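(* Let $k$ be an infinite field, let $H$ be a Hopf algebra over $k$, and let $\alpha$ be a normalized convolution-invertible two-cocycle on $H$. Let ${}^{\alpha}H$ be the twisted comodule algebra and $\mu_{\alpha} : T(X_H) \to S(t_H)\otimes {}^{\alpha}H$ the universal comodule algebra map. Then an element $P \in T(X_H)$ is an $H$-identity for ${}^{\alpha}H$ if and only if $\mu_{\alpha}(P)=0$; equivalently, $I_H({}^{\alpha}H) = \ker(\mu_{\alpha})$.
   Context: The ground field $k$ is infinite; algebras are associative unital $k$-algebras, linear maps are $k$-linear, and $\otimes=\otimes_k$. For a Hopf algebra $H$ with coproduct $\Delta$ and counit $\varepsilon$, write $\Delta(x)=x_1\otimes x_2$ (Sweedler notation, summation implicit). An $H$-comodule algebra is an algebra $A$ with a right $H$-comodule structure whose coaction $\delta:A\to A\otimes H$ is an algebra map. An $H$-comodule algebra map $f:A\to A'$ is an algebra map with $\delta'\circ f=(f\otimes \mathrm{id}_H)\circ\delta$. $X_H$ and $t_H$ are copies of the vector space underlying $H$, with identity maps $x\mapsto X_x$ and $x\mapsto t_x$. $T(X_H)$ is the tensor algebra of $X_H$; it is an $H$-comodule algebra with coaction determined by $X_x\mapsto X_{x_1}\otimes x_2$. $S(t_H)$ is the symmetric algebra of $t_H$. An element $P\in T(X_H)$ is an $H$-identity for an $H$-comodule algebra $A$ if $\mu(P)=0$ for all $H$-comodule algebra maps $\mu:T(X_H)\to A$. The set of all $H$-identities for $A$ is denoted $I_H(A)$. A two-cocycle on $H$ is a bilinear form $\alpha:H\times H\to k$ with $\alpha(x_1,y_1)\,\alpha(x_2y_2,z)=\alpha(y_1,z_1)\,\alpha(x,y_2z_2)$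 for all $x,y,z\in H$; it is normalized if $\alpha(x,1)=\alpha(1,x)=\varepsilon(x)$ for all $x\in H$. The twisted comodule algebra ${}^{\alpha}H$ is a copy $u_H$ of the vector space $H$ (with identity map $x\mapsto u_x$) with product $u_xu_y=\alpha(x_1,y_1)\,u_{x_2y_2}$, unit $u_1$, and coaction $\delta(u_x)=u_{x_1}\otimes x_2$. $S(t_H)\otimes{}^{\alpha}H$ is an $H$-comodule algebra with the $S(t_H)$-linear coaction extending that of ${}^{\alpha}H$. The universal comodule algebra map $\mu_\alpha:T(X_H)\to S(t_H)\otimes{}^{\alpha}H$ is the algebra map with $\mu_\alpha(X_x)=t_{x_1}u_{x_2}$ for all $x\in H$ (the tensor sign between $t$- and $u$-symbols is dropped). *)

theory Defs
  imports "HOL-Library.Poly_Mapping" "HOL-Algebra.Algebraic_Closure_Type" "HOL-Algebra.Algebra"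
begin

section \<open>Algebras over a field\<close>

text \<open>
  The ground field is a type \<open>'k\<close> of class \<^class>\<open>field\<close>; vector spaces and algebras over it are
  records of type \<open>('k, 'a) module\<close> with explicit carriers. For a mere vector space the
  multiplicative part of the record is irrelevant. The locale \<^locale>\<open>algebra\<close> of the library
  only covers commutative algebras.
\<close>

abbreviation base_field :: "'k::field ring"
  where "base_field \<equiv> ring_of_type_algebra"

definition base_module :: "('k::field, 'k) module"
  where "base_module = \<lparr>carrier = UNIV, monoid.mult = (*), one = 1, ring.zero = 0, ring.add = (+), module.smult = (*)\<rparr>"

locale assoc_algebra = ring A + vec: module base_field A
  for A :: "('k::field, 'a) module" (structure) +
  assumes smult_mult_left:
      "\<lbrakk>x \<in> carrier A; y \<in> carrier A\<rbrakk> \<Longrightarrow> (c \<odot> x) \<otimes> y = c \<odot> (x \<otimes> y)"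
    and smult_mult_right:
      "\<lbrakk>x \<in> carrier A; y \<in> carrier A\<rbrakk> \<Longrightarrow> x \<otimes> (c \<odot> y) = c \<odot> (x \<otimes> y)"

definition linear_hom :: "('k::field, 'a) module \<Rightarrow> ('k, 'b) module \<Rightarrow> ('a \<Rightarrow> 'b) set"
  where "linear_hom V W = {f \<in> carrier V \<rightarrow> carrier W.
    (\<forall>x\<in>carrier V. \<forall>y\<in>carrier V. f (x \<oplus>\<^bsub>V\<^esub> y) = f x \<oplus>\<^bsub>W\<^esub> f y) \<and>
    (\<forall>c. \<forall>x\<in>carrier V. f (c \<odot>\<^bsub>V\<^esub> x) = c \<odot>\<^bsub>W\<^esub> f x)}"

definition bilinear_hom ::
    "('k::field, 'a) module \<Rightarrow> ('k, 'b) module \<Rightarrow> ('k, 'c) module \<Rightarrow> ('a \<Rightarrow> 'b \<Rightarrow> 'c) set"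
  where "bilinear_hom V W U = {f.
    (\<forall>x\<in>carrier V. f x \<in> linear_hom W U) \<and>
    (\<forall>y\<in>carrier W. (\<lambda>x. f x y) \<in> linear_hom V U)}"

definition algebra_hom :: "('k::field, 'a) module \<Rightarrow> ('k, 'b) module \<Rightarrow> ('a \<Rightarrow> 'b) set"
  where "algebra_hom A B = ring_hom A B \<inter> linear_hom A B"

definition subspace_span :: "('k::field, 'a) module \<Rightarrow> 'a set \<Rightarrow> 'a set"
  where "subspace_span V S = \<Inter>{U. submodule U base_field V \<and> S \<subseteq> U}"

text \<open>
  The quotient by \<open>I\<close>, as a vector space if \<open>I\<close> is a subspace and as an algebra if \<open>I\<close> is
  moreover a two-sided ideal. It is \<^term>\<open>A Quot I\<close> with scalar multiplication added.
\<close>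

definition quotient_algebra :: "('k::field, 'a) module \<Rightarrow> 'a set \<Rightarrow> ('k, 'a set) module"
  where "quotient_algebra A I =
    \<lparr>carrier = a_rcosets\<^bsub>A\<^esub> I, monoid.mult = rcoset_mult A I, one = I +>\<^bsub>A\<^esub> \<one>\<^bsub>A\<^esub>, ring.zero = I,
     ring.add = set_add A, module.smult = (\<lambda>c C. \<Union>x\<in>C. I +>\<^bsub>A\<^esub> (c \<odot>\<^bsub>A\<^esub> x))\<rparr>"

text \<open>
  The vector space with basis \<^term>\<open>carrier M\<close>, multiplied by extending the operation of \<open>M\<close>
  bilinearly.
\<close>

definition monoid_algebra :: "('x, 'm) monoid_scheme \<Rightarrow> ('k::field, 'x \<Rightarrow>\<^sub>0 'k) module"
  where "monoid_algebra M =
    \<lparr>carrier = {p. Poly_Mapping.keys p \<subseteq> carrier M},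
     monoid.mult = (\<lambda>p q. \<Sum>x\<in>Poly_Mapping.keys p. \<Sum>y\<in>Poly_Mapping.keys q.
       Poly_Mapping.single (x \<otimes>\<^bsub>M\<^esub> y) (Poly_Mapping.lookup p x * Poly_Mapping.lookup q y)),
     one = Poly_Mapping.single \<one>\<^bsub>M\<^esub> 1, ring.zero = 0, ring.add = (+),
     module.smult = (\<lambda>c. Poly_Mapping.map ((*) c))\<rparr>"


section \<open>Tensor products\<close>

definition tensor_relations ::
    "('k::field, 'a) module \<Rightarrow> ('k, 'b) module \<Rightarrow> ('a \<times> 'b \<Rightarrow>\<^sub>0 'k) set"
  where "tensor_relations V W =
    {Poly_Mapping.single (x \<oplus>\<^bsub>V\<^esub> x', y) 1 - Poly_Mapping.single (x, y) 1
        - Poly_Mapping.single (x', y) 1 | x x' y.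
      x \<in> carrier V \<and> x' \<in> carrier V \<and> y \<in> carrier W} \<union>
    {Poly_Mapping.single (x, y \<oplus>\<^bsub>W\<^esub> y') 1 - Poly_Mapping.single (x, y) 1
        - Poly_Mapping.single (x, y') 1 | x y y'.
      x \<in> carrier V \<and> y \<in> carrier W \<and> y' \<in> carrier W} \<union>
    {Poly_Mapping.single (c \<odot>\<^bsub>V\<^esub> x, y) 1 - Poly_Mapping.single (x, y) c | c x y.
      x \<in> carrier V \<and> y \<in> carrier W} \<union>
    {Poly_Mapping.single (x, c \<odot>\<^bsub>W\<^esub> y) 1 - Poly_Mapping.single (x, y) c | c x y.
      x \<in> carrier V \<and> y \<in> carrier W}"

definition tensor_kernel ::
    "('k::field, 'a) module \<Rightarrow> ('k, 'b) module \<Rightarrow> ('a \<times> 'b \<Rightarrow>\<^sub>0 'k) set"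
  where "tensor_kernel V W = subspace_span (monoid_algebra (V \<times>\<times> W)) (tensor_relations V W)"

text \<open>
  If \<open>V\<close> and \<open>W\<close> are algebras, this carries the usual product
  \<open>(x \<otimes> y) (x' \<otimes> y') = x x' \<otimes> y y'\<close>, inherited from the direct product of monoids.
\<close>

definition tensor ::
    "('k::field, 'a) module \<Rightarrow> ('k, 'b) module \<Rightarrow> ('k, ('a \<times> 'b \<Rightarrow>\<^sub>0 'k) set) module"
  where "tensor V W = quotient_algebra (monoid_algebra (V \<times>\<times> W)) (tensor_kernel V W)"

definition pure_tensor ::
    "('k::field, 'a) module \<Rightarrow> ('k, 'b) module \<Rightarrow> 'a \<Rightarrow> 'b \<Rightarrow> ('a \<times> 'b \<Rightarrow>\<^sub>0 'k) set"
  where "pure_tensor V W x y =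
    tensor_kernel V W +>\<^bsub>monoid_algebra (V \<times>\<times> W)\<^esub> Poly_Mapping.single (x, y) 1"

text \<open>
  The image of a tensor under the linear map to \<open>U\<close> induced by a bilinear map \<open>f\<close>, computed on
  the representing formal sums; it does not depend on the representative if \<open>f\<close> is bilinear.
  Sweedler notation becomes an instance: the element of \<open>U\<close> written \<open>f(x\<^sub>1, x\<^sub>2)\<close> is
  \<open>tensor_lift U (\<lambda>x1 x2. f x1 x2) (\<Delta> x)\<close>.
\<close>

definition tensor_lift ::
    "('k::field, 'c) module \<Rightarrow> ('a \<Rightarrow> 'b \<Rightarrow> 'c) \<Rightarrow> ('a \<times> 'b \<Rightarrow>\<^sub>0 'k) set \<Rightarrow> 'c"
  where "tensor_lift U f C =
    the_elem ((\<lambda>p. \<Oplus>\<^bsub>U\<^esub>z\<in>Poly_Mapping.keys p. Poly_Mapping.lookup p z \<odot>\<^bsub>U\<^esub> f (fst z) (snd z)) ` C)"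


section \<open>Tensor algebra and symmetric algebra\<close>

text \<open>
  The tensor algebra of \<open>V\<close> is the free associative algebra on symbols \<open>X\<^sub>x\<close>, one for each
  \<^term>\<open>x \<in> carrier V\<close>, modulo the relations making \<open>x \<mapsto> X\<^sub>x\<close> linear.
\<close>

definition word_monoid :: "('k, 'a) module \<Rightarrow> 'a list monoid"
  where "word_monoid V = \<lparr>carrier = lists (carrier V), monoid.mult = (@), one = []\<rparr>"

definition generator_relations :: "('k::field, 'a) module \<Rightarrow> ('a list \<Rightarrow>\<^sub>0 'k) set"
  where "generator_relations V =
    {Poly_Mapping.single [x \<oplus>\<^bsub>V\<^esub> y] 1 - Poly_Mapping.single [x] 1 - Poly_Mapping.single [y] 1
      | x y. x \<in> carrier V \<and> y \<in> carrier V} \<union>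
    {Poly_Mapping.single [c \<odot>\<^bsub>V\<^esub> x] 1 - Poly_Mapping.single [x] c | c x. x \<in> carrier V}"

definition tensor_algebra_kernel :: "('k::field, 'a) module \<Rightarrow> ('a list \<Rightarrow>\<^sub>0 'k) set"
  where "tensor_algebra_kernel V = Idl\<^bsub>monoid_algebra (word_monoid V)\<^esub> (generator_relations V)"

definition tensor_algebra :: "('k::field, 'a) module \<Rightarrow> ('k, ('a list \<Rightarrow>\<^sub>0 'k) set) module"
  where "tensor_algebra V =
    quotient_algebra (monoid_algebra (word_monoid V)) (tensor_algebra_kernel V)"

definition tensor_gen :: "('k::field, 'a) module \<Rightarrow> 'a \<Rightarrow> ('a list \<Rightarrow>\<^sub>0 'k) set"
  where "tensor_gen V x =
    tensor_algebra_kernel V +>\<^bsub>monoid_algebra (word_monoid V)\<^esub> Poly_Mapping.single [x] 1"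

text \<open>The algebra map to \<open>A\<close> that extends a linear map \<open>f\<close> defined on the generators.\<close>

definition tensor_algebra_lift ::
    "('k::field, 'b) module \<Rightarrow> ('a \<Rightarrow> 'b) \<Rightarrow> ('a list \<Rightarrow>\<^sub>0 'k) set \<Rightarrow> 'b"
  where "tensor_algebra_lift A f C =
    the_elem ((\<lambda>p. \<Oplus>\<^bsub>A\<^esub>w\<in>Poly_Mapping.keys p. Poly_Mapping.lookup p w \<odot>\<^bsub>A\<^esub> foldr (\<lambda>x a. f x \<otimes>\<^bsub>A\<^esub> a) w \<one>\<^bsub>A\<^esub>) ` C)"

definition commutator_ideal :: "('k::field, 'a) module \<Rightarrow> ('a list \<Rightarrow>\<^sub>0 'k) set set"
  where "commutator_ideal V = Idl\<^bsub>tensor_algebra V\<^esub>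
    {tensor_gen V x \<otimes>\<^bsub>tensor_algebra V\<^esub> tensor_gen V y \<ominus>\<^bsub>tensor_algebra V\<^esub>
      tensor_gen V y \<otimes>\<^bsub>tensor_algebra V\<^esub> tensor_gen V x | x y. x \<in> carrier V \<and> y \<in> carrier V}"

definition symmetric_algebra ::
    "('k::field, 'a) module \<Rightarrow> ('k, ('a list \<Rightarrow>\<^sub>0 'k) set set) module"
  where "symmetric_algebra V = quotient_algebra (tensor_algebra V) (commutator_ideal V)"

definition symmetric_gen :: "('k::field, 'a) module \<Rightarrow> 'a \<Rightarrow> ('a list \<Rightarrow>\<^sub>0 'k) set set"
  where "symmetric_gen V x = commutator_ideal V +>\<^bsub>tensor_algebra V\<^esub> tensor_gen V x"


section \<open>Hopf algebras and comodule algebras\<close>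

text \<open>
  Coassociativity is stated in \<open>(V \<otimes> H) \<otimes> H\<close>; its right-hand side is \<open>(id \<otimes> \<Delta>) \<circ> \<delta>\<close> followed by
  the associativity isomorphism.
\<close>

definition coassociative_coaction ::
    "('k::field, 'h) module \<Rightarrow> ('h \<Rightarrow> ('h \<times> 'h \<Rightarrow>\<^sub>0 'k) set) \<Rightarrow>
     ('k, 'a) module \<Rightarrow> ('a \<Rightarrow> ('a \<times> 'h \<Rightarrow>\<^sub>0 'k) set) \<Rightarrow> bool"
  where "coassociative_coaction H \<Delta> V \<delta> \<longleftrightarrow> (\<forall>v\<in>carrier V.
    tensor_lift (tensor (tensor V H) H) (\<lambda>v0 v1. pure_tensor (tensor V H) H (\<delta> v0) v1) (\<delta> v) =
    tensor_lift (tensor (tensor V H) H)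
      (\<lambda>v0 v1. tensor_lift (tensor (tensor V H) H)
        (\<lambda>x1 x2. pure_tensor (tensor V H) H (pure_tensor V H v0 x1) x2) (\<Delta> v1)) (\<delta> v))"

definition counital_coaction ::
    "('h \<Rightarrow> 'k) \<Rightarrow> ('k::field, 'a) module \<Rightarrow> ('a \<Rightarrow> ('a \<times> 'h \<Rightarrow>\<^sub>0 'k) set) \<Rightarrow> bool"
  where "counital_coaction \<epsilon> V \<delta> \<longleftrightarrow>
    (\<forall>v\<in>carrier V. tensor_lift V (\<lambda>v0 v1. \<epsilon> v1 \<odot>\<^bsub>V\<^esub> v0) (\<delta> v) = v)"

locale hopf_algebra = assoc_algebra H
  for H :: "('k::field, 'h) module" (structure) +
  fixes \<Delta> :: "'h \<Rightarrow> ('h \<times> 'h \<Rightarrow>\<^sub>0 'k) set" and \<epsilon> :: "'h \<Rightarrow> 'k" and S :: "'h \<Rightarrow> 'h"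
  assumes comult_hom: "\<Delta> \<in> algebra_hom H (tensor H H)"
    and counit_hom: "\<epsilon> \<in> algebra_hom H base_module"
    and coassoc: "coassociative_coaction H \<Delta> H \<Delta>"
    and counit_right: "counital_coaction \<epsilon> H \<Delta>"
    and counit_left: "x \<in> carrier H \<Longrightarrow> tensor_lift H (\<lambda>x1 x2. \<epsilon> x1 \<odot> x2) (\<Delta> x) = x"
    and antipode_linear: "S \<in> linear_hom H H"
    and antipode_left: "x \<in> carrier H \<Longrightarrow> tensor_lift H (\<lambda>x1 x2. S x1 \<otimes> x2) (\<Delta> x) = \<epsilon> x \<odot> \<one>"
    and antipode_right: "x \<in> carrier H \<Longrightarrow> tensor_lift H (\<lambda>x1 x2. x1 \<otimes> S x2) (\<Delta> x) = \<epsilon> x \<odot> \<one>"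

locale comodule_algebra = hopf_algebra H \<Delta> \<epsilon> S + alg: assoc_algebra A
  for H :: "('k::field, 'h) module" and \<Delta> \<epsilon> S and A :: "('k, 'a) module" +
  fixes \<delta> :: "'a \<Rightarrow> ('a \<times> 'h \<Rightarrow>\<^sub>0 'k) set"
  assumes coaction_hom: "\<delta> \<in> algebra_hom A (tensor A H)"
    and coaction_coassoc: "coassociative_coaction H \<Delta> A \<delta>"
    and coaction_counit: "counital_coaction \<epsilon> A \<delta>"

definition comodule_algebra_hom ::
    "('k::field, 'h) module \<Rightarrow> ('k, 'a) module \<Rightarrow> ('a \<Rightarrow> ('a \<times> 'h \<Rightarrow>\<^sub>0 'k) set) \<Rightarrow>
     ('k, 'b) module \<Rightarrow> ('b \<Rightarrow> ('b \<times> 'h \<Rightarrow>\<^sub>0 'k) set) \<Rightarrow> ('a \<Rightarrow> 'b) set"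
  where "comodule_algebra_hom H A \<delta> A' \<delta>' = {f \<in> algebra_hom A A'. \<forall>a\<in>carrier A.
    \<delta>' (f a) = tensor_lift (tensor A' H) (\<lambda>a0 a1. pure_tensor A' H (f a0) a1) (\<delta> a)}"

definition tensor_algebra_coaction ::
    "('k::field, 'h) module \<Rightarrow> ('h \<Rightarrow> ('h \<times> 'h \<Rightarrow>\<^sub>0 'k) set) \<Rightarrow>
     ('h list \<Rightarrow>\<^sub>0 'k) set \<Rightarrow> (('h list \<Rightarrow>\<^sub>0 'k) set \<times> 'h \<Rightarrow>\<^sub>0 'k) set"
  where "tensor_algebra_coaction H \<Delta> =
    tensor_algebra_lift (tensor (tensor_algebra H) H)
      (\<lambda>x. tensor_lift (tensor (tensor_algebra H) H)
        (\<lambda>x1 x2. pure_tensor (tensor_algebra H) H (tensor_gen H x1) x2) (\<Delta> x))"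


section \<open>Identities\<close>

text \<open>
  Meant for a comodule algebra \<open>A\<close> with coaction \<open>\<delta>\<close> in the sense of \<^locale>\<open>comodule_algebra\<close>;
  the definitions themselves do not need the axioms.
\<close>

definition H_identity ::
    "('k::field, 'h) module \<Rightarrow> ('h \<Rightarrow> ('h \<times> 'h \<Rightarrow>\<^sub>0 'k) set) \<Rightarrow>
     ('k, 'a) module \<Rightarrow> ('a \<Rightarrow> ('a \<times> 'h \<Rightarrow>\<^sub>0 'k) set) \<Rightarrow> ('h list \<Rightarrow>\<^sub>0 'k) set \<Rightarrow> bool"
  where "H_identity H \<Delta> A \<delta> P \<longleftrightarrow> P \<in> carrier (tensor_algebra H) \<and>
    (\<forall>\<mu> \<in> comodule_algebra_hom H (tensor_algebra H) (tensor_algebra_coaction H \<Delta>) A \<delta>.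
      \<mu> P = \<zero>\<^bsub>A\<^esub>)"

definition H_identities ::
    "('k::field, 'h) module \<Rightarrow> ('h \<Rightarrow> ('h \<times> 'h \<Rightarrow>\<^sub>0 'k) set) \<Rightarrow>
     ('k, 'a) module \<Rightarrow> ('a \<Rightarrow> ('a \<times> 'h \<Rightarrow>\<^sub>0 'k) set) \<Rightarrow> ('h list \<Rightarrow>\<^sub>0 'k) set set"
  where "H_identities H \<Delta> A \<delta> = {P. H_identity H \<Delta> A \<delta> P}"


section \<open>Two-cocycles and twisted comodule algebras\<close>

definition two_cocycle ::
    "('k::field, 'h) module \<Rightarrow> ('h \<Rightarrow> ('h \<times> 'h \<Rightarrow>\<^sub>0 'k) set) \<Rightarrow> ('h \<Rightarrow> 'h \<Rightarrow> 'k) \<Rightarrow> bool"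
  where "two_cocycle H \<Delta> \<alpha> \<longleftrightarrow> \<alpha> \<in> bilinear_hom H H base_module \<and>
    (\<forall>x\<in>carrier H. \<forall>y\<in>carrier H. \<forall>z\<in>carrier H.
      tensor_lift base_module (\<lambda>x1 x2. tensor_lift base_module
        (\<lambda>y1 y2. \<alpha> x1 y1 * \<alpha> (x2 \<otimes>\<^bsub>H\<^esub> y2) z) (\<Delta> y)) (\<Delta> x) =
      tensor_lift base_module (\<lambda>y1 y2. tensor_lift base_module
        (\<lambda>z1 z2. \<alpha> y1 z1 * \<alpha> x (y2 \<otimes>\<^bsub>H\<^esub> z2)) (\<Delta> z)) (\<Delta> y))"

definition normalized_cocycle ::
    "('k::field, 'h) module \<Rightarrow> ('h \<Rightarrow> 'k) \<Rightarrow> ('h \<Rightarrow> 'h \<Rightarrow> 'k) \<Rightarrow> bool"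
  where "normalized_cocycle H \<epsilon> \<alpha> \<longleftrightarrow>
    (\<forall>x\<in>carrier H. \<alpha> x \<one>\<^bsub>H\<^esub> = \<epsilon> x \<and> \<alpha> \<one>\<^bsub>H\<^esub> x = \<epsilon> x)"

definition convolution ::
    "('h \<Rightarrow> ('h \<times> 'h \<Rightarrow>\<^sub>0 'k::field) set) \<Rightarrow> ('h \<Rightarrow> 'h \<Rightarrow> 'k) \<Rightarrow> ('h \<Rightarrow> 'h \<Rightarrow> 'k) \<Rightarrow> 'h \<Rightarrow> 'h \<Rightarrow> 'k"
  where "convolution \<Delta> \<alpha> \<beta> x y =
    tensor_lift base_module (\<lambda>x1 x2. tensor_lift base_module
      (\<lambda>y1 y2. \<alpha> x1 y1 * \<beta> x2 y2) (\<Delta> y)) (\<Delta> x)"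

definition convolution_invertible ::
    "('k::field, 'h) module \<Rightarrow> ('h \<Rightarrow> ('h \<times> 'h \<Rightarrow>\<^sub>0 'k) set) \<Rightarrow> ('h \<Rightarrow> 'k) \<Rightarrow>
     ('h \<Rightarrow> 'h \<Rightarrow> 'k) \<Rightarrow> bool"
  where "convolution_invertible H \<Delta> \<epsilon> \<alpha> \<longleftrightarrow> (\<exists>\<beta> \<in> bilinear_hom H H base_module.
    \<forall>x\<in>carrier H. \<forall>y\<in>carrier H.
      convolution \<Delta> \<alpha> \<beta> x y = \<epsilon> x * \<epsilon> y \<and> convolution \<Delta> \<beta> \<alpha> x y = \<epsilon> x * \<epsilon> y)"

text \<open>The symbol \<open>u\<^sub>x\<close> is \<open>x\<close> itself, viewed as an element of the twisted algebra.\<close>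

definition twisted_algebra ::
    "('k::field, 'h) module \<Rightarrow> ('h \<Rightarrow> ('h \<times> 'h \<Rightarrow>\<^sub>0 'k) set) \<Rightarrow> ('h \<Rightarrow> 'h \<Rightarrow> 'k) \<Rightarrow>
     ('k, 'h) module"
  where "twisted_algebra H \<Delta> \<alpha> = H\<lparr>monoid.mult :=
    (\<lambda>x y. tensor_lift H (\<lambda>x1 x2. tensor_lift H
      (\<lambda>y1 y2. \<alpha> x1 y1 \<odot>\<^bsub>H\<^esub> (x2 \<otimes>\<^bsub>H\<^esub> y2)) (\<Delta> y)) (\<Delta> x))\<rparr>"

definition twisted_coaction ::
    "('k::field, 'h) module \<Rightarrow> ('h \<Rightarrow> ('h \<times> 'h \<Rightarrow>\<^sub>0 'k) set) \<Rightarrow> ('h \<Rightarrow> 'h \<Rightarrow> 'k) \<Rightarrow>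
     'h \<Rightarrow> ('h \<times> 'h \<Rightarrow>\<^sub>0 'k) set"
  where "twisted_coaction H \<Delta> \<alpha> x =
    tensor_lift (tensor (twisted_algebra H \<Delta> \<alpha>) H)
      (\<lambda>x1 x2. pure_tensor (twisted_algebra H \<Delta> \<alpha>) H x1 x2) (\<Delta> x)"

definition universal_target ::
    "('k::field, 'h) module \<Rightarrow> ('h \<Rightarrow> ('h \<times> 'h \<Rightarrow>\<^sub>0 'k) set) \<Rightarrow> ('h \<Rightarrow> 'h \<Rightarrow> 'k) \<Rightarrow>
     ('k, (('h list \<Rightarrow>\<^sub>0 'k) set set \<times> 'h \<Rightarrow>\<^sub>0 'k) set) module"
  where "universal_target H \<Delta> \<alpha> = tensor (symmetric_algebra H) (twisted_algebra H \<Delta> \<alpha>)"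

definition universal_map ::
    "('k::field, 'h) module \<Rightarrow> ('h \<Rightarrow> ('h \<times> 'h \<Rightarrow>\<^sub>0 'k) set) \<Rightarrow> ('h \<Rightarrow> 'h \<Rightarrow> 'k) \<Rightarrow>
     ('h list \<Rightarrow>\<^sub>0 'k) set \<Rightarrow> (('h list \<Rightarrow>\<^sub>0 'k) set set \<times> 'h \<Rightarrow>\<^sub>0 'k) set"
  where "universal_map H \<Delta> \<alpha> =
    tensor_algebra_lift (universal_target H \<Delta> \<alpha>)
      (\<lambda>x. tensor_lift (universal_target H \<Delta> \<alpha>)
        (\<lambda>x1 x2. pure_tensor (symmetric_algebra H) (twisted_algebra H \<Delta> \<alpha>)
          (symmetric_gen H x1) x2) (\<Delta> x))"

end

theory Submission
  imports Defs
begin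

text \<open>
  A linear form \<open>l\<close> on \<open>H\<close> extends to a character of \<open>S(t\<^sub>H)\<close>, and applying this character to the
  coefficients of \<open>\<mu>\<^sub>\<alpha>\<close> gives a comodule algebra map \<open>\<mu>\<^sub>l\<close> with \<open>X\<^sub>x \<mapsto> l(x\<^sub>1) u\<^bsub>x\<^sub>2\<^esub>\<close>. Every comodule
  algebra map \<open>\<mu>\<close> is of this form, with \<open>l(x) = \<epsilon>(\<mu>(X\<^sub>x))\<close>: apply \<open>\<epsilon> \<otimes> id\<close> to the colinearity of
  \<open>\<mu>\<close> on \<open>X\<^sub>x\<close>. So the identities are the elements \<open>P\<close> for which \<open>\<mu>\<^sub>\<alpha>(P)\<close> is killed by all these
  specializations. As \<open>k\<close> is infinite and \<open>S(t\<^sub>H)\<close> is spanned by monomials in a basis of \<open>H\<close>, a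
  polynomial that vanishes at all points is zero, whence \<open>\<mu>\<^sub>\<alpha>(P) = 0\<close>.
\<close>

text \<open>Two universal properties explain why linear forms classify the maps \<mu>. T(X_H) is
  free on the comodule H, so a comodule algebra map out of it is a colinear map from H to the
  twisted algebra; as a comodule the latter is H itself, which is cofree on k, so a colinear map
  into it is a linear form. Linear forms are also the points at which S(t_H) is evaluated, which
  makes the universal map their generic member. The cocycle enters in associativity of the twisted
  product and multiplicativity of its coaction; both rest on one rebracketed formula for the
  coproduct of a twisted product. Vanishing in the tensor product of S(t_H) with the twisted algebra
  is tested in two stages: functionals on the second factor lead to S(t_H), and evaluation there
  leads to polynomials over k. For H = k with q elements, X^q - X would be an identity outside the
  kernel, so infinity of k is essential. The obstacle that shapes the development is that all
  algebras are explicit quotients on carriers: maps out of them are computed on representatives, and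
  testing by functionals requires bases of arbitrary carriers.\<close>

abbreviation "keys \<equiv> Poly_Mapping.keys"
abbreviation "lookup \<equiv> Poly_Mapping.lookup"
abbreviation "single \<equiv> Poly_Mapping.single"

section \<open>Linear maps\<close>

lemma base_field_simps [simp]:
  "carrier base_field = UNIV" "\<one>\<^bsub>base_field\<^esub> = (1::'k::field)" "\<zero>\<^bsub>base_field\<^esub> = (0::'k)"
  "(a::'k) \<oplus>\<^bsub>base_field\<^esub> b = a + b" "a \<otimes>\<^bsub>base_field\<^esub> b = a * b"
  by (simp_all add: ring_of_type_algebra_def)

lemma base_module_simps [simp]:
  "carrier base_module = UNIV" "\<one>\<^bsub>base_module\<^esub> = (1::'k::field)" "\<zero>\<^bsub>base_module\<^esub> = (0::'k)"
  "(a::'k) \<oplus>\<^bsub>base_module\<^esub> b = a + b" "a \<otimes>\<^bsub>base_module\<^esub> b = a * b" "a \<odot>\<^bsub>base_module\<^esub> b = a * b"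
  by (simp_all add: base_module_def)

text \<open>A module over \<open>base_field\<close>, renamed so that its laws can be restated
  without side conditions on scalars: here every element of the scalar type is a scalar.\<close>

locale vspace = module base_field V for V :: "('k::field, 'a) module" (structure)
begin

lemma scale_closed [simp, intro]: "x \<in> carrier V \<Longrightarrow> c \<odot> x \<in> carrier V"
  using smult_closed[of c x] by simp

lemma scale_add_left: "x \<in> carrier V \<Longrightarrow> (a + b) \<odot> x = a \<odot> x \<oplus> b \<odot> x"
  using smult_l_distr[of a b x] by simp

lemma scale_add_right:
  "x \<in> carrier V \<Longrightarrow> y \<in> carrier V \<Longrightarrow> c \<odot> (x \<oplus> y) = c \<odot> x \<oplus> c \<odot> y"
  using smult_r_distr[of c x y] by simp

lemma scale_scale: "x \<in> carrier V \<Longrightarrow> a \<odot> (b \<odot> x) = (a * b) \<odot> x"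
  using smult_assoc1[of a b x] by simp

lemma scale_one [simp]: "x \<in> carrier V \<Longrightarrow> 1 \<odot> x = x"
  using smult_one[of x] by simp

lemma scale_zero_left [simp]: "x \<in> carrier V \<Longrightarrow> 0 \<odot> x = \<zero>"
  using smult_l_null[of x] by simp

lemma scale_zero_right [simp]: "c \<odot> \<zero> = \<zero>"
  using smult_r_null[of c] by simp

lemma scale_minus_one: "x \<in> carrier V \<Longrightarrow> (-1) \<odot> x = \<ominus> x"
  using scale_add_left[of x "-1" 1] using minus_equality[of "(-1) \<odot> x" x] by simp

lemma minus_eq_scale: "x \<in> carrier V \<Longrightarrow> y \<in> carrier V \<Longrightarrow> x \<ominus> y = x \<oplus> (-1) \<odot> y"
  by (simp add: scale_minus_one a_minus_def)

end

sublocale assoc_algebra \<subseteq> vspace A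
  by unfold_locales

lemma assoc_algebra_vspace: "assoc_algebra V \<Longrightarrow> vspace V"
  by (rule vspace.intro[OF assoc_algebra.axioms(2)])

lemma assoc_algebraI:
  assumes "ring A"
    and "\<And>c x. x \<in> carrier A \<Longrightarrow> c \<odot>\<^bsub>A\<^esub> x \<in> carrier A"
    and "\<And>a b x. x \<in> carrier A \<Longrightarrow> (a + b) \<odot>\<^bsub>A\<^esub> x = a \<odot>\<^bsub>A\<^esub> x \<oplus>\<^bsub>A\<^esub> b \<odot>\<^bsub>A\<^esub> x"
    and "\<And>c x y. x \<in> carrier A \<Longrightarrow> y \<in> carrier A \<Longrightarrow> c \<odot>\<^bsub>A\<^esub> (x \<oplus>\<^bsub>A\<^esub> y) = c \<odot>\<^bsub>A\<^esub> x \<oplus>\<^bsub>A\<^esub> c \<odot>\<^bsub>A\<^esub> y"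
    and "\<And>a b x. x \<in> carrier A \<Longrightarrow> (a * b) \<odot>\<^bsub>A\<^esub> x = a \<odot>\<^bsub>A\<^esub> (b \<odot>\<^bsub>A\<^esub> x)"
    and "\<And>x. x \<in> carrier A \<Longrightarrow> 1 \<odot>\<^bsub>A\<^esub> x = x"
    and "\<And>c x y. x \<in> carrier A \<Longrightarrow> y \<in> carrier A \<Longrightarrow> (c \<odot>\<^bsub>A\<^esub> x) \<otimes>\<^bsub>A\<^esub> y = c \<odot>\<^bsub>A\<^esub> (x \<otimes>\<^bsub>A\<^esub> y)"
    and "\<And>c x y. x \<in> carrier A \<Longrightarrow> y \<in> carrier A \<Longrightarrow> x \<otimes>\<^bsub>A\<^esub> (c \<odot>\<^bsub>A\<^esub> y) = c \<odot>\<^bsub>A\<^esub> (x \<otimes>\<^bsub>A\<^esub> y)"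
  shows "assoc_algebra (A :: ('k::field, 'a) module)"
proof -
  have "cring (base_field :: 'k ring)" by (rule cring_from_type_algebra)
  moreover have "abelian_group A" using assms(1) by (rule ring.is_abelian_group)
  ultimately have "module base_field A"
    by (rule moduleI) (simp_all add: assms)
  thus ?thesis using assms(1,7,8)
    by (intro assoc_algebra.intro assoc_algebra_axioms.intro) auto
qed

lemma base_module_algebra: "assoc_algebra (base_module :: ('k::field, 'k) module)"
proof (rule assoc_algebraI)
  show "ring (base_module :: ('k, 'k) module)"
    by (rule ringI, rule abelian_groupI, auto intro!: monoidI exI[of _ "- _"] simp: algebra_simps)
qed (auto simp: algebra_simps)

lemma linear_homI:
  assumes "\<And>x. x \<in> carrier V \<Longrightarrow> f x \<in> carrier W"
    and "\<And>x y. x \<in> carrier V \<Longrightarrow> y \<in> carrier V \<Longrightarrow> f (x \<oplus>\<^bsub>V\<^esub> y) = f x \<oplus>\<^bsub>W\<^esub> f y"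
    and "\<And>c x. x \<in> carrier V \<Longrightarrow> f (c \<odot>\<^bsub>V\<^esub> x) = c \<odot>\<^bsub>W\<^esub> f x"
  shows "f \<in> linear_hom V W"
  using assms by (auto simp: linear_hom_def)

lemma linear_hom_closed: "f \<in> linear_hom V W \<Longrightarrow> x \<in> carrier V \<Longrightarrow> f x \<in> carrier W"
  and linear_hom_add: "f \<in> linear_hom V W \<Longrightarrow> x \<in> carrier V \<Longrightarrow> y \<in> carrier V \<Longrightarrow>
    f (x \<oplus>\<^bsub>V\<^esub> y) = f x \<oplus>\<^bsub>W\<^esub> f y"
  and linear_hom_scale: "f \<in> linear_hom V W \<Longrightarrow> x \<in> carrier V \<Longrightarrow> f (c \<odot>\<^bsub>V\<^esub> x) = c \<odot>\<^bsub>W\<^esub> f x"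
  by (auto simp: linear_hom_def)

lemma linear_hom_compose:
  "f \<in> linear_hom V W \<Longrightarrow> g \<in> linear_hom W U \<Longrightarrow> (\<lambda>x. g (f x)) \<in> linear_hom V U"
  by (auto simp: linear_hom_def Pi_iff)

lemma linear_hom_zero:
  assumes "vspace V" "vspace W" "f \<in> linear_hom V W"
  shows "f \<zero>\<^bsub>V\<^esub> = \<zero>\<^bsub>W\<^esub>"
proof -
  interpret V: vspace V by fact
  interpret W: vspace W by fact
  have "f (0 \<odot>\<^bsub>V\<^esub> \<zero>\<^bsub>V\<^esub>) = 0 \<odot>\<^bsub>W\<^esub> f \<zero>\<^bsub>V\<^esub>"
    using assms(3) by (intro linear_hom_scale) auto
  thus ?thesis using linear_hom_closed[OF assms(3), of "\<zero>\<^bsub>V\<^esub>"] by simp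
qed

lemma linear_hom_minus:
  assumes "vspace V" "vspace W" "f \<in> linear_hom V W" "x \<in> carrier V" "y \<in> carrier V"
  shows "f (x \<ominus>\<^bsub>V\<^esub> y) = f x \<ominus>\<^bsub>W\<^esub> f y"
proof -
  interpret V: vspace V by fact
  interpret W: vspace W by fact
  show ?thesis using assms(3-5)
    by (simp add: V.minus_eq_scale W.minus_eq_scale linear_hom_add linear_hom_scale linear_hom_closed)
qed

lemma linear_hom_finsum:
  assumes "vspace V" "vspace W" "f \<in> linear_hom V W" "finite I" "g \<in> I \<rightarrow> carrier V"
  shows "f (\<Oplus>\<^bsub>V\<^esub>i\<in>I. g i) = (\<Oplus>\<^bsub>W\<^esub>i\<in>I. f (g i))"
proof -
  interpret V: vspace V by fact
  interpret W: vspace W by fact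
  have fc: "\<And>x. x \<in> carrier V \<Longrightarrow> f x \<in> carrier W" using assms(3) by (rule linear_hom_closed)
  show ?thesis using assms(4,5)
    by (induction rule: finite_induct)
      (auto simp: linear_hom_zero[OF assms(1-3)] linear_hom_add[OF assms(3)] Pi_iff fc)
qed

lemma base_module_finsum [simp]:
  "finite I \<Longrightarrow> (\<Oplus>\<^bsub>base_module\<^esub>i\<in>I. g i) = (\<Sum>i\<in>I. g i :: 'k::field)"
proof (induction rule: finite_induct)
  interpret assoc_algebra "base_module :: ('k, 'k) module" by (rule base_module_algebra)
  { case empty show ?case by simp }
  { case (insert i I) thus ?case by simp }
qed

lemma algebra_homI:
  assumes "f \<in> linear_hom A B"
    and "\<And>x y. x \<in> carrier A \<Longrightarrow> y \<in> carrier A \<Longrightarrow> f (x \<otimes>\<^bsub>A\<^esub> y) = f x \<otimes>\<^bsub>B\<^esub> f y"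
    and "f \<one>\<^bsub>A\<^esub> = \<one>\<^bsub>B\<^esub>"
  shows "f \<in> algebra_hom A B"
  using assms by (auto simp: algebra_hom_def ring_hom_def linear_hom_def)

lemma algebra_hom_linear: "f \<in> algebra_hom A B \<Longrightarrow> f \<in> linear_hom A B"
  and algebra_hom_mult: "f \<in> algebra_hom A B \<Longrightarrow> x \<in> carrier A \<Longrightarrow> y \<in> carrier A \<Longrightarrow>
    f (x \<otimes>\<^bsub>A\<^esub> y) = f x \<otimes>\<^bsub>B\<^esub> f y"
  and algebra_hom_one: "f \<in> algebra_hom A B \<Longrightarrow> f \<one>\<^bsub>A\<^esub> = \<one>\<^bsub>B\<^esub>"
  by (auto simp: algebra_hom_def ring_hom_def)

lemma algebra_hom_compose:
  "f \<in> algebra_hom A B \<Longrightarrow> g \<in> algebra_hom B C \<Longrightarrow> (\<lambda>x. g (f x)) \<in> algebra_hom A C"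
  by (auto simp: algebra_hom_def ring_hom_def linear_hom_def Pi_iff)

lemma algebra_hom_kernel_ideal:
  assumes "assoc_algebra A" "assoc_algebra B" "f \<in> algebra_hom A B"
  shows "ideal {x \<in> carrier A. f x = \<zero>\<^bsub>B\<^esub>} A"
proof -
  interpret A: assoc_algebra A by fact
  interpret B: assoc_algebra B by fact
  have "ring_hom_ring A B f"
    using assms(3) by (intro ring_hom_ringI2) (auto simp: algebra_hom_def A.ring_axioms B.ring_axioms)
  from ring_hom_ring.kernel_is_ideal[OF this] show ?thesis
    by (simp add: a_kernel_def')
qed

text \<open>Apart from closure and negatives the axioms are equations, so they pass along a
  surjection that respects the operations; negatives are images of negatives. Quotients are the
  intended use, since their operations are known on cosets of representatives.\<close>

lemma assoc_algebra_image:
  assumes "assoc_algebra A" and carr: "carrier B = h ` carrier A"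
    and add: "\<And>x y. x \<in> carrier A \<Longrightarrow> y \<in> carrier A \<Longrightarrow> h x \<oplus>\<^bsub>B\<^esub> h y = h (x \<oplus>\<^bsub>A\<^esub> y)"
    and mult: "\<And>x y. x \<in> carrier A \<Longrightarrow> y \<in> carrier A \<Longrightarrow> h x \<otimes>\<^bsub>B\<^esub> h y = h (x \<otimes>\<^bsub>A\<^esub> y)"
    and scale: "\<And>c x. x \<in> carrier A \<Longrightarrow> c \<odot>\<^bsub>B\<^esub> h x = h (c \<odot>\<^bsub>A\<^esub> x)"
    and one: "\<one>\<^bsub>B\<^esub> = h \<one>\<^bsub>A\<^esub>" and zero: "\<zero>\<^bsub>B\<^esub> = h \<zero>\<^bsub>A\<^esub>"
  shows "assoc_algebra B"
proof -
  interpret A: assoc_algebra A by fact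
  have inv: "\<exists>y\<in>carrier A. h y \<oplus>\<^bsub>B\<^esub> h x = \<zero>\<^bsub>B\<^esub>" if "x \<in> carrier A" for x
    using that by (intro bexI[of _ "\<ominus>\<^bsub>A\<^esub> x"]) (simp_all add: add zero A.l_neg)
  show ?thesis
  proof (rule assoc_algebraI)
    show "ring B"
    proof (rule ringI)
      show "abelian_group B"
      proof (rule abelian_groupI)
        fix x assume "x \<in> carrier B"
        thus "\<exists>y\<in>carrier B. y \<oplus>\<^bsub>B\<^esub> x = \<zero>\<^bsub>B\<^esub>" using inv by (auto simp: carr)
      qed (auto simp: carr add zero A.add.m_ac)
      show "Group.monoid B"
        by (rule monoidI) (auto simp: carr mult one A.m_assoc)
    qed (auto simp: carr add mult A.l_distr A.r_distr)
  qed (auto simp: carr add mult scale A.scale_add_left A.scale_add_right A.scale_scale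
      A.smult_mult_left A.smult_mult_right)
qed

section \<open>Free vector spaces and monoid algebras\<close>

text \<open>The linear extension of \<open>f\<close> to formal sums, written exactly as the
  expression under \<open>the_elem\<close> in \<open>tensor_lift\<close> and, with word products in
  place of \<open>f\<close>, in \<open>tensor_algebra_lift\<close>. Folding it turns both into lifts
  along a quotient.\<close>

definition lin_ext :: "('k::field, 'a) module \<Rightarrow> ('x \<Rightarrow> 'a) \<Rightarrow> ('x \<Rightarrow>\<^sub>0 'k) \<Rightarrow> 'a"
  where "lin_ext U f p =
    (\<Oplus>\<^bsub>U\<^esub>z\<in>keys p. lookup p z \<odot>\<^bsub>U\<^esub> f z)"

lemma lin_ext_base: "lin_ext base_module f p = (\<Sum>z\<in>keys p. lookup p z * f z)"
  by (simp add: lin_ext_def)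

lemma lookup_scale [simp]: "lookup (Poly_Mapping.map ((*) (c::'k::field)) p) z = c * lookup p z"
  by (simp add: map.rep_eq when_def)

lemma scale_zero_poly_mapping [simp]: "Poly_Mapping.map ((*) (c::'k::field)) 0 = 0"
  by (rule poly_mapping_eqI) simp

lemma keys_scale_subset: "keys (Poly_Mapping.map ((*) (c::'k::field)) p) \<subseteq> keys p"
  by (auto simp: in_keys_iff)

lemma monoid_algebra_simps [simp]:
  "carrier (monoid_algebra M) = {p. keys p \<subseteq> carrier M}"
  "\<one>\<^bsub>monoid_algebra M\<^esub> = single \<one>\<^bsub>M\<^esub> 1"
  "\<zero>\<^bsub>monoid_algebra M\<^esub> = 0"
  "p \<oplus>\<^bsub>monoid_algebra M\<^esub> q = p + q"
  "c \<odot>\<^bsub>monoid_algebra M\<^esub> p = Poly_Mapping.map ((*) c) p"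
  by (simp_all add: monoid_algebra_def)

lemma keys_add_subset:
  "keys p \<subseteq> D \<Longrightarrow> keys q \<subseteq> D \<Longrightarrow> keys (p + q) \<subseteq> D"
  using keys_add[of p q] by blast

text \<open>A formal sum is the finite sum of its one-term pieces. The case \<open>zero\<close> is
  separate because \<open>D\<close> may be empty.\<close>

lemma free_induct [consumes 1, case_names single add zero]:
  fixes p :: "'x \<Rightarrow>\<^sub>0 'k::field"
  assumes "keys p \<subseteq> D"
    and "\<And>x c. x \<in> D \<Longrightarrow> P (single x c)"
    and "\<And>p q. keys p \<subseteq> D \<Longrightarrow> keys q \<subseteq> D \<Longrightarrow> P p \<Longrightarrow> P q \<Longrightarrow> P (p + q)"
    and "P 0"
  shows "P p"
proof -
  have eq: "p = (\<Sum>x\<in>keys p. single x (lookup p x))"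
    by (rule poly_mapping_eqI)
      (auto simp: lookup_sum lookup_single when_def in_keys_iff sum.delta')
  \<comment> \<open>The bound on the support is proved along with \<open>P\<close>, since the rule
    for sums demands it of both summands.\<close>
  have "finite K \<Longrightarrow> K \<subseteq> D \<Longrightarrow> P (\<Sum>x\<in>K. single x (lookup p x)) \<and>
      keys (\<Sum>x\<in>K. single x (lookup p x)) \<subseteq> D" for K
  proof (induction rule: finite_induct)
    case empty thus ?case using assms(4) by simp
  next
    case (insert x K)
    have "keys (single x (lookup p x)) \<subseteq> D"
      using insert.prems by auto
    with insert show ?case using assms(2,3)
      by (simp add: keys_add_subset del: keys_single)
  qed
  from this[of "keys p"] eq assms(1) show ?thesis by simp
qed

context vspace
begin

text \<open>Points outside the support contribute zero terms, so two formal sums can be expanded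
  over one common index set.\<close>

lemma lin_ext_superset:
  assumes "finite D" "keys p \<subseteq> D" "f \<in> D \<rightarrow> carrier V"
  shows "lin_ext V f p = (\<Oplus>z\<in>D. lookup p z \<odot> f z)"
  unfolding lin_ext_def
  using assms by (intro add.finprod_mono_neutral_cong_left) (auto simp: in_keys_iff Pi_iff)

lemma lin_ext_closed:
  "f \<in> D \<rightarrow> carrier V \<Longrightarrow> keys p \<subseteq> D \<Longrightarrow> lin_ext V f p \<in> carrier V"
  unfolding lin_ext_def by (intro finsum_closed) (auto simp: Pi_iff)

lemma lin_ext_zero [simp]: "lin_ext V f 0 = \<zero>"
  by (simp add: lin_ext_def)

lemma lin_ext_single [simp]: "f x \<in> carrier V \<Longrightarrow> lin_ext V f (single x c) = c \<odot> f x"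
  by (cases "c = 0") (simp_all add: lin_ext_def)

lemma lin_ext_add:
  assumes "f \<in> D \<rightarrow> carrier V" "keys p \<subseteq> D" "keys q \<subseteq> D"
  shows "lin_ext V f (p + q) = lin_ext V f p \<oplus> lin_ext V f q"
proof -
  let ?K = "keys p \<union> keys q"
  have f: "f \<in> ?K \<rightarrow> carrier V" using assms by auto
  have "lin_ext V f (p + q) = (\<Oplus>z\<in>?K. lookup (p + q) z \<odot> f z)"
    using f by (intro lin_ext_superset keys_add_subset) auto
  also have "\<dots> = (\<Oplus>z\<in>?K. lookup p z \<odot> f z \<oplus> lookup q z \<odot> f z)"
    using f by (intro add.finprod_cong') (auto simp: lookup_add scale_add_left Pi_iff)
  also have "\<dots> = (\<Oplus>z\<in>?K. lookup p z \<odot> f z) \<oplus> (\<Oplus>z\<in>?K. lookup q z \<odot> f z)"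
    using f by (intro finsum_addf) (auto simp: Pi_iff)
  also have "\<dots> = lin_ext V f p \<oplus> lin_ext V f q"
    using f by (simp add: lin_ext_superset[of ?K])
  finally show ?thesis .
qed

lemma scale_finsum:
  assumes "finite I" "g \<in> I \<rightarrow> carrier V"
  shows "c \<odot> (\<Oplus>i\<in>I. g i) = (\<Oplus>i\<in>I. c \<odot> g i)"
  using assms by (induction rule: finite_induct) (auto simp: scale_add_right Pi_iff)

lemma lin_ext_scale:
  assumes "f \<in> D \<rightarrow> carrier V" "keys p \<subseteq> D"
  shows "lin_ext V f (Poly_Mapping.map ((*) c) p) = c \<odot> lin_ext V f p"
proof -
  let ?K = "keys p"
  have f: "f \<in> ?K \<rightarrow> carrier V" using assms by auto
  have "lin_ext V f (Poly_Mapping.map ((*) c) p) = (\<Oplus>z\<in>?K. lookup (Poly_Mapping.map ((*) c) p) z \<odot> f z)"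
    using f by (intro lin_ext_superset keys_scale_subset) auto
  also have "\<dots> = (\<Oplus>z\<in>?K. c \<odot> (lookup p z \<odot> f z))"
    using f by (intro add.finprod_cong') (auto simp: scale_scale Pi_iff)
  also have "\<dots> = c \<odot> lin_ext V f p"
    unfolding lin_ext_def using f by (intro scale_finsum[symmetric]) (auto simp: Pi_iff)
  finally show ?thesis .
qed

lemma lin_ext_linear:
  assumes "f \<in> carrier M \<rightarrow> carrier V"
  shows "lin_ext V f \<in> linear_hom (monoid_algebra M) V"
  using assms by (intro linear_homI) (simp_all add: lin_ext_closed lin_ext_add lin_ext_scale)

lemma lin_ext_compose:
  assumes "vspace U" "\<phi> \<in> linear_hom V U" "f \<in> D \<rightarrow> carrier V" "keys p \<subseteq> D"
  shows "\<phi> (lin_ext V f p) = lin_ext U (\<lambda>x. \<phi> (f x)) p"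
proof -
  interpret U: vspace U by fact
  have "\<phi> (lin_ext V f p) = (\<Oplus>\<^bsub>U\<^esub>z\<in>keys p. \<phi> (lookup p z \<odot> f z))"
    unfolding lin_ext_def using assms
    by (intro linear_hom_finsum) (auto simp: vspace_axioms Pi_iff)
  also have "\<dots> = lin_ext U (\<lambda>x. \<phi> (f x)) p"
    unfolding lin_ext_def using assms
    by (intro U.add.finprod_cong') (auto simp: linear_hom_scale linear_hom_closed Pi_iff)
  finally show ?thesis .
qed

end

lemma free_linear_eq:
  fixes g h :: "('x \<Rightarrow>\<^sub>0 'k::field) \<Rightarrow> 'a"
  assumes "vspace U" "g \<in> linear_hom (monoid_algebra M) U" "h \<in> linear_hom (monoid_algebra M) U"
    and eq: "\<And>x. x \<in> carrier M \<Longrightarrow> g (single x 1) = h (single x 1)"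
    and "p \<in> carrier (monoid_algebra M)"
  shows "g p = h p"
proof -
  have keys: "keys p \<subseteq> carrier M" using assms(5) by simp
  \<comment> \<open>\<open>M\<close> is an arbitrary structure here, so the source is not known to
    be a vector space; homogeneity with the scalar 0 yields the value at 0 all the same.\<close>
  have zero: "f 0 = \<zero>\<^bsub>U\<^esub>" if "f \<in> linear_hom (monoid_algebra M) U" for f
  proof -
    interpret U: vspace U by fact
    show ?thesis using linear_hom_scale[OF that, of 0 0] linear_hom_closed[OF that, of 0] by simp
  qed
  show ?thesis using keys
  proof (induction rule: free_induct)
    case (single x c)
    thus ?case using linear_hom_scale[OF assms(2), of "single x 1" c]
        linear_hom_scale[OF assms(3), of "single x 1" c] by (simp add: eq)
  next
    case (add p q)
    thus ?case using linear_hom_add[OF assms(2), of p q] linear_hom_add[OF assms(3), of p q] by simp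
  qed (simp add: zero assms)
qed

subsection \<open>The multiplication of a monoid algebra\<close>

lemma monoid_algebra_mult:
  fixes p q :: "'x \<Rightarrow>\<^sub>0 'k::field"
  assumes "finite D" "finite Y" "keys p \<subseteq> D" "keys q \<subseteq> Y"
  shows "p \<otimes>\<^bsub>monoid_algebra M\<^esub> q = (\<Sum>x\<in>D. \<Sum>y\<in>Y. single (x \<otimes>\<^bsub>M\<^esub> y)
    (lookup p x * lookup q y))"
proof -
  have "p \<otimes>\<^bsub>monoid_algebra M\<^esub> q = (\<Sum>x\<in>keys p. \<Sum>y\<in>Y. single (x \<otimes>\<^bsub>M\<^esub> y)
    (lookup p x * lookup q y))"
    unfolding monoid_algebra_def monoid.simps using assms
    by (intro sum.cong sum.mono_neutral_left) (auto simp: in_keys_iff)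
  also have "\<dots> = (\<Sum>x\<in>D. \<Sum>y\<in>Y. single (x \<otimes>\<^bsub>M\<^esub> y)
    (lookup p x * lookup q y))"
    using assms by (intro sum.mono_neutral_left) (auto simp: in_keys_iff)
  finally show ?thesis .
qed

lemma monoid_algebra_mult_single [simp]:
  "single x a \<otimes>\<^bsub>monoid_algebra M\<^esub> single y b =
    single (x \<otimes>\<^bsub>M\<^esub> y) (a * b :: 'k::field)"
  by (subst monoid_algebra_mult[of "{x}" "{y}"]) auto

lemma monoid_algebra_mult_add_left:
  "(p + p') \<otimes>\<^bsub>monoid_algebra M\<^esub> q = p \<otimes>\<^bsub>monoid_algebra M\<^esub> q + p' \<otimes>\<^bsub>monoid_algebra M\<^esub> (q :: 'x \<Rightarrow>\<^sub>0 'k::field)"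
proof -
  let ?D = "keys p \<union> keys p'"
  have "keys (p + p') \<subseteq> ?D" by (rule keys_add)
  thus ?thesis
    by (simp add: monoid_algebra_mult[of ?D "keys q"] lookup_add ring_distribs
        single_add sum.distrib)
qed

lemma monoid_algebra_mult_add_right:
  "q \<otimes>\<^bsub>monoid_algebra M\<^esub> (p + p') = q \<otimes>\<^bsub>monoid_algebra M\<^esub> p + q \<otimes>\<^bsub>monoid_algebra M\<^esub> (p' :: 'x \<Rightarrow>\<^sub>0 'k::field)"
proof -
  let ?D = "keys p \<union> keys p'"
  have "keys (p + p') \<subseteq> ?D" by (rule keys_add)
  thus ?thesis
    by (simp add: monoid_algebra_mult[of "keys q" ?D] lookup_add ring_distribs
        single_add sum.distrib)
qed

lemma monoid_algebra_mult_zero [simp]: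
  "0 \<otimes>\<^bsub>monoid_algebra M\<^esub> q = (0 :: 'x \<Rightarrow>\<^sub>0 'k::field)" "q \<otimes>\<^bsub>monoid_algebra M\<^esub> 0 = (0 :: 'x \<Rightarrow>\<^sub>0 'k)"
  by (simp_all add: monoid_algebra_def)

lemma scale_add_poly_mapping: 
  "Poly_Mapping.map ((*) (c::'k::field)) (p + q) = Poly_Mapping.map ((*) c) p + Poly_Mapping.map ((*) c) q"
  by (rule poly_mapping_eqI) (simp add: lookup_add algebra_simps)

text \<open>The multiplicative laws are additive in every argument, so induction over formal sums
  reduces them to one-term sums, where they are the laws of \<open>M\<close>.\<close>

lemma monoid_algebra_algebra:
  assumes "Group.monoid M"
  shows "assoc_algebra (monoid_algebra M :: ('k::field, 'x \<Rightarrow>\<^sub>0 'k) module)"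
proof -
  interpret M: Group.monoid M by fact
  let ?A = "monoid_algebra M :: ('k, 'x \<Rightarrow>\<^sub>0 'k) module"
  let ?C = "carrier M"
  have closed: "keys (p \<otimes>\<^bsub>?A\<^esub> q) \<subseteq> ?C"
    if "keys p \<subseteq> ?C" "keys q \<subseteq> ?C" for p q :: "'x \<Rightarrow>\<^sub>0 'k"
    using that(1)
  proof (induction rule: free_induct)
    case (single x c)
    show ?case using that(2) single
      by (induction rule: free_induct) (simp_all add: monoid_algebra_mult_add_right keys_add_subset)
  qed (simp_all add: monoid_algebra_mult_add_left keys_add_subset that(2))
  have left: "Poly_Mapping.map ((*) c) p \<otimes>\<^bsub>?A\<^esub> q = Poly_Mapping.map ((*) c) (p \<otimes>\<^bsub>?A\<^esub> q)"
    if "keys p \<subseteq> ?C" "keys q \<subseteq> ?C" for c and p q :: "'x \<Rightarrow>\<^sub>0 'k"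
    using that(1)
  proof (induction rule: free_induct)
    case (single x c)
    show ?case using that(2) single
      by (induction rule: free_induct) (auto simp: monoid_algebra_mult_add_right scale_add_poly_mapping mult.assoc)
  qed (auto simp: monoid_algebra_mult_add_left scale_add_poly_mapping)
  have right: "p \<otimes>\<^bsub>?A\<^esub> Poly_Mapping.map ((*) c) q = Poly_Mapping.map ((*) c) (p \<otimes>\<^bsub>?A\<^esub> q)"
    if "keys p \<subseteq> ?C" "keys q \<subseteq> ?C" for c and p q :: "'x \<Rightarrow>\<^sub>0 'k"
    using that(1)
  proof (induction rule: free_induct)
    case (single x c)
    show ?case using that(2) single
      by (induction rule: free_induct) (auto simp: monoid_algebra_mult_add_right scale_add_poly_mapping mult_ac)
  qed (auto simp: monoid_algebra_mult_add_left scale_add_poly_mapping)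
  have assoc: "(p \<otimes>\<^bsub>?A\<^esub> q) \<otimes>\<^bsub>?A\<^esub> r = p \<otimes>\<^bsub>?A\<^esub> (q \<otimes>\<^bsub>?A\<^esub> r)"
    if "keys p \<subseteq> ?C" "keys q \<subseteq> ?C" "keys r \<subseteq> ?C"
    for p q r :: "'x \<Rightarrow>\<^sub>0 'k"
    using that(1)
  proof (induction rule: free_induct)
    case (single x c)
    show ?case using that(2)
    proof (induction rule: free_induct)
      case (single y d)
      show ?case using that(3) single \<open>x \<in> ?C\<close>
        by (induction rule: free_induct) (auto simp: monoid_algebra_mult_add_right mult.assoc M.m_assoc)
    qed (auto simp: monoid_algebra_mult_add_left monoid_algebra_mult_add_right)
  qed (auto simp: monoid_algebra_mult_add_left)
  have one: "single \<one>\<^bsub>M\<^esub> 1 \<otimes>\<^bsub>?A\<^esub> p = p \<and> p \<otimes>\<^bsub>?A\<^esub> single \<one>\<^bsub>M\<^esub> 1 = p"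
    if "keys p \<subseteq> ?C" for p :: "'x \<Rightarrow>\<^sub>0 'k"
    using that
    by (induction rule: free_induct)
      (auto simp: monoid_algebra_mult_add_left monoid_algebra_mult_add_right)
  show ?thesis
  proof (rule assoc_algebraI)
    show "ring ?A"
    proof (rule ringI)
      show "abelian_group ?A"
      proof (rule abelian_groupI)
        fix p :: "'x \<Rightarrow>\<^sub>0 'k" assume "p \<in> carrier ?A"
        thus "\<exists>q\<in>carrier ?A. q \<oplus>\<^bsub>?A\<^esub> p = \<zero>\<^bsub>?A\<^esub>"
          by (intro bexI[of _ "- p"]) (auto simp: in_keys_iff subset_iff)
      qed (auto simp: keys_add_subset[THEN subsetD] add_ac)
      show "Group.monoid ?A"
        by (rule monoidI) (auto simp: closed[THEN subsetD] assoc one)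
    qed (auto simp: monoid_algebra_mult_add_left monoid_algebra_mult_add_right)
  next
    fix c and p :: "'x \<Rightarrow>\<^sub>0 'k"
    assume "p \<in> carrier ?A"
    thus "c \<odot>\<^bsub>?A\<^esub> p \<in> carrier ?A" using keys_scale_subset[of c p] by auto
  qed (auto simp: left right scale_add_poly_mapping lookup_add algebra_simps intro!: poly_mapping_eqI)
qed

lemma monoid_algebra_lift:
  fixes A :: "('k::field, 'a) module"
  assumes "Group.monoid M" "assoc_algebra A" and f: "f \<in> carrier M \<rightarrow> carrier A"
    and mult: "\<And>x y. x \<in> carrier M \<Longrightarrow> y \<in> carrier M \<Longrightarrow> f (x \<otimes>\<^bsub>M\<^esub> y) = f x \<otimes>\<^bsub>A\<^esub> f y"
    and one: "f \<one>\<^bsub>M\<^esub> = \<one>\<^bsub>A\<^esub>"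
  shows "lin_ext A f \<in> algebra_hom (monoid_algebra M) A"
proof -
  interpret A: assoc_algebra A by fact
  interpret M: Group.monoid M by fact
  interpret F: assoc_algebra "monoid_algebra M :: ('k, _) module" by (rule monoid_algebra_algebra) fact
  have fc: "\<And>x. x \<in> carrier M \<Longrightarrow> f x \<in> carrier A" using f by auto
  note closed = A.lin_ext_closed[OF f]
  note add = A.lin_ext_add[OF f]
  have keys_mult: "keys (p \<otimes>\<^bsub>monoid_algebra M\<^esub> q) \<subseteq> carrier M"
    if "keys p \<subseteq> carrier M" "keys q \<subseteq> carrier M" for p q :: "_ \<Rightarrow>\<^sub>0 'k"
    using F.m_closed[of p q] that by simp
  show ?thesis
  proof (rule algebra_homI)
    show "lin_ext A f \<in> linear_hom (monoid_algebra M) A" using f by (rule A.lin_ext_linear)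
    show "lin_ext A f \<one>\<^bsub>monoid_algebra M\<^esub> = \<one>\<^bsub>A\<^esub>" using fc[of "\<one>\<^bsub>M\<^esub>"] by (simp add: one)
  next
    fix p q :: "_ \<Rightarrow>\<^sub>0 'k"
    assume "p \<in> carrier (monoid_algebra M)" and "q \<in> carrier (monoid_algebra M)"
    hence p: "keys p \<subseteq> carrier M" and q: "keys q \<subseteq> carrier M" by simp_all
    from p show "lin_ext A f (p \<otimes>\<^bsub>monoid_algebra M\<^esub> q) = lin_ext A f p \<otimes>\<^bsub>A\<^esub> lin_ext A f q"
    proof (induction rule: free_induct)
      case (single x c)
      hence x: "keys (single x c) \<subseteq> carrier M" by simp
      show ?case using q
      proof (induction rule: free_induct)
        case (single y d)
        thus ?case using \<open>x \<in> carrier M\<close>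
          by (simp add: fc mult A.smult_mult_left A.smult_mult_right A.scale_scale mult.commute)
      next
        case (add p q)
        thus ?case using x \<open>x \<in> carrier M\<close> unfolding monoid_algebra_mult_add_right
          by (simp add: A.lin_ext_add[OF f] keys_mult A.r_distr closed fc del: A.lin_ext_single)
      qed (use x closed in auto)
    next
      case (add p p')
      thus ?case using q unfolding monoid_algebra_mult_add_left
        by (simp add: A.lin_ext_add[OF f] keys_mult A.l_distr closed)
    qed (use q closed in auto)
  qed
qed

section \<open>Quotient algebras\<close>

lemma the_elem_image_const: "x \<in> M \<Longrightarrow> (\<And>y. y \<in> M \<Longrightarrow> f y = f x) \<Longrightarrow> the_elem (f ` M) = f x"
  by (metis (full_types) image_cong image_constant_conv empty_iff the_elem_eq)

text \<open>A ring ideal of a unital algebra is automatically a subspace, because c x = (c 1) x.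
  This is why ideals generated in the ring sense give quotient algebras.\<close>

lemma ideal_scale_closed:
  assumes "assoc_algebra A" "ideal I A" "x \<in> I"
  shows "c \<odot>\<^bsub>A\<^esub> x \<in> I"
proof -
  interpret A: assoc_algebra A by fact
  interpret I: ideal I A by fact
  have "c \<odot>\<^bsub>A\<^esub> x = (c \<odot>\<^bsub>A\<^esub> \<one>\<^bsub>A\<^esub>) \<otimes>\<^bsub>A\<^esub> x"
    using assms(3) by (simp add: A.smult_mult_left I.Icarr)
  thus ?thesis using assms(3) I.I_l_closed by simp
qed

context
  fixes A :: "('k::field, 'a) module" and I :: "'a set"
  assumes A: "assoc_algebra A" and I: "ideal I A"
begin

interpretation A: assoc_algebra A by (rule A)
interpretation I: ideal I A by (rule I)

lemma quotient_coset_elem: "y \<in> I +>\<^bsub>A\<^esub> x \<longleftrightarrow> (\<exists>i\<in>I. y = i \<oplus>\<^bsub>A\<^esub> x)"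
  by (auto simp: a_r_coset_def')

lemma quotient_coset_eqI:
  assumes "x \<in> carrier A" "y \<in> carrier A" "x \<ominus>\<^bsub>A\<^esub> y \<in> I"
  shows "I +>\<^bsub>A\<^esub> x = I +>\<^bsub>A\<^esub> y"
proof -
  have "x = (x \<ominus>\<^bsub>A\<^esub> y) \<oplus>\<^bsub>A\<^esub> y" using assms by (simp add: A.minus_eq A.a_assoc A.l_neg)
  hence "x \<in> I +>\<^bsub>A\<^esub> y" using assms(3) quotient_coset_elem by blast
  thus ?thesis using assms I.a_subgroup A.a_repr_independence by metis
qed

text \<open>The scalar action is defined as a union over all representatives. Two representatives
  differ by an element of \<open>I\<close>, so all the cosets united are the same one.\<close>

lemma quotient_scale:
  assumes "x \<in> carrier A"
  shows "c \<odot>\<^bsub>quotient_algebra A I\<^esub> (I +>\<^bsub>A\<^esub> x) = I +>\<^bsub>A\<^esub> (c \<odot>\<^bsub>A\<^esub> x)"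
proof -
  have "I +>\<^bsub>A\<^esub> (c \<odot>\<^bsub>A\<^esub> y) = I +>\<^bsub>A\<^esub> (c \<odot>\<^bsub>A\<^esub> x)" if "y \<in> I +>\<^bsub>A\<^esub> x" for y
  proof -
    from that obtain i where i: "i \<in> I" "y = i \<oplus>\<^bsub>A\<^esub> x" using quotient_coset_elem by blast
    have "c \<odot>\<^bsub>A\<^esub> y \<ominus>\<^bsub>A\<^esub> c \<odot>\<^bsub>A\<^esub> x = c \<odot>\<^bsub>A\<^esub> i"
      using i assms I.Icarr[of i]
      by (simp add: A.scale_add_right A.minus_eq A.a_assoc A.r_neg)
    thus ?thesis using i assms I.Icarr[of i] ideal_scale_closed[OF A I, of i c]
      by (intro quotient_coset_eqI) auto
  qed
  hence "(\<Union>y\<in>I +>\<^bsub>A\<^esub> x. I +>\<^bsub>A\<^esub> (c \<odot>\<^bsub>A\<^esub> y)) = (\<Union>y\<in>I +>\<^bsub>A\<^esub> x. I +>\<^bsub>A\<^esub> (c \<odot>\<^bsub>A\<^esub> x))"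
    by (intro SUP_cong) simp_all
  also have "\<dots> = I +>\<^bsub>A\<^esub> (c \<odot>\<^bsub>A\<^esub> x)"
    by (rule UN_constant_eq[OF I.a_rcos_self[OF assms]]) simp
  finally show ?thesis by (simp add: quotient_algebra_def)
qed

lemma quotient_carrier: "carrier (quotient_algebra A I) = (\<lambda>x. I +>\<^bsub>A\<^esub> x) ` carrier A"
  by (auto simp: quotient_algebra_def A_RCOSETS_def')

lemma quotient_zero: "\<zero>\<^bsub>quotient_algebra A I\<^esub> = I +>\<^bsub>A\<^esub> \<zero>\<^bsub>A\<^esub>"
  by (simp add: quotient_algebra_def A.a_coset_add_zero I.a_subset)

lemma quotient_algebra_algebra: "assoc_algebra (quotient_algebra A I)"
  by (rule assoc_algebra_image[OF A, where h = "\<lambda>x. I +>\<^bsub>A\<^esub> x"], rule quotient_carrier)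
    (simp_all add: quotient_scale quotient_zero,
     simp_all add: quotient_algebra_def I.a_rcos_sum I.rcoset_mult_add)

lemma quotient_proj_hom: "(\<lambda>x. I +>\<^bsub>A\<^esub> x) \<in> algebra_hom A (quotient_algebra A I)"
  by (intro algebra_homI linear_homI)
   (simp_all add: quotient_scale quotient_zero quotient_carrier,
    simp_all add: quotient_algebra_def I.a_rcos_sum I.rcoset_mult_add)

text \<open>A map that kills \<open>I\<close> takes a single value on each coset, and
  \<open>the_elem\<close> of the image returns it. This fact gives meaning to
  \<open>tensor_lift\<close>, \<open>tensor_algebra_lift\<close> and
  \<open>sym_eval\<close>.\<close>

lemma quotient_lift_coset:
  assumes "vspace U" "\<phi> \<in> linear_hom A U" "\<And>i. i \<in> I \<Longrightarrow> \<phi> i = \<zero>\<^bsub>U\<^esub>" "x \<in> carrier A"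
  shows "the_elem (\<phi> ` (I +>\<^bsub>A\<^esub> x)) = \<phi> x"
proof -
  interpret U: vspace U by fact
  have "\<phi> (i \<oplus>\<^bsub>A\<^esub> x) = \<phi> x" if "i \<in> I" for i
    using assms that linear_hom_closed[OF assms(2,4)] I.Icarr[OF that]
    by (simp add: linear_hom_add)
  hence "\<phi> y = \<phi> x" if "y \<in> I +>\<^bsub>A\<^esub> x" for y
    using that by (metis quotient_coset_elem)
  thus ?thesis by (rule the_elem_image_const[OF I.a_rcos_self[OF assms(4)]])
qed

lemma quotient_lift_linear:
  assumes "vspace U" "\<phi> \<in> linear_hom A U" "\<And>i. i \<in> I \<Longrightarrow> \<phi> i = \<zero>\<^bsub>U\<^esub>"
  shows "(\<lambda>C. the_elem (\<phi> ` C)) \<in> linear_hom (quotient_algebra A I) U"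
proof (intro linear_homI; unfold quotient_carrier; elim imageE; hypsubst)
  note L = quotient_lift_coset[OF assms]
  note P = algebra_hom_linear[OF quotient_proj_hom]
  fix x assume x: "x \<in> carrier A"
  show "the_elem (\<phi> ` (I +>\<^bsub>A\<^esub> x)) \<in> carrier U" using x assms(2) by (simp add: L linear_hom_closed)
  show "the_elem (\<phi> ` (c \<odot>\<^bsub>quotient_algebra A I\<^esub> (I +>\<^bsub>A\<^esub> x))) = c \<odot>\<^bsub>U\<^esub> the_elem (\<phi> ` (I +>\<^bsub>A\<^esub> x))" for c
    using x assms(2) by (simp add: linear_hom_scale[OF P, symmetric] L linear_hom_scale)
  fix y assume y: "y \<in> carrier A"
  show "the_elem (\<phi> ` ((I +>\<^bsub>A\<^esub> x) \<oplus>\<^bsub>quotient_algebra A I\<^esub> (I +>\<^bsub>A\<^esub> y))) =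
      the_elem (\<phi> ` (I +>\<^bsub>A\<^esub> x)) \<oplus>\<^bsub>U\<^esub> the_elem (\<phi> ` (I +>\<^bsub>A\<^esub> y))"
    using x y assms(2) by (simp add: linear_hom_add[OF P, symmetric] L linear_hom_add)
qed

lemma quotient_lift_algebra:
  assumes "assoc_algebra B" "\<phi> \<in> algebra_hom A B" "\<And>i. i \<in> I \<Longrightarrow> \<phi> i = \<zero>\<^bsub>B\<^esub>"
  shows "(\<lambda>C. the_elem (\<phi> ` C)) \<in> algebra_hom (quotient_algebra A I) B"
proof -
  interpret B: assoc_algebra B by fact
  note \<phi> = algebra_hom_linear[OF assms(2)]
  note L = quotient_lift_coset[OF B.vspace_axioms \<phi> assms(3)]
  show ?thesis
  proof (intro algebra_homI quotient_lift_linear B.vspace_axioms \<phi> assms(3))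
    show "the_elem (\<phi> ` (X' \<otimes>\<^bsub>quotient_algebra A I\<^esub> Y')) = the_elem (\<phi> ` X') \<otimes>\<^bsub>B\<^esub> the_elem (\<phi> ` Y')"
      if "X' \<in> carrier (quotient_algebra A I)" "Y' \<in> carrier (quotient_algebra A I)" for X' Y'
      using that assms(2) unfolding quotient_carrier
      by (auto simp: algebra_hom_mult[OF quotient_proj_hom, symmetric] L algebra_hom_mult)
    show "the_elem (\<phi> ` \<one>\<^bsub>quotient_algebra A I\<^esub>) = \<one>\<^bsub>B\<^esub>"
      using assms(2) by (simp add: algebra_hom_one[OF quotient_proj_hom, symmetric] L algebra_hom_one)
  qed
qed

end

section \<open>Tensor products of algebras\<close>

lemma (in abelian_group) add_minus_minus:
  assumes "a \<in> carrier G" "b \<in> carrier G"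
  shows "a \<oplus> b \<ominus> a \<ominus> b = \<zero>"
proof -
  have "a \<oplus> b \<ominus> a \<ominus> b = (a \<oplus> b) \<oplus> (\<ominus> a \<oplus> \<ominus> b)"
    using assms by (simp add: minus_eq a_assoc)
  also have "\<dots> = \<zero>" using assms by (simp add: minus_add[symmetric] r_neg del: minus_add)
  finally show ?thesis .
qed

lemma bilinear_homI:
  assumes "\<And>x. x \<in> carrier V \<Longrightarrow> f x \<in> linear_hom W U"
    and "\<And>y. y \<in> carrier W \<Longrightarrow> (\<lambda>x. f x y) \<in> linear_hom V U"
  shows "f \<in> bilinear_hom V W U"
  using assms by (simp add: bilinear_hom_def)

lemma bilinear_hom_right: "f \<in> bilinear_hom V W U \<Longrightarrow> x \<in> carrier V \<Longrightarrow> f x \<in> linear_hom W U"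
  and bilinear_hom_left: "f \<in> bilinear_hom V W U \<Longrightarrow> y \<in> carrier W \<Longrightarrow> (\<lambda>x. f x y) \<in> linear_hom V U"
  by (simp_all add: bilinear_hom_def)

lemma bilinear_hom_closed:
  "f \<in> bilinear_hom V W U \<Longrightarrow> x \<in> carrier V \<Longrightarrow> y \<in> carrier W \<Longrightarrow> f x y \<in> carrier U"
  using bilinear_hom_right linear_hom_closed by metis

lemma bilinear_hom_compose:
  assumes "f \<in> bilinear_hom V W U" "g \<in> linear_hom U U'"
  shows "(\<lambda>x y. g (f x y)) \<in> bilinear_hom V W U'"
  using assms by (auto simp: bilinear_hom_def intro: linear_hom_compose)

section \<open>Subspaces and linear spans\<close>

lemma subspace_span_superset: "S \<subseteq> subspace_span V S"
  by (auto simp: subspace_span_def)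

lemma subspace_span_least: "submodule U base_field V \<Longrightarrow> S \<subseteq> U \<Longrightarrow> subspace_span V S \<subseteq> U"
  by (auto simp: subspace_span_def)

lemma (in vspace) submoduleI':
  assumes "U \<subseteq> carrier V" "\<zero> \<in> U" "\<And>x y. x \<in> U \<Longrightarrow> y \<in> U \<Longrightarrow> x \<oplus> y \<in> U"
    and "\<And>c x. x \<in> U \<Longrightarrow> c \<odot> x \<in> U"
  shows "submodule U base_field V"
proof -
  have "\<ominus> x \<in> U" if "x \<in> U" for x
    using assms(4)[OF that, of "-1"] assms(1) that scale_minus_one[of x] by auto
  thus ?thesis using assms by (intro submoduleI) auto
qed

lemma (in vspace) subspace_span_submodule:
  assumes "S \<subseteq> carrier V"
  shows "submodule (subspace_span V S) base_field V"
proof (rule submoduleI')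
  have c: "submodule (carrier V) base_field V" by (rule submoduleI') auto
  show "subspace_span V S \<subseteq> carrier V" using subspace_span_least[OF c assms] .
  \<comment> \<open>A submodule is nonempty, and scaling one of its elements by 0 produces
    zero.\<close>
  have zero: "\<zero> \<in> U" if U: "submodule U base_field V" for U
  proof -
    obtain x where "x \<in> U" using submoduleE(2)[OF U] by auto
    thus ?thesis using submoduleE(4)[OF U, of 0 x] submoduleE(1)[OF U] by (auto simp: subset_iff)
  qed
  show "\<zero> \<in> subspace_span V S" by (auto simp: subspace_span_def zero)
qed (auto simp: subspace_span_def intro: submoduleE)

lemma (in vspace) linear_kernel_submodule:
  assumes "vspace U" "\<phi> \<in> linear_hom V U"
  shows "submodule {x \<in> carrier V. \<phi> x = \<zero>\<^bsub>U\<^esub>} base_field V"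
proof (rule submoduleI')
  interpret U: vspace U by fact
  show "\<zero> \<in> {x \<in> carrier V. \<phi> x = \<zero>\<^bsub>U\<^esub>}"
    using linear_hom_zero[OF vspace_axioms assms] by simp
  show "x \<oplus> y \<in> {x \<in> carrier V. \<phi> x = \<zero>\<^bsub>U\<^esub>}" if "x \<in> {x \<in> carrier V. \<phi> x = \<zero>\<^bsub>U\<^esub>}"
    "y \<in> {x \<in> carrier V. \<phi> x = \<zero>\<^bsub>U\<^esub>}" for x y
    using that by (simp add: linear_hom_add[OF assms(2)])
  show "c \<odot> x \<in> {x \<in> carrier V. \<phi> x = \<zero>\<^bsub>U\<^esub>}" if "x \<in> {x \<in> carrier V. \<phi> x = \<zero>\<^bsub>U\<^esub>}" for c x
    using that by (simp add: linear_hom_scale[OF assms(2)])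
qed auto

lemma monoid_algebra_mult_diff_left:
  "(p - p') \<otimes>\<^bsub>monoid_algebra M\<^esub> q = p \<otimes>\<^bsub>monoid_algebra M\<^esub> q - p' \<otimes>\<^bsub>monoid_algebra M\<^esub> (q :: 'x \<Rightarrow>\<^sub>0 'k::field)"
  using monoid_algebra_mult_add_left[where p = "p - p'" and p' = p' and q = q and M = M] by simp

lemma monoid_algebra_mult_diff_right:
  "q \<otimes>\<^bsub>monoid_algebra M\<^esub> (p - p') = q \<otimes>\<^bsub>monoid_algebra M\<^esub> p - q \<otimes>\<^bsub>monoid_algebra M\<^esub> (p' :: 'x \<Rightarrow>\<^sub>0 'k::field)"
  using monoid_algebra_mult_add_right[where p = "p - p'" and p' = p' and q = q and M = M] by simp

lemma scale_diff_poly_mapping: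
  "Poly_Mapping.map ((*) (c::'k::field)) (p - q) = Poly_Mapping.map ((*) c) p - Poly_Mapping.map ((*) c) q"
  by (rule poly_mapping_eqI) (simp add: lookup_minus algebra_simps)

lemma keys_diff_subset:
  "keys p \<subseteq> D \<Longrightarrow> keys q \<subseteq> D \<Longrightarrow> keys (p - q :: 'x \<Rightarrow>\<^sub>0 'k::field) \<subseteq> D"
  using keys_add_subset[of p D "- q"] by (simp add: subset_iff in_keys_iff)

lemma monoid_algebra_minus:
  fixes p q :: "'x \<Rightarrow>\<^sub>0 'k::field"
  assumes "Group.monoid M" "p \<in> carrier (monoid_algebra M)" "q \<in> carrier (monoid_algebra M)"
  shows "p \<ominus>\<^bsub>monoid_algebra M\<^esub> q = p - q"
proof -
  interpret assoc_algebra "monoid_algebra M :: ('k, _) module" by (rule monoid_algebra_algebra) fact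
  have "p \<ominus>\<^bsub>monoid_algebra M\<^esub> q = p + Poly_Mapping.map ((*) (-1)) q"
    using minus_eq_scale[OF assms(2,3)] by simp
  also have "\<dots> = p - q"
    by (rule poly_mapping_eqI) (simp add: lookup_add lookup_minus)
  finally show ?thesis .
qed

lemma tensor_relations_cases [consumes 1, case_names add_left add_right scale_left scale_right]:
  assumes "r \<in> tensor_relations A B"
  obtains x x' y where "x \<in> carrier A" "x' \<in> carrier A" "y \<in> carrier B"
      "r = single (x \<oplus>\<^bsub>A\<^esub> x', y) 1 - single (x, y) 1 - single (x', y) 1"
    | x y y' where "x \<in> carrier A" "y \<in> carrier B" "y' \<in> carrier B"
      "r = single (x, y \<oplus>\<^bsub>B\<^esub> y') 1 - single (x, y) 1 - single (x, y') 1"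
    | c x y where "x \<in> carrier A" "y \<in> carrier B"
      "r = single (c \<odot>\<^bsub>A\<^esub> x, y) 1 - single (x, y) c"
    | c x y where "x \<in> carrier A" "y \<in> carrier B"
      "r = single (x, c \<odot>\<^bsub>B\<^esub> y) 1 - single (x, y) c"
  using assms unfolding tensor_relations_def by blast

lemma tensor_relationsI:
  "x \<in> carrier A \<Longrightarrow> x' \<in> carrier A \<Longrightarrow> y \<in> carrier B \<Longrightarrow>
     single (x \<oplus>\<^bsub>A\<^esub> x', y) 1 - single (x, y) 1 - single (x', y) 1 \<in> tensor_relations A B"
  "x \<in> carrier A \<Longrightarrow> y \<in> carrier B \<Longrightarrow> y' \<in> carrier B \<Longrightarrow>
     single (x, y \<oplus>\<^bsub>B\<^esub> y') 1 - single (x, y) 1 - single (x, y') 1 \<in> tensor_relations A B"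
  "x \<in> carrier A \<Longrightarrow> y \<in> carrier B \<Longrightarrow>
     single (c \<odot>\<^bsub>A\<^esub> x, y) 1 - single (x, y) c \<in> tensor_relations A B"
  "x \<in> carrier A \<Longrightarrow> y \<in> carrier B \<Longrightarrow>
     single (x, c \<odot>\<^bsub>B\<^esub> y) 1 - single (x, y) c \<in> tensor_relations A B"
  unfolding tensor_relations_def by blast+

context
  fixes A :: "('k::field, 'a) module" and B :: "('k, 'b) module"
  assumes A: "assoc_algebra A" and B: "assoc_algebra B"
begin

interpretation A: assoc_algebra A by (rule A)
interpretation B: assoc_algebra B by (rule B)

lemma tensor_monoid: "Group.monoid (A \<times>\<times> B)"
  by (rule DirProd_monoid) (rule A.monoid_axioms B.monoid_axioms)+

interpretation M: Group.monoid "A \<times>\<times> B" by (rule tensor_monoid)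
abbreviation pair_algebra :: "('k, 'a \<times> 'b \<Rightarrow>\<^sub>0 'k) module"
  where "pair_algebra \<equiv> monoid_algebra (A \<times>\<times> B)"

interpretation F: assoc_algebra pair_algebra
  by (rule monoid_algebra_algebra) (rule tensor_monoid)

lemma tensor_relations_carrier: "tensor_relations A B \<subseteq> carrier (pair_algebra)"
proof
  fix r assume "r \<in> tensor_relations A B"
  thus "r \<in> carrier (pair_algebra)"
    by (cases rule: tensor_relations_cases) (simp_all add: keys_diff_subset)
qed

interpretation K: submodule "tensor_kernel A B" base_field pair_algebra
  unfolding tensor_kernel_def by (rule F.subspace_span_submodule[OF tensor_relations_carrier])

lemma tensor_kernel_closed:
  "0 \<in> tensor_kernel A B"
  "p \<in> tensor_kernel A B \<Longrightarrow> q \<in> tensor_kernel A B \<Longrightarrow> p + q \<in> tensor_kernel A B"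
  "p \<in> tensor_kernel A B \<Longrightarrow> Poly_Mapping.map ((*) c) p \<in> tensor_kernel A B"
  using K.one_closed F.vec.submoduleE(5)[OF K.submodule_axioms, of p q]
    F.vec.submoduleE(4)[OF K.submodule_axioms, of c p] by simp_all

lemma tensor_kernel_relation: "r \<in> tensor_relations A B \<Longrightarrow> Poly_Mapping.map ((*) c) r \<in> tensor_kernel A B"
  using subspace_span_superset[of "tensor_relations A B" "pair_algebra"]
  by (intro tensor_kernel_closed) (auto simp: tensor_kernel_def)

text \<open>\<open>tensor_kernel\<close> is defined as a linear span, so its closure under
  multiplication has to be proved. A relation multiplied by a one-term sum is \<open>d\<close> times
  a relation of the same kind, with both entries multiplied; and the elements whose two products
  with the fixed one-term sum stay in the kernel form a subspace.\<close>

lemma tensor_kernel_mult_single: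
  assumes "p \<in> tensor_kernel A B" "u \<in> carrier A" "v \<in> carrier B"
  shows "p \<otimes>\<^bsub>pair_algebra\<^esub> single (u, v) d \<in> tensor_kernel A B"
    and "single (u, v) d \<otimes>\<^bsub>pair_algebra\<^esub> p \<in> tensor_kernel A B"
proof -
  let ?F = pair_algebra
  let ?s = "single (u, v) d"
  have s: "?s \<in> carrier ?F" using assms by simp
  define N where "N = {p \<in> carrier ?F. p \<otimes>\<^bsub>?F\<^esub> ?s \<in> tensor_kernel A B \<and> ?s \<otimes>\<^bsub>?F\<^esub> p \<in> tensor_kernel A B}"
  have "tensor_kernel A B \<subseteq> N"
    unfolding tensor_kernel_def
  proof (rule subspace_span_least)
    show "submodule N base_field ?F"
    proof (rule F.submoduleI')
      show "N \<subseteq> carrier ?F" by (auto simp: N_def)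
      show "\<zero>\<^bsub>?F\<^esub> \<in> N" by (simp add: N_def tensor_kernel_closed)
      fix p assume p: "p \<in> N"
      show "c \<odot>\<^bsub>?F\<^esub> p \<in> N" for c
        using p s F.smult_mult_left[of p ?s c] F.smult_mult_right[of ?s p c] F.scale_closed[of p c]
        by (simp add: N_def tensor_kernel_closed)
      fix q assume q: "q \<in> N"
      show "p \<oplus>\<^bsub>?F\<^esub> q \<in> N" using p q
        by (simp add: N_def tensor_kernel_closed keys_add_subset monoid_algebra_mult_add_left monoid_algebra_mult_add_right)
    qed
    show "tensor_relations A B \<subseteq> N"
    proof
      fix r assume r: "r \<in> tensor_relations A B"
      have "r \<otimes>\<^bsub>?F\<^esub> ?s \<in> tensor_kernel A B"
        using r
      proof (cases rule: tensor_relations_cases)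
        case (add_left x x' y)
        thus ?thesis using assms tensor_kernel_relation[OF tensor_relationsI(1)[where x = "x \<otimes>\<^bsub>A\<^esub> u" and x' = "x' \<otimes>\<^bsub>A\<^esub> u" and y = "y \<otimes>\<^bsub>B\<^esub> v"], of d]
          by (simp add: monoid_algebra_mult_diff_left scale_diff_poly_mapping A.l_distr)
      next
        case (add_right x y y')
        thus ?thesis using assms tensor_kernel_relation[OF tensor_relationsI(2)[where x = "x \<otimes>\<^bsub>A\<^esub> u" and y = "y \<otimes>\<^bsub>B\<^esub> v" and y' = "y' \<otimes>\<^bsub>B\<^esub> v"], of d]
          by (simp add: monoid_algebra_mult_diff_left scale_diff_poly_mapping B.l_distr)
      next
        case (scale_left c x y)
        thus ?thesis using assms tensor_kernel_relation[OF tensor_relationsI(3)[where x = "x \<otimes>\<^bsub>A\<^esub> u" and y = "y \<otimes>\<^bsub>B\<^esub> v" and c = c], of d]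
          by (simp add: monoid_algebra_mult_diff_left scale_diff_poly_mapping A.smult_mult_left mult.commute)
      next
        case (scale_right c x y)
        thus ?thesis using assms tensor_kernel_relation[OF tensor_relationsI(4)[where x = "x \<otimes>\<^bsub>A\<^esub> u" and y = "y \<otimes>\<^bsub>B\<^esub> v" and c = c], of d]
          by (simp add: monoid_algebra_mult_diff_left scale_diff_poly_mapping B.smult_mult_left mult.commute)
      qed
      moreover have "?s \<otimes>\<^bsub>?F\<^esub> r \<in> tensor_kernel A B"
        using r
      proof (cases rule: tensor_relations_cases)
        case (add_left x x' y)
        thus ?thesis using assms tensor_kernel_relation[OF tensor_relationsI(1)[where x = "u \<otimes>\<^bsub>A\<^esub> x" and x' = "u \<otimes>\<^bsub>A\<^esub> x'" and y = "v \<otimes>\<^bsub>B\<^esub> y"], of d]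
          by (simp add: monoid_algebra_mult_diff_right scale_diff_poly_mapping A.r_distr)
      next
        case (add_right x y y')
        thus ?thesis using assms tensor_kernel_relation[OF tensor_relationsI(2)[where x = "u \<otimes>\<^bsub>A\<^esub> x" and y = "v \<otimes>\<^bsub>B\<^esub> y" and y' = "v \<otimes>\<^bsub>B\<^esub> y'"], of d]
          by (simp add: monoid_algebra_mult_diff_right scale_diff_poly_mapping B.r_distr)
      next
        case (scale_left c x y)
        thus ?thesis using assms tensor_kernel_relation[OF tensor_relationsI(3)[where x = "u \<otimes>\<^bsub>A\<^esub> x" and y = "v \<otimes>\<^bsub>B\<^esub> y" and c = c], of d]
          by (simp add: monoid_algebra_mult_diff_right scale_diff_poly_mapping A.smult_mult_right mult.commute)
      next
        case (scale_right c x y)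
        thus ?thesis using assms tensor_kernel_relation[OF tensor_relationsI(4)[where x = "u \<otimes>\<^bsub>A\<^esub> x" and y = "v \<otimes>\<^bsub>B\<^esub> y" and c = c], of d]
          by (simp add: monoid_algebra_mult_diff_right scale_diff_poly_mapping B.smult_mult_right mult.commute)
      qed
      ultimately show "r \<in> N" using r tensor_relations_carrier by (auto simp: N_def)
    qed
  qed
  thus "p \<otimes>\<^bsub>?F\<^esub> ?s \<in> tensor_kernel A B" "?s \<otimes>\<^bsub>?F\<^esub> p \<in> tensor_kernel A B"
    using assms(1) by (auto simp: N_def)
qed

lemma tensor_kernel_ideal: "ideal (tensor_kernel A B) (pair_algebra)"
proof (rule idealI)
  show "ring pair_algebra" by (rule F.ring_axioms)
  show "subgroup (tensor_kernel A B) (add_monoid (pair_algebra))"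
    by (rule K.subgroup_axioms)
next
  fix p q assume p: "p \<in> tensor_kernel A B" and "q \<in> carrier pair_algebra"
  hence q: "keys q \<subseteq> carrier A \<times> carrier B" by simp
  show "q \<otimes>\<^bsub>pair_algebra\<^esub> p \<in> tensor_kernel A B"
    using q
  proof (induction rule: free_induct)
    case (single z c) thus ?case using tensor_kernel_mult_single(2)[OF p] by auto
  qed (simp_all add: monoid_algebra_mult_add_left tensor_kernel_closed)
  show "p \<otimes>\<^bsub>pair_algebra\<^esub> q \<in> tensor_kernel A B"
    using q
  proof (induction rule: free_induct)
    case (single z c) thus ?case using tensor_kernel_mult_single(1)[OF p] by auto
  qed (simp_all add: monoid_algebra_mult_add_right tensor_kernel_closed)
qed

lemma tensor_algebra_product: "assoc_algebra (tensor A B)"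
  unfolding tensor_def by (rule quotient_algebra_algebra[OF F.assoc_algebra_axioms tensor_kernel_ideal])

abbreviation tensor_proj where
  "tensor_proj p \<equiv> tensor_kernel A B +>\<^bsub>pair_algebra\<^esub> p"

lemma tensor_proj_hom: "(\<lambda>p. tensor_proj p) \<in> algebra_hom (pair_algebra) (tensor A B)"
  unfolding tensor_def by (rule quotient_proj_hom[OF F.assoc_algebra_axioms tensor_kernel_ideal])

interpretation T: assoc_algebra "tensor A B" by (rule tensor_algebra_product)

text \<open>Each of the four families of relations lies in the kernel and hence becomes one of the
  four bilinearity equations between cosets.\<close>

lemma pure_tensor_bilinear: "pure_tensor A B \<in> bilinear_hom A B (tensor A B)"
proof -
  let ?F = pair_algebra
  have rel: "tensor_proj p = tensor_proj q"
    if "p \<in> carrier ?F" "q \<in> carrier ?F" "p - q \<in> tensor_relations A B" for p q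
  proof (rule quotient_coset_eqI[OF F.assoc_algebra_axioms tensor_kernel_ideal that(1,2)])
    show "p \<ominus>\<^bsub>?F\<^esub> q \<in> tensor_kernel A B"
      unfolding monoid_algebra_minus[OF tensor_monoid that(1,2)] tensor_kernel_def
      by (rule subsetD[OF subspace_span_superset that(3)])
  qed
  have add: "tensor_proj (p + q) = tensor_proj p \<oplus>\<^bsub>tensor A B\<^esub> tensor_proj q"
    if "p \<in> carrier ?F" "q \<in> carrier ?F" for p q
    using linear_hom_add[OF algebra_hom_linear[OF tensor_proj_hom] that] by simp
  have scale: "tensor_proj (Poly_Mapping.map ((*) c) p) = c \<odot>\<^bsub>tensor A B\<^esub> tensor_proj p"
    if "p \<in> carrier ?F" for p c
    using linear_hom_scale[OF algebra_hom_linear[OF tensor_proj_hom] that] by simp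
  have closed: "tensor_proj p \<in> carrier (tensor A B)" if "p \<in> carrier ?F" for p
    using linear_hom_closed[OF algebra_hom_linear[OF tensor_proj_hom] that] .
  have single: "single (x, y) c \<in> carrier ?F" if "x \<in> carrier A" "y \<in> carrier B" for x y c
    using that by simp
  \<comment> \<open>Relations of additivity subtract two terms in succession; regrouped as a single
    difference they fit \<open>rel\<close>.\<close>
  have dd: "a - b - c = a - (b + c)" for a b c :: "'a \<times> 'b \<Rightarrow>\<^sub>0 'k" by simp
  have al: "tensor_proj (single (x \<oplus>\<^bsub>A\<^esub> x', y) 1) =
      tensor_proj (single (x, y) 1 + single (x', y) 1)"
    if "x \<in> carrier A" "x' \<in> carrier A" "y \<in> carrier B" for x x' y
    using that tensor_relationsI(1)[OF that] unfolding dd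
    by (intro rel) (simp_all add: keys_add_subset)
  have ar: "tensor_proj (single (x, y \<oplus>\<^bsub>B\<^esub> y') 1) =
      tensor_proj (single (x, y) 1 + single (x, y') 1)"
    if "x \<in> carrier A" "y \<in> carrier B" "y' \<in> carrier B" for x y y'
    using that tensor_relationsI(2)[OF that] unfolding dd
    by (intro rel) (simp_all add: keys_add_subset)
  have sl: "tensor_proj (single (c \<odot>\<^bsub>A\<^esub> x, y) 1) =
      tensor_proj (Poly_Mapping.map ((*) c) (single (x, y) 1))"
    if "x \<in> carrier A" "y \<in> carrier B" for x y c
    using that tensor_relationsI(3)[OF that] by (intro rel) simp_all
  have sr: "tensor_proj (single (x, c \<odot>\<^bsub>B\<^esub> y) 1) =
      tensor_proj (Poly_Mapping.map ((*) c) (single (x, y) 1))"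
    if "x \<in> carrier A" "y \<in> carrier B" for x y c
    using that tensor_relationsI(4)[OF that] by (intro rel) simp_all
  show ?thesis unfolding pure_tensor_def
    by (intro bilinear_homI linear_homI)
      (simp_all only: al ar sl sr add single scale closed)
qed

lemmas pure_tensor_closed [simp] = bilinear_hom_closed[OF pure_tensor_bilinear]

lemma tensor_proj_single:
  assumes "x \<in> carrier A" "y \<in> carrier B"
  shows "tensor_proj (single (x, y) c) = c \<odot>\<^bsub>tensor A B\<^esub> pure_tensor A B x y"
  using linear_hom_scale[OF algebra_hom_linear[OF tensor_proj_hom], of "single (x, y) 1" c] assms
  by (simp add: pure_tensor_def)

lemma pure_tensor_mult:
  assumes "x \<in> carrier A" "y \<in> carrier B" "x' \<in> carrier A" "y' \<in> carrier B"
  shows "pure_tensor A B x y \<otimes>\<^bsub>tensor A B\<^esub> pure_tensor A B x' y' =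
    pure_tensor A B (x \<otimes>\<^bsub>A\<^esub> x') (y \<otimes>\<^bsub>B\<^esub> y')"
  using algebra_hom_mult[OF tensor_proj_hom, of "single (x, y) 1" "single (x', y') 1"] assms
  by (simp add: pure_tensor_def)

lemma pure_tensor_one: "pure_tensor A B \<one>\<^bsub>A\<^esub> \<one>\<^bsub>B\<^esub> = \<one>\<^bsub>tensor A B\<^esub>"
  using algebra_hom_one[OF tensor_proj_hom] by (simp add: pure_tensor_def)

lemma tensor_carrierE:
  assumes "C \<in> carrier (tensor A B)"
  obtains p where "keys p \<subseteq> carrier A \<times> carrier B" "C = tensor_proj p"
  using assms quotient_carrier[OF F.assoc_algebra_axioms tensor_kernel_ideal]
  by (auto simp: tensor_def)

text \<open>Two cases suffice: a scalar multiple of a pure tensor is pure, as the scalar can be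
  moved into the left factor, and zero is the multiple by 0 of a pure tensor.\<close>

lemma tensor_induct [consumes 1, case_names pure add]:
  assumes "C \<in> carrier (tensor A B)"
    and pure: "\<And>x y. x \<in> carrier A \<Longrightarrow> y \<in> carrier B \<Longrightarrow> P (pure_tensor A B x y)"
    and add: "\<And>C D. C \<in> carrier (tensor A B) \<Longrightarrow> D \<in> carrier (tensor A B) \<Longrightarrow> P C \<Longrightarrow> P D \<Longrightarrow> P (C \<oplus>\<^bsub>tensor A B\<^esub> D)"
  shows "P C"
proof -
  note P = algebra_hom_linear[OF tensor_proj_hom]
  from assms(1) obtain p where p: "keys p \<subseteq> carrier A \<times> carrier B" "C = tensor_proj p"
    by (rule tensor_carrierE)
  have psingle: "P (tensor_proj (single (x, y) c))" if "x \<in> carrier A" "y \<in> carrier B" for x y c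
    using that pure[of "c \<odot>\<^bsub>A\<^esub> x" y] linear_hom_scale[OF bilinear_hom_left[OF pure_tensor_bilinear that(2)] that(1), of c]
    by (simp add: tensor_proj_single)
  from p(1) have "P (tensor_proj p)"
  proof (induction rule: free_induct)
    case (single z c) thus ?case using psingle by auto
  next
    case (add p q)
    thus ?case using assms(3)[of "tensor_proj p" "tensor_proj q"] linear_hom_add[OF P, of p q]
        linear_hom_closed[OF P, of p] linear_hom_closed[OF P, of q] by simp
  next
    case zero
    have "tensor_proj 0 = tensor_proj (single (\<zero>\<^bsub>A\<^esub>, \<zero>\<^bsub>B\<^esub>) 0)" by simp
    thus ?case using psingle[of "\<zero>\<^bsub>A\<^esub>" "\<zero>\<^bsub>B\<^esub>" 0] by simp
  qed
  thus ?thesis using p by simp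
qed

lemma tensor_linear_eq:
  assumes "g \<in> linear_hom (tensor A B) U" "h \<in> linear_hom (tensor A B) U"
    and "\<And>x y. x \<in> carrier A \<Longrightarrow> y \<in> carrier B \<Longrightarrow> g (pure_tensor A B x y) = h (pure_tensor A B x y)"
    and "C \<in> carrier (tensor A B)"
  shows "g C = h C"
  using assms(4) by (induction rule: tensor_induct)
    (simp_all add: assms(3) linear_hom_add[OF assms(1)] linear_hom_add[OF assms(2)])

text \<open>The kernel of a linear map is a subspace, so it contains the span of the relations once
  it contains the relations, and these express bilinearity of \<open>f\<close>.\<close>

lemma lin_ext_tensor_kernel:
  assumes "vspace U" "f \<in> bilinear_hom A B U" "r \<in> tensor_kernel A B"
  shows "lin_ext U (\<lambda>z. f (fst z) (snd z)) r = \<zero>\<^bsub>U\<^esub>"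
proof -
  interpret U: vspace U by fact
  let ?F = pair_algebra
  let ?g = "lin_ext U (\<lambda>z. f (fst z) (snd z))"
  have c: "(\<lambda>z. f (fst z) (snd z)) \<in> carrier (A \<times>\<times> B) \<rightarrow> carrier U"
    using bilinear_hom_closed[OF assms(2)] by auto
  have lin: "?g \<in> linear_hom ?F U" using c by (rule U.lin_ext_linear)
  have minus: "?g (p - q) = ?g p \<ominus>\<^bsub>U\<^esub> ?g q" if "p \<in> carrier ?F" "q \<in> carrier ?F" for p q
    using linear_hom_minus[OF F.vspace_axioms U.vspace_axioms lin that] monoid_algebra_minus[OF tensor_monoid that] by simp
  have dc: "p - q \<in> carrier ?F" if "p \<in> carrier ?F" "q \<in> carrier ?F" for p q
    using that by (simp add: keys_diff_subset)
  have sc: "single (x, y) d \<in> carrier ?F" if "x \<in> carrier A" "y \<in> carrier B" for x y d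
    using that by simp
  have gs: "?g (single (x, y) d) = d \<odot>\<^bsub>U\<^esub> f x y" if "x \<in> carrier A" "y \<in> carrier B" for x y d
    using that bilinear_hom_closed[OF assms(2), of x y] by simp
  have fc: "f x y \<in> carrier U" if "x \<in> carrier A" "y \<in> carrier B" for x y
    by (rule bilinear_hom_closed[OF assms(2) that])
  have "tensor_kernel A B \<subseteq> {r \<in> carrier ?F. ?g r = \<zero>\<^bsub>U\<^esub>}"
    unfolding tensor_kernel_def
  proof (rule subspace_span_least)
    show "submodule {r \<in> carrier ?F. ?g r = \<zero>\<^bsub>U\<^esub>} base_field ?F"
      by (rule F.linear_kernel_submodule[OF U.vspace_axioms lin])
    show "tensor_relations A B \<subseteq> {r \<in> carrier ?F. ?g r = \<zero>\<^bsub>U\<^esub>}"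
    proof
      fix r assume r: "r \<in> tensor_relations A B"
      hence "?g r = \<zero>\<^bsub>U\<^esub>"
      proof (cases rule: tensor_relations_cases)
        case (add_left x x' y)
        have "f (x \<oplus>\<^bsub>A\<^esub> x') y = f x y \<oplus>\<^bsub>U\<^esub> f x' y"
          using add_left by (intro linear_hom_add[OF bilinear_hom_left[OF assms(2)]])
        thus ?thesis using add_left fc
          by (simp only: minus sc dc gs A.a_closed U.scale_one U.a_closed)
            (simp add: U.add_minus_minus)
      next
        case (add_right x y y')
        have "f x (y \<oplus>\<^bsub>B\<^esub> y') = f x y \<oplus>\<^bsub>U\<^esub> f x y'"
          using add_right by (intro linear_hom_add[OF bilinear_hom_right[OF assms(2)]])
        thus ?thesis using add_right fc
          by (simp only: minus sc dc gs B.a_closed U.scale_one U.a_closed)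
            (simp add: U.add_minus_minus)
      next
        case (scale_left c x y)
        have "f (c \<odot>\<^bsub>A\<^esub> x) y = c \<odot>\<^bsub>U\<^esub> f x y"
          using scale_left by (intro linear_hom_scale[OF bilinear_hom_left[OF assms(2)]])
        thus ?thesis using scale_left fc
          by (simp only: minus sc dc gs A.scale_closed U.scale_one U.scale_closed)
            (simp add: U.minus_eq U.r_neg)
      next
        case (scale_right c x y)
        have "f x (c \<odot>\<^bsub>B\<^esub> y) = c \<odot>\<^bsub>U\<^esub> f x y"
          using scale_right by (intro linear_hom_scale[OF bilinear_hom_right[OF assms(2)]])
        thus ?thesis using scale_right fc
          by (simp only: minus sc dc gs B.scale_closed U.scale_one U.scale_closed)
            (simp add: U.minus_eq U.r_neg)
      qed
      thus "r \<in> {r \<in> carrier ?F. ?g r = \<zero>\<^bsub>U\<^esub>}" using subsetD[OF tensor_relations_carrier r] by simp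
    qed
  qed
  from subsetD[OF this assms(3)] show ?thesis by simp
qed

lemma tensor_lift_proj:
  assumes "vspace U" "f \<in> bilinear_hom A B U" "keys p \<subseteq> carrier A \<times> carrier B"
  shows "tensor_lift U f (tensor_proj p) = lin_ext U (\<lambda>z. f (fst z) (snd z)) p"
proof -
  interpret U: vspace U by fact
  have c: "(\<lambda>z. f (fst z) (snd z)) \<in> carrier (A \<times>\<times> B) \<rightarrow> carrier U"
    using bilinear_hom_closed[OF assms(2)] by auto
  show ?thesis unfolding tensor_lift_def lin_ext_def[symmetric]
    using assms(3) by (intro quotient_lift_coset[OF F.assoc_algebra_axioms tensor_kernel_ideal U.vspace_axioms]
      U.lin_ext_linear c lin_ext_tensor_kernel[OF assms(1,2)]) auto
qed

lemma tensor_lift_linear: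
  assumes "vspace U" "f \<in> bilinear_hom A B U"
  shows "tensor_lift U f \<in> linear_hom (tensor A B) U"
proof -
  interpret U: vspace U by fact
  have c: "(\<lambda>z. f (fst z) (snd z)) \<in> carrier (A \<times>\<times> B) \<rightarrow> carrier U"
    using bilinear_hom_closed[OF assms(2)] by auto
  show ?thesis unfolding tensor_lift_def lin_ext_def[symmetric] tensor_def
    by (intro quotient_lift_linear[OF F.assoc_algebra_axioms tensor_kernel_ideal U.vspace_axioms]
      U.lin_ext_linear c lin_ext_tensor_kernel[OF assms])
qed

lemma tensor_lift_pure:
  assumes "vspace U" "f \<in> bilinear_hom A B U" "x \<in> carrier A" "y \<in> carrier B"
  shows "tensor_lift U f (pure_tensor A B x y) = f x y"
proof -
  interpret U: vspace U by fact
  show ?thesis using assms(3,4) bilinear_hom_closed[OF assms(2-4)]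
    by (simp add: pure_tensor_def tensor_lift_proj[OF assms(1,2)])
qed

text \<open>Both sides of multiplicativity are additive in each factor, so it may be tested on pure
  tensors.\<close>

lemma tensor_algebra_homI:
  assumes "assoc_algebra E" "g \<in> linear_hom (tensor A B) E"
    and mult: "\<And>x y x' y'. x \<in> carrier A \<Longrightarrow> y \<in> carrier B \<Longrightarrow> x' \<in> carrier A \<Longrightarrow> y' \<in> carrier B \<Longrightarrow>
      g (pure_tensor A B (x \<otimes>\<^bsub>A\<^esub> x') (y \<otimes>\<^bsub>B\<^esub> y')) = g (pure_tensor A B x y) \<otimes>\<^bsub>E\<^esub> g (pure_tensor A B x' y')"
    and one: "g (pure_tensor A B \<one>\<^bsub>A\<^esub> \<one>\<^bsub>B\<^esub>) = \<one>\<^bsub>E\<^esub>"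
  shows "g \<in> algebra_hom (tensor A B) E"
proof (rule algebra_homI[OF assms(2)])
  interpret E: assoc_algebra E by fact
  note add = linear_hom_add[OF assms(2)] and closed = linear_hom_closed[OF assms(2)]
  show "g \<one>\<^bsub>tensor A B\<^esub> = \<one>\<^bsub>E\<^esub>" using one by (simp add: pure_tensor_one)
  fix C D assume C: "C \<in> carrier (tensor A B)" and D: "D \<in> carrier (tensor A B)"
  from C show "g (C \<otimes>\<^bsub>tensor A B\<^esub> D) = g C \<otimes>\<^bsub>E\<^esub> g D"
  proof (induction rule: tensor_induct)
    case (pure x y)
    note xy = pure
    from D show ?case
    proof (induction rule: tensor_induct)
      case (pure x' y')
      thus ?case using xy by (simp add: pure_tensor_mult mult)
    next
      case (add C' D')
      thus ?case using xy by (simp add: T.r_distr E.r_distr linear_hom_add[OF assms(2)] closed)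
    qed
  next
    case (add C' D')
    thus ?case using D by (simp add: T.l_distr E.l_distr linear_hom_add[OF assms(2)] closed)
  qed
qed

end

section \<open>Tensor algebras\<close>

lemma word_monoid_simps [simp]:
  "carrier (word_monoid V) = lists (carrier V)" "v \<otimes>\<^bsub>word_monoid V\<^esub> w = v @ w" "\<one>\<^bsub>word_monoid V\<^esub> = []"
  by (simp_all add: word_monoid_def)

lemma word_monoid_monoid: "Group.monoid (word_monoid V)"
  by (rule monoidI) auto

abbreviation word_algebra :: "('k::field, 'a) module \<Rightarrow> ('k, 'a list \<Rightarrow>\<^sub>0 'k) module"
  where "word_algebra V \<equiv> monoid_algebra (word_monoid V)"

lemma word_algebra_algebra: "assoc_algebra (word_algebra V)"
  by (rule monoid_algebra_algebra[OF word_monoid_monoid])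

definition word_prod :: "('k::field, 'b) module \<Rightarrow> ('a \<Rightarrow> 'b) \<Rightarrow> 'a list \<Rightarrow> 'b"
  where "word_prod A f w = foldr (\<lambda>x a. f x \<otimes>\<^bsub>A\<^esub> a) w \<one>\<^bsub>A\<^esub>"

lemma word_prod_simps [simp]:
  "word_prod A f [] = \<one>\<^bsub>A\<^esub>" "word_prod A f (x # w) = f x \<otimes>\<^bsub>A\<^esub> word_prod A f w"
  by (simp_all add: word_prod_def)

lemma (in assoc_algebra) word_prod_closed:
  "f \<in> V \<rightarrow> carrier A \<Longrightarrow> w \<in> lists V \<Longrightarrow> word_prod A f w \<in> carrier A"
  by (induction w) (auto simp: Pi_iff)

lemma (in assoc_algebra) word_prod_append:
  "f \<in> V \<rightarrow> carrier A \<Longrightarrow> v \<in> lists V \<Longrightarrow> w \<in> lists V \<Longrightarrow>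
    word_prod A f (v @ w) = word_prod A f v \<otimes> word_prod A f w"
  by (induction v) (auto simp: Pi_iff word_prod_closed m_assoc)

lemma word_algebra_lift:
  assumes "assoc_algebra A" "f \<in> carrier V \<rightarrow> carrier A"
  shows "lin_ext A (word_prod A f) \<in> algebra_hom (word_algebra V) A"
proof -
  interpret A: assoc_algebra A by fact
  show ?thesis
    using assms(2)
    by (intro monoid_algebra_lift[OF word_monoid_monoid A.assoc_algebra_axioms])
      (auto simp: A.word_prod_closed A.word_prod_append)
qed

lemma algebra_hom_word:
  assumes "g \<in> algebra_hom (word_algebra V) A" "w \<in> lists (carrier V)"
  shows "g (single w 1) = word_prod A (\<lambda>x. g (single [x] 1)) w"
  using assms(2)
proof (induction w)
  case Nil
  show ?case using algebra_hom_one[OF assms(1)] by simp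
next
  case (Cons x w)
  hence "g (single [x] 1 \<otimes>\<^bsub>word_algebra V\<^esub> single w 1) =
      g (single [x] 1) \<otimes>\<^bsub>A\<^esub> g (single w 1)"
    by (intro algebra_hom_mult[OF assms(1)]) simp_all
  thus ?case using Cons by simp
qed

lemma word_prod_cong:
  "(\<And>x. x \<in> V \<Longrightarrow> f x = g x) \<Longrightarrow> w \<in> lists V \<Longrightarrow> word_prod A f w = word_prod A g w"
  by (induction w) auto

lemma generator_relations_cases [consumes 1, case_names add scale]:
  assumes "r \<in> generator_relations V"
  obtains x y where "x \<in> carrier V" "y \<in> carrier V"
      "r = single [x \<oplus>\<^bsub>V\<^esub> y] 1 - single [x] 1 - single [y] 1"
    | c x where "x \<in> carrier V" "r = single [c \<odot>\<^bsub>V\<^esub> x] 1 - single [x] c"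
  using assms unfolding generator_relations_def by blast

lemma generator_relationsI:
  "x \<in> carrier V \<Longrightarrow> y \<in> carrier V \<Longrightarrow>
    single [x \<oplus>\<^bsub>V\<^esub> y] 1 - single [x] 1 - single [y] 1 \<in> generator_relations V"
  "x \<in> carrier V \<Longrightarrow> single [c \<odot>\<^bsub>V\<^esub> x] 1 - single [x] c \<in> generator_relations V"
  unfolding generator_relations_def by blast+

lemma generator_relations_carrier:
  assumes "vspace V"
  shows "generator_relations V \<subseteq> carrier (word_algebra V)"
proof
  interpret V: vspace V by fact
  fix r assume "r \<in> generator_relations V"
  thus "r \<in> carrier (word_algebra V)"
    by (cases rule: generator_relations_cases) (simp_all add: keys_diff_subset)
qed

lemma tensor_algebra_kernel_ideal:
  assumes "vspace V"
  shows "ideal (tensor_algebra_kernel V) (word_algebra V)"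
  unfolding tensor_algebra_kernel_def
  by (rule ring.genideal_ideal[OF assoc_algebra.axioms(1)[OF word_algebra_algebra] generator_relations_carrier[OF assms]])

abbreviation word_proj :: "('k::field, 'a) module \<Rightarrow> ('a list \<Rightarrow>\<^sub>0 'k) \<Rightarrow> ('a list \<Rightarrow>\<^sub>0 'k) set"
  where "word_proj V p \<equiv> tensor_algebra_kernel V +>\<^bsub>word_algebra V\<^esub> p"

lemma tensor_algebra_algebra: "vspace V \<Longrightarrow> assoc_algebra (tensor_algebra V)"
  unfolding tensor_algebra_def
  by (rule quotient_algebra_algebra[OF word_algebra_algebra tensor_algebra_kernel_ideal])

lemma word_proj_hom: "vspace V \<Longrightarrow> word_proj V \<in> algebra_hom (word_algebra V) (tensor_algebra V)"
  unfolding tensor_algebra_def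
  by (rule quotient_proj_hom[OF word_algebra_algebra tensor_algebra_kernel_ideal])

lemma tensor_algebra_carrier:
  "vspace V \<Longrightarrow> carrier (tensor_algebra V) = word_proj V ` carrier (word_algebra V)"
  unfolding tensor_algebra_def
  by (rule quotient_carrier[OF word_algebra_algebra tensor_algebra_kernel_ideal])

lemma tensor_gen_linear:
  assumes "vspace V"
  shows "tensor_gen V \<in> linear_hom V (tensor_algebra V)"
proof -
  interpret V: vspace V by fact
  let ?F = "word_algebra V"
  interpret F: assoc_algebra ?F by (rule word_algebra_algebra)
  note P = algebra_hom_linear[OF word_proj_hom[OF assms]]
  have gen: "generator_relations V \<subseteq> tensor_algebra_kernel V"
    unfolding tensor_algebra_kernel_def by (rule F.genideal_self[OF generator_relations_carrier[OF assms]])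
  have rel: "word_proj V p = word_proj V q"
    if "p \<in> carrier ?F" "q \<in> carrier ?F" "p - q \<in> generator_relations V" for p q
  proof (rule quotient_coset_eqI[OF word_algebra_algebra tensor_algebra_kernel_ideal[OF assms] that(1,2)])
    show "p \<ominus>\<^bsub>?F\<^esub> q \<in> tensor_algebra_kernel V"
      unfolding monoid_algebra_minus[OF word_monoid_monoid that(1,2)]
      by (rule subsetD[OF gen that(3)])
  qed
  have single: "single [x] c \<in> carrier ?F" if "x \<in> carrier V" for x c
    using that by simp
  have add: "word_proj V (single [x \<oplus>\<^bsub>V\<^esub> y] 1) =
      word_proj V (single [x] 1 \<oplus>\<^bsub>?F\<^esub> single [y] 1)"
    if "x \<in> carrier V" "y \<in> carrier V" for x y
    using that generator_relationsI(1)[OF that]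
    by (intro rel) (simp_all add: keys_add_subset diff_diff_eq)
  have scale: "word_proj V (single [c \<odot>\<^bsub>V\<^esub> x] 1) =
      word_proj V (c \<odot>\<^bsub>?F\<^esub> single [x] 1)"
    if "x \<in> carrier V" for x c
    using that generator_relationsI(2)[OF that] by (intro rel) simp_all
  show ?thesis unfolding tensor_gen_def
    by (intro linear_homI)
      (simp_all only: add scale linear_hom_add[OF P] linear_hom_scale[OF P] linear_hom_closed[OF P] single)
qed

text \<open>The kernel of an algebra map is an ideal, so it contains the generated ideal once it
  contains the generators, and these express linearity of \<open>f\<close>.\<close>

lemma lin_ext_tensor_algebra_kernel:
  assumes "vspace V" "assoc_algebra A" "f \<in> linear_hom V A" "r \<in> tensor_algebra_kernel V"
  shows "lin_ext A (word_prod A f) r = \<zero>\<^bsub>A\<^esub>"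
proof -
  interpret V: vspace V by fact
  interpret A: assoc_algebra A by fact
  let ?F = "word_algebra V"
  interpret F: assoc_algebra ?F by (rule word_algebra_algebra)
  let ?g = "lin_ext A (word_prod A f)"
  have f: "f \<in> carrier V \<rightarrow> carrier A" using assms(3) by (auto simp: linear_hom_def)
  have fc: "f x \<in> carrier A" if "x \<in> carrier V" for x using linear_hom_closed[OF assms(3) that] .
  have g: "?g \<in> algebra_hom ?F A" by (rule word_algebra_lift[OF assms(2) f])
  have minus: "?g (p - q) = ?g p \<ominus>\<^bsub>A\<^esub> ?g q" if "p \<in> carrier ?F" "q \<in> carrier ?F" for p q
    using linear_hom_minus[OF F.vspace_axioms A.vspace_axioms algebra_hom_linear[OF g] that]
      monoid_algebra_minus[OF word_monoid_monoid that] by simp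
  have dc: "p - q \<in> carrier ?F" if "p \<in> carrier ?F" "q \<in> carrier ?F" for p q
    using that by (simp add: keys_diff_subset)
  have sc: "single [x] c \<in> carrier ?F" if "x \<in> carrier V" for x c
    using that by simp
  have gs: "?g (single [x] c) = c \<odot>\<^bsub>A\<^esub> f x" if "x \<in> carrier V" for x c
    using fc[OF that] by simp
  have "tensor_algebra_kernel V \<subseteq> {r \<in> carrier ?F. ?g r = \<zero>\<^bsub>A\<^esub>}"
    unfolding tensor_algebra_kernel_def
  proof (rule F.genideal_minimal)
    show "ideal {r \<in> carrier ?F. ?g r = \<zero>\<^bsub>A\<^esub>} ?F"
      by (rule algebra_hom_kernel_ideal[OF word_algebra_algebra assms(2) g])
    show "generator_relations V \<subseteq> {r \<in> carrier ?F. ?g r = \<zero>\<^bsub>A\<^esub>}"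
    proof
      fix r assume r: "r \<in> generator_relations V"
      hence "?g r = \<zero>\<^bsub>A\<^esub>"
      proof (cases rule: generator_relations_cases)
        case (add x y)
        thus ?thesis using fc
          by (simp only: minus sc dc gs V.a_closed A.scale_one linear_hom_add[OF assms(3)] A.a_closed)
            (simp add: A.add_minus_minus)
      next
        case (scale c x)
        thus ?thesis using fc
          by (simp only: minus sc dc gs V.scale_closed A.scale_one linear_hom_scale[OF assms(3)] A.scale_closed)
            (simp add: A.minus_eq A.r_neg)
      qed
      thus "r \<in> {r \<in> carrier ?F. ?g r = \<zero>\<^bsub>A\<^esub>}" using subsetD[OF generator_relations_carrier[OF assms(1)] r] by simp
    qed
  qed
  from subsetD[OF this assms(4)] show ?thesis by simp
qed

lemma tensor_algebra_lift_hom: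
  assumes "vspace V" "assoc_algebra A" "f \<in> linear_hom V A"
  shows "tensor_algebra_lift A f \<in> algebra_hom (tensor_algebra V) A"
proof -
  have f: "f \<in> carrier V \<rightarrow> carrier A" using assms(3) by (auto simp: linear_hom_def)
  show ?thesis
    unfolding tensor_algebra_lift_def word_prod_def[symmetric] lin_ext_def[symmetric] tensor_algebra_def
    by (rule quotient_lift_algebra[OF word_algebra_algebra tensor_algebra_kernel_ideal[OF assms(1)] assms(2)
          word_algebra_lift[OF assms(2) f] lin_ext_tensor_algebra_kernel[OF assms]])
qed

lemma tensor_algebra_lift_proj:
  assumes "vspace V" "assoc_algebra A" "f \<in> linear_hom V A" "p \<in> carrier (word_algebra V)"
  shows "tensor_algebra_lift A f (word_proj V p) = lin_ext A (word_prod A f) p"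
proof -
  interpret A: assoc_algebra A by fact
  have f: "f \<in> carrier V \<rightarrow> carrier A" using assms(3) by (auto simp: linear_hom_def)
  show ?thesis
    unfolding tensor_algebra_lift_def word_prod_def[symmetric] lin_ext_def[symmetric]
    by (rule quotient_lift_coset[OF word_algebra_algebra tensor_algebra_kernel_ideal[OF assms(1)] A.vspace_axioms
          algebra_hom_linear[OF word_algebra_lift[OF assms(2) f]] lin_ext_tensor_algebra_kernel[OF assms(1-3)] assms(4)])
qed

lemma tensor_algebra_lift_gen:
  assumes "vspace V" "assoc_algebra A" "f \<in> linear_hom V A" "x \<in> carrier V"
  shows "tensor_algebra_lift A f (tensor_gen V x) = f x"
proof -
  interpret A: assoc_algebra A by fact
  have "f x \<in> carrier A" using linear_hom_closed[OF assms(3,4)] .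
  thus ?thesis using tensor_algebra_lift_proj[OF assms(1-3), of "single [x] 1"] assms(4)
    by (simp add: tensor_gen_def)
qed

text \<open>Pulled back to the word algebra, both maps are linear and multiplicative, hence
  determined by their values on one-letter words.\<close>

lemma tensor_algebra_hom_eq:
  assumes "vspace V" "assoc_algebra A"
    and g: "g \<in> algebra_hom (tensor_algebra V) A" and h: "h \<in> algebra_hom (tensor_algebra V) A"
    and eq: "\<And>x. x \<in> carrier V \<Longrightarrow> g (tensor_gen V x) = h (tensor_gen V x)"
    and "P \<in> carrier (tensor_algebra V)"
  shows "g P = h P"
proof -
  interpret A: assoc_algebra A by fact
  note g' = algebra_hom_compose[OF word_proj_hom[OF assms(1)] g]
    and h' = algebra_hom_compose[OF word_proj_hom[OF assms(1)] h]
  obtain p where p: "p \<in> carrier (word_algebra V)" "P = word_proj V p"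
    using assms(6) unfolding tensor_algebra_carrier[OF assms(1)] by (elim imageE)
  have "g (word_proj V p) = h (word_proj V p)"
  proof (rule free_linear_eq[OF A.vspace_axioms algebra_hom_linear[OF g'] algebra_hom_linear[OF h'] _ p(1)])
    fix w assume w: "w \<in> carrier (word_monoid V)"
    hence w: "w \<in> lists (carrier V)" by simp
    show "g (word_proj V (single w 1)) = h (word_proj V (single w 1))"
      unfolding algebra_hom_word[OF g' w] algebra_hom_word[OF h' w]
      by (rule word_prod_cong[OF _ w]) (use eq in \<open>simp add: tensor_gen_def\<close>)
  qed
  thus ?thesis using p by simp
qed

section \<open>Symmetric algebras\<close>

lemma commutator_ideal_ideal:
  assumes "vspace V"
  shows "ideal (commutator_ideal V) (tensor_algebra V)"
  and "x \<in> carrier V \<Longrightarrow> y \<in> carrier V \<Longrightarrow>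
    tensor_gen V x \<otimes>\<^bsub>tensor_algebra V\<^esub> tensor_gen V y \<ominus>\<^bsub>tensor_algebra V\<^esub>
      tensor_gen V y \<otimes>\<^bsub>tensor_algebra V\<^esub> tensor_gen V x \<in> commutator_ideal V"
proof -
  interpret T: assoc_algebra "tensor_algebra V" by (rule tensor_algebra_algebra[OF assms])
  let ?R = "{tensor_gen V x \<otimes>\<^bsub>tensor_algebra V\<^esub> tensor_gen V y \<ominus>\<^bsub>tensor_algebra V\<^esub>
      tensor_gen V y \<otimes>\<^bsub>tensor_algebra V\<^esub> tensor_gen V x | x y. x \<in> carrier V \<and> y \<in> carrier V}"
  have R: "?R \<subseteq> carrier (tensor_algebra V)"
    using linear_hom_closed[OF tensor_gen_linear[OF assms]] by auto
  show "ideal (commutator_ideal V) (tensor_algebra V)"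
    unfolding commutator_ideal_def by (rule T.genideal_ideal[OF R])
  assume "x \<in> carrier V" "y \<in> carrier V"
  thus "tensor_gen V x \<otimes>\<^bsub>tensor_algebra V\<^esub> tensor_gen V y \<ominus>\<^bsub>tensor_algebra V\<^esub>
      tensor_gen V y \<otimes>\<^bsub>tensor_algebra V\<^esub> tensor_gen V x \<in> commutator_ideal V"
    unfolding commutator_ideal_def by (intro subsetD[OF T.genideal_self[OF R]]) blast
qed

abbreviation sym_proj :: "('k::field, 'a) module \<Rightarrow> ('a list \<Rightarrow>\<^sub>0 'k) set \<Rightarrow> ('a list \<Rightarrow>\<^sub>0 'k) set set"
  where "sym_proj V P \<equiv> commutator_ideal V +>\<^bsub>tensor_algebra V\<^esub> P"

lemma symmetric_algebra_algebra: "vspace V \<Longrightarrow> assoc_algebra (symmetric_algebra V)"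
  unfolding symmetric_algebra_def
  by (rule quotient_algebra_algebra[OF tensor_algebra_algebra commutator_ideal_ideal(1)])

lemma sym_proj_hom: "vspace V \<Longrightarrow> sym_proj V \<in> algebra_hom (tensor_algebra V) (symmetric_algebra V)"
  unfolding symmetric_algebra_def
  by (rule quotient_proj_hom[OF tensor_algebra_algebra commutator_ideal_ideal(1)])

lemma symmetric_algebra_carrier:
  "vspace V \<Longrightarrow> carrier (symmetric_algebra V) = sym_proj V ` carrier (tensor_algebra V)"
  unfolding symmetric_algebra_def
  by (rule quotient_carrier[OF tensor_algebra_algebra commutator_ideal_ideal(1)])

lemma symmetric_gen_linear: "vspace V \<Longrightarrow> symmetric_gen V \<in> linear_hom V (symmetric_algebra V)"
  using linear_hom_compose[OF tensor_gen_linear algebra_hom_linear[OF sym_proj_hom]]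
  by (simp add: symmetric_gen_def[abs_def])

lemma symmetric_gen_commute:
  assumes "vspace V" "x \<in> carrier V" "y \<in> carrier V"
  shows "symmetric_gen V x \<otimes>\<^bsub>symmetric_algebra V\<^esub> symmetric_gen V y =
    symmetric_gen V y \<otimes>\<^bsub>symmetric_algebra V\<^esub> symmetric_gen V x"
proof -
  interpret T: assoc_algebra "tensor_algebra V" by (rule tensor_algebra_algebra[OF assms(1)])
  note c = linear_hom_closed[OF tensor_gen_linear[OF assms(1)]]
  show ?thesis unfolding symmetric_gen_def
    using assms c
    by (simp add: algebra_hom_mult[OF sym_proj_hom[OF assms(1)], symmetric])
      (intro quotient_coset_eqI[OF tensor_algebra_algebra commutator_ideal_ideal(1)] commutator_ideal_ideal(2) T.m_closed)
qed

text \<open>Evaluation at the point \<open>l\<close>: the character of the symmetric algebra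
  extending the linear form \<open>l\<close>, obtained by letting the character of the tensor
  algebra descend.\<close>

definition sym_eval :: "('k::field, 'a) module \<Rightarrow> ('a \<Rightarrow> 'k) \<Rightarrow> ('a list \<Rightarrow>\<^sub>0 'k) set set \<Rightarrow> 'k"
  where "sym_eval V l = (\<lambda>C. the_elem (tensor_algebra_lift base_module l ` C))"

lemma sym_eval_aux:
  fixes V :: "('k::field, 'a) module"
  assumes "vspace V" "l \<in> linear_hom V base_module"
  shows "sym_eval V l \<in> algebra_hom (symmetric_algebra V) base_module"
    and "P \<in> carrier (tensor_algebra V) \<Longrightarrow> sym_eval V l (sym_proj V P) = tensor_algebra_lift base_module l P"
proof -
  interpret V: vspace V by fact
  interpret T: assoc_algebra "tensor_algebra V" by (rule tensor_algebra_algebra[OF assms(1)])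
  interpret k: assoc_algebra "base_module :: ('k, 'k) module" by (rule base_module_algebra)
  let ?L = "tensor_algebra_lift base_module l"
  have L: "?L \<in> algebra_hom (tensor_algebra V) base_module"
    by (rule tensor_algebra_lift_hom[OF assms(1) base_module_algebra assms(2)])
  note c = linear_hom_closed[OF tensor_gen_linear[OF assms(1)]]
  have "commutator_ideal V \<subseteq> {r \<in> carrier (tensor_algebra V). ?L r = \<zero>\<^bsub>base_module\<^esub>}"
    unfolding commutator_ideal_def
  proof (rule T.genideal_minimal)
    show "ideal {r \<in> carrier (tensor_algebra V). ?L r = \<zero>\<^bsub>base_module\<^esub>} (tensor_algebra V)"
      by (rule algebra_hom_kernel_ideal[OF tensor_algebra_algebra[OF assms(1)] base_module_algebra L])
    \<comment> \<open>The target is the commutative field, so every commutator is killed, in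
      particular those of generators.\<close>
    have "?L (a \<otimes>\<^bsub>tensor_algebra V\<^esub> b \<ominus>\<^bsub>tensor_algebra V\<^esub> b \<otimes>\<^bsub>tensor_algebra V\<^esub> a) = 0"
      if "a \<in> carrier (tensor_algebra V)" "b \<in> carrier (tensor_algebra V)" for a b
      using that k.r_neg[of "?L a * ?L b"]
        linear_hom_minus[OF T.vspace_axioms k.vspace_axioms algebra_hom_linear[OF L]]
      by (simp add: algebra_hom_mult[OF L] mult.commute k.minus_eq)
    thus "{tensor_gen V x \<otimes>\<^bsub>tensor_algebra V\<^esub> tensor_gen V y \<ominus>\<^bsub>tensor_algebra V\<^esub>
      tensor_gen V y \<otimes>\<^bsub>tensor_algebra V\<^esub> tensor_gen V x | x y. x \<in> carrier V \<and> y \<in> carrier V}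
      \<subseteq> {r \<in> carrier (tensor_algebra V). ?L r = \<zero>\<^bsub>base_module\<^esub>}"
      using c by auto
  qed
  hence kill: "?L r = \<zero>\<^bsub>base_module\<^esub>" if "r \<in> commutator_ideal V" for r
    using that by auto
  show "sym_eval V l \<in> algebra_hom (symmetric_algebra V) base_module"
    unfolding sym_eval_def symmetric_algebra_def
    by (rule quotient_lift_algebra[OF tensor_algebra_algebra[OF assms(1)] commutator_ideal_ideal(1)[OF assms(1)]
          base_module_algebra L kill])
  show "P \<in> carrier (tensor_algebra V) \<Longrightarrow> sym_eval V l (sym_proj V P) = ?L P"
    unfolding sym_eval_def
    by (rule quotient_lift_coset[OF tensor_algebra_algebra[OF assms(1)] commutator_ideal_ideal(1)[OF assms(1)]
          k.vspace_axioms algebra_hom_linear[OF L] kill])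
qed

lemma sym_eval_gen:
  assumes "vspace V" "l \<in> linear_hom V base_module" "x \<in> carrier V"
  shows "sym_eval V l (symmetric_gen V x) = l x"
  unfolding symmetric_gen_def
  using assms linear_hom_closed[OF tensor_gen_linear[OF assms(1)]]
  by (simp add: sym_eval_aux(2) tensor_algebra_lift_gen base_module_algebra)

text \<open>The composite of the two projections and the extension of word products agree on words,
  so the former can be read off from any representative in the word algebra.\<close>

lemma symmetric_algebra_words:
  assumes "vspace V" "s \<in> carrier (symmetric_algebra V)"
  obtains p where "keys p \<subseteq> lists (carrier V)"
    "s = lin_ext (symmetric_algebra V) (word_prod (symmetric_algebra V) (symmetric_gen V)) p"
proof -
  let ?S = "symmetric_algebra V"
  interpret S: assoc_algebra ?S by (rule symmetric_algebra_algebra[OF assms(1)])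
  have c: "symmetric_gen V \<in> carrier V \<rightarrow> carrier ?S"
    using linear_hom_closed[OF symmetric_gen_linear[OF assms(1)]] by auto
  obtain P where P: "P \<in> carrier (tensor_algebra V)" "s = sym_proj V P"
    using assms(2) unfolding symmetric_algebra_carrier[OF assms(1)] by (elim imageE)
  obtain p where p: "p \<in> carrier (word_algebra V)" "P = word_proj V p"
    using P(1) unfolding tensor_algebra_carrier[OF assms(1)] by (elim imageE)
  note g = algebra_hom_compose[OF word_proj_hom sym_proj_hom, OF assms(1) assms(1)]
  have "sym_proj V (word_proj V p) = lin_ext ?S (word_prod ?S (symmetric_gen V)) p"
  proof (rule free_linear_eq[OF S.vspace_axioms algebra_hom_linear[OF g]
        algebra_hom_linear[OF word_algebra_lift[OF symmetric_algebra_algebra[OF assms(1)] c]] _ p(1)])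
    fix w assume w: "w \<in> carrier (word_monoid V)"
    hence w: "w \<in> lists (carrier V)" by simp
    show "sym_proj V (word_proj V (single w 1)) =
        lin_ext ?S (word_prod ?S (symmetric_gen V)) (single w 1)"
      unfolding algebra_hom_word[OF g w]
      using S.word_prod_closed[OF c w]
      by (simp add: symmetric_gen_def[abs_def] tensor_gen_def[abs_def])
  qed
  thus ?thesis using that[of p] p P by simp
qed

section \<open>Bases and linear functionals\<close>

text \<open>\<open>V\<close> is presented by formal sums of symbols for its elements modulo linear
  relations; formal sums fill a whole type, where linear algebra over types applies. A basis of the
  relations is extended by symbols; the elements they name form \<open>B\<close>, and
  \<open>c x\<close> is the normal form of the symbol of \<open>x\<close>.\<close>

lemma (in vspace) basis_coordinates:
  obtains B and c :: "'a \<Rightarrow> 'a \<Rightarrow>\<^sub>0 'k"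
  where "B \<subseteq> carrier V"
    and "\<And>x. x \<in> carrier V \<Longrightarrow> keys (c x) \<subseteq> B"
    and "\<And>b. b \<in> B \<Longrightarrow> c b = single b 1"
    and "\<And>x. x \<in> carrier V \<Longrightarrow> lin_ext V (\<lambda>b. b) (c x) = x"
    and "\<And>b. (\<lambda>x. lookup (c x) b) \<in> linear_hom V base_module"
proof -
  let ?s = "\<lambda>(c::'k) (p::'a \<Rightarrow>\<^sub>0 'k). Poly_Mapping.map ((*) c) p"
  interpret pm: vector_space ?s
    by unfold_locales (auto intro!: poly_mapping_eqI simp: lookup_add algebra_simps)
  interpret pp: vector_space_pair ?s ?s ..
  let ?ev = "lin_ext V (\<lambda>x. x)"
  let ?e = "\<lambda>x::'a. single x (1::'k)"
  \<comment> \<open>The linear relations among elements of \<open>V\<close>: the formal sums that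
    evaluate to zero.\<close>
  define K where "K = {p. keys p \<subseteq> carrier V \<and> ?ev p = \<zero>}"
  note ev_add = lin_ext_add[of "\<lambda>x. x" "carrier V", simplified]
  note ev_scale = lin_ext_scale[of "\<lambda>x. x" "carrier V", simplified]
  have K_sub: "pm.subspace K"
  proof (rule pm.subspaceI)
    show "0 \<in> K" by (simp add: K_def)
    show "p + q \<in> K" if "p \<in> K" "q \<in> K" for p q
      using that by (simp add: K_def ev_add keys_add_subset)
    show "?s c p \<in> K" if "p \<in> K" for p c
      using that order_trans[OF keys_scale_subset[of c p]] by (simp add: K_def ev_scale)
  qed
  obtain S where S: "S \<subseteq> K" "pm.independent S" "K \<subseteq> pm.span S"
    by (rule pm.maximal_independent_subset[of K]) blast
  \<comment> \<open>Extending inside the union of \<open>S\<close> with the symbols ensures that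
    each new basis vector is \<open>single x 1\<close> for some \<open>x\<close> in
    \<open>V\<close>.\<close>
  obtain B' where B': "S \<subseteq> B'" "B' \<subseteq> S \<union> ?e ` carrier V" "pm.independent B'" "S \<union> ?e ` carrier V \<subseteq> pm.span B'"
    by (rule pm.maximal_independent_subset_extend[of S "S \<union> ?e ` carrier V"]) (use S in auto)
  \<comment> \<open>On the span of \<open>B'\<close>, \<open>r\<close> is the projection along
    \<open>K\<close>: it kills the basis \<open>S\<close> of \<open>K\<close> and fixes the
    remaining basis vectors.\<close>
  obtain r where r: "Vector_Spaces.linear ?s ?s r" "\<forall>b\<in>B'. r b = (if b \<in> S then 0 else b)"
    using pp.linear_independent_extend[OF B'(3), of "\<lambda>b. if b \<in> S then 0 else b"] by blast
  interpret r: Vector_Spaces.linear ?s ?s r by (rule r(1))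
  define B where "B = {x \<in> carrier V. ?e x \<in> B' - S}"
  have rK: "r p = 0" if "p \<in> K" for p
  proof (rule pp.linear_eq_0_on_span[OF r(1)])
    show "p \<in> pm.span S" by (rule subsetD[OF S(3) that])
    show "r x = 0" if "x \<in> S" for x using r(2) subsetD[OF B'(1) that] that by simp
  qed
  \<comment> \<open>\<open>r p\<close> is a normal form of \<open>p\<close>: it is supported on
    \<open>B\<close> and differs from \<open>p\<close> by a relation.\<close>
  have span: "keys (r p) \<subseteq> B \<and> p - r p \<in> K" if "p \<in> pm.span B'" for p
    using that
  proof (induction rule: pm.span_induct_alt)
    case base
    show ?case by (simp add: r.zero pm.subspace_0[OF K_sub])
  next
    case (step c b p)
    have b: "keys (r b) \<subseteq> B \<and> b - r b \<in> K"
      using r(2) step(1) B'(2) S(1) by (auto simp: B_def pm.subspace_0[OF K_sub])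
    have eq: "?s c b + p - r (?s c b + p) = ?s c (b - r b) + (p - r p)"
      by (simp add: r.add r.scale pm.scale_right_diff_distrib)
    have "?s c (b - r b) + (p - r p) \<in> K" using b step by (intro pm.subspace_add[OF K_sub] pm.subspace_scale[OF K_sub]) auto
    moreover have "keys (r (?s c b + p)) \<subseteq> B"
      unfolding r.add r.scale using b step keys_scale_subset[of c "r b"] by (intro keys_add_subset) auto
    ultimately show ?case unfolding eq by blast
  qed
  have e_span: "?e x \<in> pm.span B'" if "x \<in> carrier V" for x using that B'(4) by blast
  define c where "c = (\<lambda>x. r (?e x))"
  have Bc: "B \<subseteq> carrier V" by (auto simp: B_def)
  have keys: "keys (c x) \<subseteq> B" if "x \<in> carrier V" for x
    using span[OF e_span[OF that]] by (simp add: c_def)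
  have cb: "c b = single b 1" if "b \<in> B" for b
    using that r(2) by (simp add: B_def c_def)
  have ev_e: "?ev (?e x) = x" if "x \<in> carrier V" for x
    using lin_ext_single[of "\<lambda>x. x" x 1] that by simp
  have ev_c: "?ev (c x) = x" if "x \<in> carrier V" for x
  proof -
    have K: "?e x - c x \<in> K" using span[OF e_span[OF that]] by (simp add: c_def)
    have k: "keys (c x) \<subseteq> carrier V" using keys[OF that] Bc by blast
    have "?ev ((?e x - c x) + c x) = ?ev (?e x - c x) \<oplus> ?ev (c x)"
      using K k by (intro ev_add) (auto simp: K_def)
    also have "\<dots> = ?ev (c x)" using K k lin_ext_closed[of "\<lambda>x. x" "carrier V" "c x"] by (simp add: K_def)
    finally show ?thesis using ev_e[OF that] by simp
  qed
  have ev_single: "?ev (single x a) = a \<odot> x" if "x \<in> carrier V" for x a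
    using lin_ext_single[of "\<lambda>x. x" x a] that by simp
  have r_single: "r (single x a) = ?s a (c x)" for x a
    using r.scale[of a "?e x"] by (simp add: c_def)
  have ks: "keys (single x a :: 'a \<Rightarrow>\<^sub>0 'k) \<subseteq> carrier V" if "x \<in> carrier V" for x a
    using that by simp
  have lin: "(\<lambda>x. lookup (c x) b) \<in> linear_hom V base_module" for b
  proof (rule linear_homI)
    fix x y assume x: "x \<in> carrier V" and y: "y \<in> carrier V"
    \<comment> \<open>Additivity of the coordinates is an instance of a relation: this formal sum
      evaluates to zero, so it lies in \<open>K\<close> and \<open>r\<close> kills it. Homogeneity
      is treated in the same way below.\<close>
    let ?p = "single (x \<oplus> y) 1 + (single x (-1) + single y (-1 :: 'k))"
    have xy: "x \<oplus> y \<in> carrier V" using x y by (rule a_closed)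
    have "?ev ?p = 1 \<odot> (x \<oplus> y) \<oplus> ((-1) \<odot> x \<oplus> (-1) \<odot> y)"
      by (simp only: ev_add ks keys_add_subset x y xy ev_single)
    also have "\<dots> = \<zero>"
      using x y add_minus_minus[of x y] by (simp add: minus_eq_scale a_assoc)
    finally have "?p \<in> K" unfolding K_def by (simp only: mem_Collect_eq ks keys_add_subset x y xy simp_thms)
    from rK[OF this] have "0 = lookup (r ?p) b" by simp
    also have "\<dots> = lookup (c (x \<oplus> y)) b - (lookup (c x) b + lookup (c y) b)"
      unfolding r.add r_single lookup_add lookup_scale by simp
    finally show "lookup (c (x \<oplus> y)) b = lookup (c x) b \<oplus>\<^bsub>base_module\<^esub> lookup (c y) b"
      by simp
  next
    fix a x assume x: "x \<in> carrier V"
    let ?p = "single (a \<odot> x) 1 + single x (- a)"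
    have ax: "a \<odot> x \<in> carrier V" using x by (rule scale_closed)
    have "?ev ?p = 1 \<odot> (a \<odot> x) \<oplus> (-a) \<odot> x"
      by (simp only: ev_add ks x ax ev_single)
    also have "\<dots> = \<zero>" using x scale_add_left[of x a "-a"] by simp
    finally have "?p \<in> K" unfolding K_def by (simp only: mem_Collect_eq ks keys_add_subset x ax simp_thms)
    from rK[OF this] have "0 = lookup (r ?p) b" by simp
    also have "\<dots> = lookup (c (a \<odot> x)) b - a * lookup (c x) b"
      unfolding r.add r_single lookup_add lookup_scale by simp
    finally show "lookup (c (a \<odot> x)) b = a \<odot>\<^bsub>base_module\<^esub> lookup (c x) b"
      by simp
  qed simp
  show ?thesis by (rule that[OF Bc keys cb ev_c lin])
qed

text \<open>The coordinate functionals of one basis determine an element. Equations in any vector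
  space can therefore be verified after applying functionals.\<close>

lemma (in vspace) functionals_separate:
  assumes "x \<in> carrier V" "y \<in> carrier V" "\<And>\<phi>. \<phi> \<in> linear_hom V base_module \<Longrightarrow> \<phi> x = \<phi> y"
  shows "x = y"
proof (rule basis_coordinates)
  fix B and c :: "'a \<Rightarrow> 'a \<Rightarrow>\<^sub>0 'k"
  assume ev: "\<And>x. x \<in> carrier V \<Longrightarrow> lin_ext V (\<lambda>b. b) (c x) = x"
    and "\<And>b. (\<lambda>x. lookup (c x) b) \<in> linear_hom V base_module"
  from assms(3)[OF this(2)] have "c x = c y" by (intro poly_mapping_eqI)
  thus "x = y" using ev[OF assms(1)] ev[OF assms(2)] by metis
qed

section \<open>Polynomials vanishing everywhere over an infinite field\<close>

text \<open>Multisets of variables serve as monomials. For fixed values of the other variables the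
  sum is a univariate polynomial in \<open>x\<close> that vanishes on an infinite field; its
  coefficients are zero, and they are sums of the same shape in fewer variables.\<close>

lemma multiset_poly_vanishing:
  fixes a :: "'x multiset \<Rightarrow> 'k::field"
  assumes inf: "infinite (UNIV :: 'k set)" and "finite W" "finite M" "\<And>m. m \<in> M \<Longrightarrow> set_mset m \<subseteq> W"
    and "\<And>g. (\<Sum>m\<in>M. a m * (\<Prod>x\<in>#m. g x)) = 0"
  shows "\<forall>m\<in>M. a m = 0"
  using assms(2-5)
proof (induction W arbitrary: M a rule: finite_induct)
  case empty
  \<comment> \<open>Without variables at most the empty monomial is present; its product is 1, so
    the vanishing sum is its coefficient.\<close>
  hence "M \<subseteq> {{#}}" by auto
  hence "M = {} \<or> M = {{#}}" by blast
  thus ?case using empty.prems(3) by auto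
next
  case (insert x W)
  let ?q = "filter_mset (\<lambda>y. y \<noteq> x)"
  show ?case
  proof
    fix m0 assume m0: "m0 \<in> M"
    define j where "j = count m0 x"
    \<comment> \<open>The monomials with the same degree in \<open>x\<close> as \<open>m0\<close>
      are those that contribute to the coefficient of degree \<open>j\<close>. Removing
      \<open>x\<close> is injective on them, and \<open>a'\<close> indexes their coefficients by the
      remaining monomial.\<close>
    define Mj where "Mj = {m \<in> M. count m x = j}"
    define a' where "a' = (\<lambda>m. a (m + replicate_mset j x))"
    have split: "m = ?q m + replicate_mset (count m x) x" for m
      by (rule multiset_eqI) auto
    have inj: "inj_on ?q Mj"
    proof (rule inj_onI)
      fix m m' assume "m \<in> Mj" "m' \<in> Mj" "?q m = ?q m'"
      thus "m = m'" using split[of m] split[of m'] by (simp add: Mj_def)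
    qed
    have prod_split: "(\<Prod>y\<in>#m. (g(x := t)) y) = t ^ count m x * (\<Prod>y\<in>#?q m. g y)"
      for m and g :: "'x \<Rightarrow> 'k" and t
    proof -
      have "(\<Prod>y\<in>#m. (g(x := t)) y) = (\<Prod>y\<in>#?q m + replicate_mset (count m x) x. (g(x := t)) y)"
        using split[of m] by simp
      also have "\<dots> = (\<Prod>y\<in>#?q m. (g(x := t)) y) * t ^ count m x"
        by simp
      also have "image_mset (g(x := t)) (?q m) = image_mset g (?q m)"
        by (rule image_mset_cong) auto
      finally show ?thesis by (simp add: mult.commute)
    qed
    have vanish: "(\<Sum>m\<in>?q ` Mj. a' m * (\<Prod>y\<in>#m. g y)) = 0" for g
    proof -
      \<comment> \<open>The variables other than \<open>x\<close> take the values given by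
        \<open>g\<close>, and \<open>x\<close> becomes the indeterminate.\<close>
      define P where "P = (\<Sum>m\<in>M. Polynomial.monom (a m * (\<Prod>y\<in>#?q m. g y)) (count m x))"
      have "poly P t = 0" for t
      proof -
        have "poly P t = (\<Sum>m\<in>M. a m * (\<Prod>y\<in>#m. (g(x := t)) y))"
          unfolding P_def poly_sum poly_monom prod_split by (intro sum.cong) auto
        thus ?thesis using insert.prems(3) by simp
      qed
      hence "P = 0" using poly_roots_finite[of P] inf by auto
      hence "0 = Polynomial.coeff P j" by simp
      also have "\<dots> = (\<Sum>m\<in>M. if count m x = j then a m * (\<Prod>y\<in>#?q m. g y) else 0)"
        unfolding P_def coeff_sum by (intro sum.cong) auto
      also have "\<dots> = (\<Sum>m\<in>Mj. a m * (\<Prod>y\<in>#?q m. g y))"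
        unfolding Mj_def using insert.prems(1) by (intro sum.inter_filter[symmetric])
      also have "\<dots> = (\<Sum>m\<in>Mj. a' (?q m) * (\<Prod>y\<in>#?q m. g y))"
        by (intro sum.cong) (auto simp: a'_def Mj_def split[symmetric])
      also have "\<dots> = (\<Sum>m\<in>?q ` Mj. a' m * (\<Prod>y\<in>#m. g y))"
        using inj by (simp add: sum.reindex)
      finally show ?thesis by simp
    qed
    have "\<forall>m\<in>?q ` Mj. a' m = 0"
      using insert.prems(1) vanish by (intro insert.IH) (use insert.prems(2) in \<open>fastforce simp: Mj_def\<close>)+
    moreover have "m0 \<in> Mj" using m0 by (simp add: Mj_def j_def)
    ultimately have "a' (?q m0) = 0" by simp
    thus "a m0 = 0" using split[of m0] by (simp add: a'_def j_def)
  qed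
qed

section \<open>Separation of points\<close>

text \<open>Commuting factors can be reordered: the first letter of \<open>v\<close> is moved to a
  place where it occurs in \<open>w\<close>, and induction treats \<open>w\<close> with that
  occurrence removed.\<close>

lemma (in assoc_algebra) word_prod_mset_cong:
  assumes f: "f \<in> B \<rightarrow> carrier A"
    and comm: "\<And>x y. x \<in> B \<Longrightarrow> y \<in> B \<Longrightarrow> f x \<otimes> f y = f y \<otimes> f x"
    and "v \<in> lists B" "mset v = mset w"
  shows "word_prod A f v = word_prod A f w"
proof -
  have comm': "f x \<otimes> word_prod A f u = word_prod A f u \<otimes> f x" if "x \<in> B" "u \<in> lists B" for x u
    using that(2)
  proof (induction u)
    case Nil
    show ?case using that f by (auto simp: Pi_iff)
  next
    case (Cons y u)
    have fc: "f x \<in> carrier A" "f y \<in> carrier A" "word_prod A f u \<in> carrier A"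
      using f that Cons word_prod_closed[OF f, of u] by (auto simp: Pi_iff)
    have "f x \<otimes> (f y \<otimes> word_prod A f u) = (f y \<otimes> f x) \<otimes> word_prod A f u"
      using fc comm[of x y] that(1) Cons.hyps by (simp add: m_assoc[symmetric])
    also have "\<dots> = f y \<otimes> (f x \<otimes> word_prod A f u)" using fc by (simp add: m_assoc)
    also have "f x \<otimes> word_prod A f u = word_prod A f u \<otimes> f x" using Cons by simp
    also have "f y \<otimes> \<dots> = f y \<otimes> word_prod A f u \<otimes> f x" using fc by (simp add: m_assoc)
    finally show ?case by simp
  qed
  show ?thesis using assms(3,4)
  proof (induction v arbitrary: w rule: list.induct)
    case Nil thus ?case by simp
  next
    case (Cons x v)
    have "x \<in> set w" using Cons.prems(2) by (metis list.set_intros(1) mset_eq_setD)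
    then obtain w1 w2 where w: "w = w1 @ x # w2" by (meson split_list)
    have "set w = set (x # v)" using Cons.prems(2) by (metis mset_eq_setD)
    hence wB: "w1 \<in> lists B" "w2 \<in> lists B" "x \<in> B" using Cons.prems(1) w by auto
    have fc: "f x \<in> carrier A" "word_prod A f w1 \<in> carrier A" "word_prod A f w2 \<in> carrier A"
      using f wB word_prod_closed[OF f] by (auto simp: Pi_iff)
    have "word_prod A f (x # v) = f x \<otimes> word_prod A f (w1 @ w2)"
      using Cons.IH[of "w1 @ w2"] Cons.prems w by simp
    also have "\<dots> = word_prod A f w1 \<otimes> (f x \<otimes> word_prod A f w2)"
      using fc wB comm'[of x w1] by (simp add: word_prod_append[OF f] m_assoc[symmetric])
    also have "\<dots> = word_prod A f w"
      using wB w word_prod_append[OF f wB(1), of "x # w2"] by simp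
    finally show ?case .
  qed
qed

text \<open>An expression of \<open>s\<close> as a combination of basis monomials has, at each
  linear form, the value of the polynomial with the same coefficients. By
  \<open>multiset_poly_vanishing\<close> these coefficients are zero, so \<open>s\<close> is
  zero.\<close>

lemma symmetric_algebra_separation:
  fixes V :: "('k::field, 'a) module"
  assumes inf: "infinite (UNIV :: 'k set)" and V: "vspace V" and s: "s \<in> carrier (symmetric_algebra V)"
    and van: "\<And>l. l \<in> linear_hom V base_module \<Longrightarrow> sym_eval V l s = 0"
  shows "s = \<zero>\<^bsub>symmetric_algebra V\<^esub>"
proof -
  let ?S = "symmetric_algebra V" and ?t = "symmetric_gen V"
  interpret V: vspace V by fact
  interpret S: assoc_algebra ?S by (rule symmetric_algebra_algebra[OF V])
  note t = symmetric_gen_linear[OF V]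
  have tc: "?t \<in> carrier V \<rightarrow> carrier ?S" using linear_hom_closed[OF t] by auto
  show ?thesis
  proof (rule V.basis_coordinates)
    fix B and c :: "'a \<Rightarrow> 'a \<Rightarrow>\<^sub>0 'k"
    assume B: "B \<subseteq> carrier V"
      and keys: "\<And>x. x \<in> carrier V \<Longrightarrow> keys (c x) \<subseteq> B"
      and cb: "\<And>b. b \<in> B \<Longrightarrow> c b = single b 1"
      and ev: "\<And>x. x \<in> carrier V \<Longrightarrow> lin_ext V (\<lambda>b. b) (c x) = x"
      and lin: "\<And>b. (\<lambda>x. lookup (c x) b) \<in> linear_hom V base_module"
    have tB: "?t \<in> B \<rightarrow> carrier ?S" using tc B by auto
    \<comment> \<open>\<open>wd\<close> fixes one ordering of the letters of each multiset;
      \<open>tm m\<close> below is the monomial multiplied in that order, and \<open>tm_add\<close>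
      rests on the order being immaterial.\<close>
    define wd where "wd = (\<lambda>m::'a multiset. SOME w. mset w = m)"
    have wd: "mset (wd m) = m" for m unfolding wd_def by (rule someI_ex) (rule ex_mset)
    define MB where "MB = {m. set_mset m \<subseteq> B}"
    have wdB: "wd m \<in> lists B" if "m \<in> MB" for m
    proof -
      have "set (wd m) = set_mset m" by (metis set_mset_mset wd)
      thus ?thesis using that by (auto simp: MB_def)
    qed
    define tm where "tm = (\<lambda>m. word_prod ?S ?t (wd m))"
    have tm: "tm \<in> MB \<rightarrow> carrier ?S" using S.word_prod_closed[OF tB wdB] by (auto simp: tm_def)
    have tm_add: "?t b \<otimes>\<^bsub>?S\<^esub> tm m = tm (add_mset b m)" if "b \<in> B" "m \<in> MB" for b m
    proof -
      have "word_prod ?S ?t (b # wd m) = word_prod ?S ?t (wd (add_mset b m))"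
      proof (rule S.word_prod_mset_cong[OF tB])
        show "b # wd m \<in> lists B" using that wdB by auto
        show "mset (b # wd m) = mset (wd (add_mset b m))" by (simp add: wd)
        show "?t x \<otimes>\<^bsub>?S\<^esub> ?t y = ?t y \<otimes>\<^bsub>?S\<^esub> ?t x" if "x \<in> B" "y \<in> B" for x y
          using that B by (intro symmetric_gen_commute[OF V]) auto
      qed
      thus ?thesis by (simp add: tm_def)
    qed
    \<comment> \<open>The span of the monomials in basis elements. It is stable under left
      multiplication by basis generators, hence by linearity under all generators; so it contains
      every word product and with them \<open>s\<close>.\<close>
    define G where "G = {lin_ext ?S tm r | r. keys r \<subseteq> MB}"
    have G0: "\<zero>\<^bsub>?S\<^esub> \<in> G" unfolding G_def
      by (intro CollectI exI[of _ 0] conjI S.lin_ext_zero[symmetric]) simp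
    have Gadd: "x \<oplus>\<^bsub>?S\<^esub> y \<in> G" if "x \<in> G" "y \<in> G" for x y
      using that S.lin_ext_add[OF tm] keys_add_subset unfolding G_def by (smt (verit) mem_Collect_eq)
    have Gscale: "a \<odot>\<^bsub>?S\<^esub> x \<in> G" if "x \<in> G" for a x
      using that S.lin_ext_scale[OF tm] keys_scale_subset unfolding G_def
      by (smt (verit) mem_Collect_eq order_trans)
    have Gc: "x \<in> carrier ?S" if "x \<in> G" for x
      using that S.lin_ext_closed[OF tm] by (auto simp: G_def)
    have Gtm: "tm m \<in> G" if "m \<in> MB" for m
    proof -
      have "lin_ext ?S tm (single m 1) = tm m"
        using funcset_mem[OF tm that] by simp
      thus ?thesis using that unfolding G_def
        by (intro CollectI exI[of _ "single m 1"]) auto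
    qed
    have Glin: "lin_ext ?S f p \<in> G" if "\<And>x. x \<in> D \<Longrightarrow> f x \<in> G" "keys p \<subseteq> D"
      for f and p :: "'z \<Rightarrow>\<^sub>0 'k" and D
    proof -
      have fc: "f \<in> D \<rightarrow> carrier ?S" using that(1) Gc by auto
      show ?thesis using that(2)
      proof (induction rule: free_induct)
        case (single x a)
        thus ?case using funcset_mem[OF fc] Gscale[OF that(1)] by simp
      next
        case (add p q)
        thus ?case by (simp add: S.lin_ext_add[OF fc] Gadd)
      next
        case zero show ?case by (simp add: G0)
      qed
    qed
    have Gmult_b: "?t b \<otimes>\<^bsub>?S\<^esub> x \<in> G" if b: "b \<in> B" and "x \<in> G" for b x
    proof -
      from that(2) obtain r where r: "x = lin_ext ?S tm r" "keys r \<subseteq> MB" by (auto simp: G_def)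
      have tb: "?t b \<in> carrier ?S" using tB b by auto
      have "(\<lambda>y. ?t b \<otimes>\<^bsub>?S\<^esub> y) \<in> linear_hom ?S ?S"
        using tb by (intro linear_homI) (auto simp: S.r_distr S.smult_mult_right)
      hence "?t b \<otimes>\<^bsub>?S\<^esub> x = lin_ext ?S (\<lambda>m. ?t b \<otimes>\<^bsub>?S\<^esub> tm m) r"
        unfolding r(1) by (intro S.lin_ext_compose[OF S.vspace_axioms _ tm r(2)])
      also have "\<dots> \<in> G"
      proof (rule Glin[OF _ r(2)])
        fix m assume "m \<in> MB"
        thus "?t b \<otimes>\<^bsub>?S\<^esub> tm m \<in> G" using b by (simp add: tm_add Gtm MB_def)
      qed
      finally show ?thesis .
    qed
    have Gmult: "?t v \<otimes>\<^bsub>?S\<^esub> x \<in> G" if v: "v \<in> carrier V" and x: "x \<in> G" for v x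
    proof -
      have xc: "x \<in> carrier ?S" using Gc[OF x] .
      have l: "(\<lambda>v. ?t v \<otimes>\<^bsub>?S\<^esub> x) \<in> linear_hom V ?S"
        using xc linear_hom_closed[OF t]
        by (intro linear_homI) (auto simp: linear_hom_add[OF t] linear_hom_scale[OF t] S.l_distr S.smult_mult_left)
      have "?t v \<otimes>\<^bsub>?S\<^esub> x = ?t (lin_ext V (\<lambda>b. b) (c v)) \<otimes>\<^bsub>?S\<^esub> x" by (simp add: ev[OF v])
      also have "\<dots> = lin_ext ?S (\<lambda>b. ?t b \<otimes>\<^bsub>?S\<^esub> x) (c v)"
        by (rule V.lin_ext_compose[OF S.vspace_axioms l _ keys[OF v]]) (use B in auto)
      also have "\<dots> \<in> G" by (rule Glin[OF _ keys[OF v]]) (rule Gmult_b[OF _ x])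
      finally show ?thesis .
    qed
    have Gword: "word_prod ?S ?t w \<in> G" if "w \<in> lists (carrier V)" for w
      using that
    proof (induction w)
      case Nil
      have "wd {#} = []" using wd[of "{#}"] by simp
      thus ?case using Gtm[of "{#}"] by (simp add: tm_def MB_def)
    next
      case (Cons v w)
      thus ?case using Gmult by auto
    qed
    obtain p where p: "keys p \<subseteq> lists (carrier V)" "s = lin_ext ?S (word_prod ?S ?t) p"
      by (rule symmetric_algebra_words[OF V s])
    have "s \<in> G" unfolding p(2) by (rule Glin[OF Gword p(1)])
    then obtain r where r: "s = lin_ext ?S tm r" "keys r \<subseteq> MB" by (auto simp: G_def)
    have "(\<Sum>m\<in>keys r. lookup r m * (\<Prod>b\<in>#m. g b)) = 0" for g
    proof -
      \<comment> \<open>A linear form can be prescribed freely on a basis, so every assignment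
        \<open>g\<close> of values to the variables is realized by a point \<open>l\<close>.\<close>
      define l where "l = (\<lambda>x. lin_ext base_module g (c x))"
      interpret k: assoc_algebra "base_module :: ('k, 'k) module" by (rule base_module_algebra)
      have "l \<in> linear_hom V base_module"
      proof (rule linear_homI)
        fix x y assume x: "x \<in> carrier V" and y: "y \<in> carrier V"
        have "c (x \<oplus>\<^bsub>V\<^esub> y) = c x + c y"
          using linear_hom_add[OF lin x y] by (intro poly_mapping_eqI) (simp add: lookup_add)
        thus "l (x \<oplus>\<^bsub>V\<^esub> y) = l x \<oplus>\<^bsub>base_module\<^esub> l y"
          using k.lin_ext_add[of g UNIV "c x" "c y"] by (simp add: l_def)
      next
        fix a x assume x: "x \<in> carrier V"
        have "c (a \<odot>\<^bsub>V\<^esub> x) = Poly_Mapping.map ((*) a) (c x)"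
          using linear_hom_scale[OF lin x] by (intro poly_mapping_eqI) simp
        thus "l (a \<odot>\<^bsub>V\<^esub> x) = a \<odot>\<^bsub>base_module\<^esub> l x"
          using k.lin_ext_scale[of g UNIV "c x" a] by (simp add: l_def)
      qed simp
      note l = this
      have lb: "l b = g b" if "b \<in> B" for b
        using cb[OF that] k.lin_ext_single[of g b 1] by (simp add: l_def)
      note e = sym_eval_aux(1)[OF V l]
      have ew: "sym_eval V l (word_prod ?S ?t w) = (\<Prod>x\<leftarrow>w. g x)" if "w \<in> lists B" for w
        using that
      proof (induction w)
        case Nil show ?case using algebra_hom_one[OF e] by simp
      next
        case (Cons x w)
        have "?t x \<in> carrier ?S" "word_prod ?S ?t w \<in> carrier ?S" "x \<in> carrier V"
          using Cons tB B S.word_prod_closed[OF tB] by auto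
        thus ?case using Cons by (simp add: algebra_hom_mult[OF e] sym_eval_gen[OF V l] lb)
      qed
      have "sym_eval V l (tm m) = (\<Prod>b\<in>#m. g b)" if "m \<in> MB" for m
      proof -
        have "sym_eval V l (tm m) = (\<Prod>b\<in>#mset (wd m). g b)"
          unfolding tm_def ew[OF wdB[OF that]] by (simp flip: mset_map add: prod_mset_prod_list)
        thus ?thesis by (simp add: wd)
      qed
      hence "(\<Sum>m\<in>keys r. lookup r m * (\<Prod>b\<in>#m. g b)) =
          (\<Sum>m\<in>keys r. lookup r m * sym_eval V l (tm m))"
        using r(2) by (intro sum.cong) auto
      also have "\<dots> = sym_eval V l s"
        unfolding r(1) S.lin_ext_compose[OF k.vspace_axioms algebra_hom_linear[OF e] tm r(2)]
        by (simp add: lin_ext_base)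
      also have "\<dots> = 0" by (rule van[OF l])
      finally show ?thesis .
    qed
    hence "\<forall>m\<in>keys r. lookup r m = 0"
      by (intro multiset_poly_vanishing[OF inf, where W = "\<Union>m\<in>keys r. set_mset m"]) auto
    hence "r = 0" by (intro poly_mapping_eqI) (metis in_keys_iff lookup_zero)
    thus ?thesis by (simp add: r(1))
  qed
qed

section \<open>Tensor products: linear parameters and separation by functionals on one
  factor\<close>

lemma linear_hom_cong:
  assumes "vspace V" "g \<in> linear_hom V W" "\<And>x. x \<in> carrier V \<Longrightarrow> f x = g x"
  shows "f \<in> linear_hom V W"
proof -
  interpret V: vspace V by fact
  show ?thesis using assms(2)
    by (intro linear_homI) (simp_all add: assms(3) linear_hom_closed linear_hom_add linear_hom_scale)
qed

text \<open>For nested Sweedler sums, where the inner lift depends on a variable of the outer one.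
  On pure tensors the lift is \<open>f x a b\<close>, and linearity in \<open>x\<close> survives
  sums of tensors.\<close>

lemma tensor_lift_param:
  assumes A: "assoc_algebra A" and B: "assoc_algebra B" and V: "vspace V" and U: "vspace U"
    and bil: "\<And>x. x \<in> carrier V \<Longrightarrow> f x \<in> bilinear_hom A B U"
    and lin: "\<And>a b. a \<in> carrier A \<Longrightarrow> b \<in> carrier B \<Longrightarrow> (\<lambda>x. f x a b) \<in> linear_hom V U"
    and C: "C \<in> carrier (tensor A B)"
  shows "(\<lambda>x. tensor_lift U (f x) C) \<in> linear_hom V U"
proof (rule linear_homI)
  interpret U: vspace U by fact
  interpret V: vspace V by fact
  note L = tensor_lift_linear[OF A B U bil]
  fix x assume x: "x \<in> carrier V"
  show "tensor_lift U (f x) C \<in> carrier U" by (rule linear_hom_closed[OF L[OF x] C])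
  show "tensor_lift U (f (c \<odot>\<^bsub>V\<^esub> x)) C = c \<odot>\<^bsub>U\<^esub> tensor_lift U (f x) C" for c
    using C
  proof (induction rule: tensor_induct[OF A B, consumes 1, case_names pure add])
    case (pure a b)
    thus ?case using x linear_hom_scale[OF lin]
      by (simp add: tensor_lift_pure[OF A B U bil])
  next
    case (add C D)
    thus ?case using x linear_hom_closed[OF L[OF x]]
      by (simp add: linear_hom_add[OF L] U.scale_add_right)
  qed
  fix y assume y: "y \<in> carrier V"
  show "tensor_lift U (f (x \<oplus>\<^bsub>V\<^esub> y)) C = tensor_lift U (f x) C \<oplus>\<^bsub>U\<^esub> tensor_lift U (f y) C"
    using C
  proof (induction rule: tensor_induct[OF A B, consumes 1, case_names pure add])
    case (pure a b)
    thus ?case using x y linear_hom_add[OF lin]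
      by (simp add: tensor_lift_pure[OF A B U bil])
  next
    case (add C D)
    thus ?case using x y linear_hom_closed[OF L[OF x]] linear_hom_closed[OF L[OF y]]
      by (simp add: linear_hom_add[OF L] U.add.m_ac)
  qed
qed

lemma bilinear_hom_compose_left:
  assumes "f \<in> bilinear_hom V' W U" "g \<in> linear_hom V V'"
  shows "(\<lambda>x y. f (g x) y) \<in> bilinear_hom V W U"
proof (rule bilinear_homI)
  show "f (g x) \<in> linear_hom W U" if "x \<in> carrier V" for x
    by (rule bilinear_hom_right[OF assms(1) linear_hom_closed[OF assms(2) that]])
  show "(\<lambda>x. f (g x) y) \<in> linear_hom V U" if "y \<in> carrier W" for y
    by (rule linear_hom_compose[OF assms(2) bilinear_hom_left[OF assms(1) that]])
qed

lemma scale_bilinear: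
  assumes "vspace V" "\<phi> \<in> linear_hom W base_module"
  shows "(\<lambda>x y. \<phi> y \<odot>\<^bsub>V\<^esub> x) \<in> bilinear_hom V W V" "(\<lambda>y x. \<phi> y \<odot>\<^bsub>V\<^esub> x) \<in> bilinear_hom W V V"
proof -
  interpret V: vspace V by fact
  show "(\<lambda>x y. \<phi> y \<odot>\<^bsub>V\<^esub> x) \<in> bilinear_hom V W V" "(\<lambda>y x. \<phi> y \<odot>\<^bsub>V\<^esub> x) \<in> bilinear_hom W V V"
    using linear_hom_add[OF assms(2)] linear_hom_scale[OF assms(2)]
    by (auto intro!: bilinear_homI linear_homI simp: V.scale_add_left V.scale_add_right V.scale_scale mult.commute)
qed

text \<open>Relative to a basis of \<open>B\<close>, a tensor is the sum of its slices:
  \<open>p b z\<close> \<otimes> b, where \<open>p b\<close> applies the coordinate at b to the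
  second factor. The hypothesis makes all slices vanish.\<close>

lemma tensor_separation:
  fixes A :: "('k::field, 'a) module" and B :: "('k, 'b) module"
  assumes A: "assoc_algebra A" and B: "assoc_algebra B" and z: "z \<in> carrier (tensor A B)"
    and van: "\<And>\<phi>. \<phi> \<in> linear_hom B base_module \<Longrightarrow>
      tensor_lift A (\<lambda>a b. \<phi> b \<odot>\<^bsub>A\<^esub> a) z = \<zero>\<^bsub>A\<^esub>"
  shows "z = \<zero>\<^bsub>tensor A B\<^esub>"
proof -
  interpret A: assoc_algebra A by fact
  interpret B: assoc_algebra B by fact
  let ?T = "tensor A B"
  interpret T: assoc_algebra ?T by (rule tensor_algebra_product[OF A B])
  note pure = pure_tensor_bilinear[OF A B]
  show ?thesis
  proof (rule B.basis_coordinates)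
    fix N and c :: "'b \<Rightarrow> 'b \<Rightarrow>\<^sub>0 'k"
    assume N: "N \<subseteq> carrier B"
      and keys: "\<And>x. x \<in> carrier B \<Longrightarrow> keys (c x) \<subseteq> N"
      and ev: "\<And>x. x \<in> carrier B \<Longrightarrow> lin_ext B (\<lambda>b. b) (c x) = x"
      and lin: "\<And>b. (\<lambda>x. lookup (c x) b) \<in> linear_hom B base_module"
    define p where "p = (\<lambda>b. tensor_lift A (\<lambda>a y. lookup (c y) b \<odot>\<^bsub>A\<^esub> a))"
    have p: "p b \<in> linear_hom ?T A" for b unfolding p_def
      by (rule tensor_lift_linear[OF A B A.vspace_axioms scale_bilinear(1)[OF A.vspace_axioms lin]])
    have p_pure: "p b (pure_tensor A B x y) = lookup (c y) b \<odot>\<^bsub>A\<^esub> x"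
      if "x \<in> carrier A" "y \<in> carrier B" for x y b unfolding p_def
      by (rule tensor_lift_pure[OF A B A.vspace_axioms scale_bilinear(1)[OF A.vspace_axioms lin] that])
    have pc: "p b C \<in> carrier A" if "C \<in> carrier ?T" for b C using linear_hom_closed[OF p that] .
    have fc: "(\<lambda>b. pure_tensor A B (p b C) b) \<in> F \<rightarrow> carrier ?T"
      if "C \<in> carrier ?T" "F \<subseteq> N" for C F
    proof (rule funcsetI)
      fix b assume "b \<in> F"
      hence "b \<in> carrier B" using that(2) N by (metis subsetD)
      thus "pure_tensor A B (p b C) b \<in> carrier ?T" by (rule bilinear_hom_closed[OF pure pc[OF that(1)]])
    qed
    \<comment> \<open>Different tensors need different finite sets of basis elements. Demanding the
      expansion over every finite set beyond \<open>F\<close> lets two expansions be added over a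
      common set.\<close>
    define Q where "Q = (\<lambda>F z. finite F \<and> F \<subseteq> N \<and> (\<forall>F'. finite F' \<and> F \<subseteq> F' \<and> F' \<subseteq> N \<longrightarrow>
        z = (\<Oplus>\<^bsub>?T\<^esub>b\<in>F'. pure_tensor A B (p b z) b)))"
    have QD: "C = (\<Oplus>\<^bsub>?T\<^esub>b\<in>F'. pure_tensor A B (p b C) b)"
      if "Q F C" "finite F' \<and> F \<subseteq> F' \<and> F' \<subseteq> N" for F F' C
      using that(1) unfolding Q_def by (elim conjE allE[of _ F'] impE) (rule that(2))
    have "\<exists>F. Q F z"
      using z
    proof (induction rule: tensor_induct[OF A B, consumes 1, case_names pure add])
      case (pure x y)
      show ?case unfolding Q_def
      proof (intro exI[of _ "keys (c y)"] conjI allI impI)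
        show "keys (c y) \<subseteq> N" by (rule keys[OF pure(2)])
        fix F' assume F': "finite F' \<and> keys (c y) \<subseteq> F' \<and> F' \<subseteq> N"
        hence FB: "b \<in> carrier B" if "b \<in> F'" for b using that N by (metis subsetD)
        have idF: "(\<lambda>b. b) \<in> F' \<rightarrow> carrier B" by (rule funcsetI) (rule FB)
        note l = bilinear_hom_right[OF pure_tensor_bilinear[OF A B] pure(1)]
        have lF: "(\<lambda>b. pure_tensor A B x b) \<in> F' \<rightarrow> carrier ?T"
          by (rule funcsetI) (rule linear_hom_closed[OF l FB])
        have "pure_tensor A B x y = pure_tensor A B x (lin_ext B (\<lambda>b. b) (c y))" by (simp add: ev[OF pure(2)])
        also have "\<dots> = lin_ext ?T (\<lambda>b. pure_tensor A B x b) (c y)"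
          using F' by (intro B.lin_ext_compose[OF T.vspace_axioms l idF]) simp
        also have "\<dots> = (\<Oplus>\<^bsub>?T\<^esub>b\<in>F'. lookup (c y) b \<odot>\<^bsub>?T\<^esub> pure_tensor A B x b)"
          using F' by (intro T.lin_ext_superset lF) simp_all
        also have "\<dots> = (\<Oplus>\<^bsub>?T\<^esub>b\<in>F'. pure_tensor A B (p b (pure_tensor A B x y)) b)"
        proof (rule T.add.finprod_cong'[OF refl])
          show "(\<lambda>b. pure_tensor A B (p b (pure_tensor A B x y)) b) \<in> F' \<rightarrow> carrier ?T"
            using F' pure by (intro fc bilinear_hom_closed[OF pure_tensor_bilinear[OF A B]]) simp_all
          fix b assume "b \<in> F'"
          hence b: "b \<in> carrier B" by (rule FB)
          show "lookup (c y) b \<odot>\<^bsub>?T\<^esub> pure_tensor A B x b = pure_tensor A B (p b (pure_tensor A B x y)) b"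
            unfolding p_pure[OF pure]
            by (rule linear_hom_scale[OF bilinear_hom_left[OF pure_tensor_bilinear[OF A B] b] pure(1), symmetric])
        qed
        finally show "pure_tensor A B x y = (\<Oplus>\<^bsub>?T\<^esub>b\<in>F'. pure_tensor A B (p b (pure_tensor A B x y)) b)" .
      qed simp
    next
      case (add C D)
      from add(3) obtain F where F: "Q F C" by (elim exE)
      from add(4) obtain G where G: "Q G D" by (elim exE)
      show ?case unfolding Q_def
      proof (intro exI[of _ "F \<union> G"] conjI allI impI)
        fix F' assume F': "finite F' \<and> F \<union> G \<subseteq> F' \<and> F' \<subseteq> N"
        have "C \<oplus>\<^bsub>?T\<^esub> D = (\<Oplus>\<^bsub>?T\<^esub>b\<in>F'. pure_tensor A B (p b C) b) \<oplus>\<^bsub>?T\<^esub> (\<Oplus>\<^bsub>?T\<^esub>b\<in>F'. pure_tensor A B (p b D) b)"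
          using F' by (intro arg_cong2[where f = "add ?T"] QD[OF F] QD[OF G]) simp_all
        also have "\<dots> = (\<Oplus>\<^bsub>?T\<^esub>b\<in>F'. pure_tensor A B (p b C) b \<oplus>\<^bsub>?T\<^esub> pure_tensor A B (p b D) b)"
          using F' add(1,2) by (intro T.finsum_addf[symmetric] fc) simp_all
        also have "\<dots> = (\<Oplus>\<^bsub>?T\<^esub>b\<in>F'. pure_tensor A B (p b (C \<oplus>\<^bsub>?T\<^esub> D)) b)"
        proof (rule T.add.finprod_cong'[OF refl])
          show "(\<lambda>b. pure_tensor A B (p b (C \<oplus>\<^bsub>?T\<^esub> D)) b) \<in> F' \<rightarrow> carrier ?T"
            using F' add(1,2) by (intro fc) simp_all
          fix b assume "b \<in> F'"
          hence b: "b \<in> carrier B" using F' N by (metis subsetD)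
          show "pure_tensor A B (p b C) b \<oplus>\<^bsub>?T\<^esub> pure_tensor A B (p b D) b = pure_tensor A B (p b (C \<oplus>\<^bsub>?T\<^esub> D)) b"
            using add(1,2) linear_hom_add[OF bilinear_hom_left[OF pure_tensor_bilinear[OF A B] b] pc pc]
            by (simp add: linear_hom_add[OF p])
        qed
        finally show "C \<oplus>\<^bsub>?T\<^esub> D = (\<Oplus>\<^bsub>?T\<^esub>b\<in>F'. pure_tensor A B (p b (C \<oplus>\<^bsub>?T\<^esub> D)) b)" .
      qed (use F G in \<open>simp_all only: Q_def finite_Un Un_subset_iff simp_thms\<close>)
    qed
    then obtain F where QF: "Q F z" by (elim exE)
    hence F: "finite F" "F \<subseteq> N" by (simp_all only: Q_def simp_thms)
    hence F3: "z = (\<Oplus>\<^bsub>?T\<^esub>b\<in>F. pure_tensor A B (p b z) b)" by (intro QD[OF QF]) simp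
    have "p b z = \<zero>\<^bsub>A\<^esub>" for b unfolding p_def by (rule van[OF lin])
    moreover have "pure_tensor A B \<zero>\<^bsub>A\<^esub> b = \<zero>\<^bsub>?T\<^esub>" if "b \<in> F" for b
    proof -
      have "b \<in> carrier B" using that F(2) N by (metis subsetD)
      from linear_hom_zero[OF A.vspace_axioms T.vspace_axioms bilinear_hom_left[OF pure this]] show ?thesis .
    qed
    ultimately have "(\<Oplus>\<^bsub>?T\<^esub>b\<in>F. pure_tensor A B (p b z) b) = \<zero>\<^bsub>?T\<^esub>"
      by (intro T.add.finprod_one_eqI) simp
    with F3 show ?thesis by (rule trans)
  qed
qed

lemma (in assoc_algebra) mult_left_linear: "c \<in> carrier A \<Longrightarrow> (\<lambda>x. x \<otimes> c) \<in> linear_hom A A"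
  by (rule linear_homI) (simp_all add: l_distr smult_mult_left)

lemma (in assoc_algebra) mult_right_linear: "c \<in> carrier A \<Longrightarrow> (\<lambda>x. c \<otimes> x) \<in> linear_hom A A"
  by (rule linear_homI) (simp_all add: r_distr smult_mult_right)

section \<open>Sweedler sums\<close>

text \<open>
  Equalities in arbitrary vector spaces are tested by linear functionals, so that all Sweedler sums
  take values in the field. With a representative of \<open>\<Delta> x\<close> fixed once and for all, such sums can be
  interchanged without any linearity condition.
\<close>

context hopf_algebra
begin

abbreviation "functionals \<equiv> linear_hom H (base_module :: ('k, 'k) module)"
abbreviation "bilinear_forms \<equiv> bilinear_hom H H (base_module :: ('k, 'k) module)"

definition comult_rep :: "'h \<Rightarrow> ('h \<times> 'h \<Rightarrow>\<^sub>0 'k)"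
  where "comult_rep x = (SOME p. keys p \<subseteq> carrier H \<times> carrier H \<and>
    \<Delta> x = tensor_kernel H H +>\<^bsub>monoid_algebra (H \<times>\<times> H)\<^esub> p)"

definition sweedler :: "('h \<Rightarrow> 'h \<Rightarrow> 'k) \<Rightarrow> 'h \<Rightarrow> 'k"
  where "sweedler f x = (\<Sum>z\<in>keys (comult_rep x).
    lookup (comult_rep x) z * f (fst z) (snd z))"

lemma comult_linear: "\<Delta> \<in> linear_hom H (tensor H H)"
  by (rule algebra_hom_linear[OF comult_hom])

lemma counit_linear: "\<epsilon> \<in> functionals"
  by (rule algebra_hom_linear[OF counit_hom])

lemma comult_rep:
  assumes "x \<in> carrier H"
  shows "keys (comult_rep x) \<subseteq> carrier H \<times> carrier H"
    and "\<Delta> x = tensor_kernel H H +>\<^bsub>monoid_algebra (H \<times>\<times> H)\<^esub> comult_rep x"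
proof -
  have "\<exists>p. keys p \<subseteq> carrier H \<times> carrier H \<and>
    \<Delta> x = tensor_kernel H H +>\<^bsub>monoid_algebra (H \<times>\<times> H)\<^esub> p"
    by (rule tensor_carrierE[OF assoc_algebra_axioms assoc_algebra_axioms linear_hom_closed[OF comult_linear assms]]) blast
  from someI_ex[OF this] show "keys (comult_rep x) \<subseteq> carrier H \<times> carrier H"
    "\<Delta> x = tensor_kernel H H +>\<^bsub>monoid_algebra (H \<times>\<times> H)\<^esub> comult_rep x"
    by (simp_all add: comult_rep_def)
qed

lemma sweedler_cong:
  assumes "x \<in> carrier H" "\<And>a b. a \<in> carrier H \<Longrightarrow> b \<in> carrier H \<Longrightarrow> f a b = g a b"
  shows "sweedler f x = sweedler g x"
  unfolding sweedler_def
proof (rule sum.cong[OF refl])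
  fix z assume "z \<in> keys (comult_rep x)"
  hence "z \<in> carrier H \<times> carrier H" by (rule subsetD[OF comult_rep(1)[OF assms(1)]])
  hence "f (fst z) (snd z) = g (fst z) (snd z)" by (intro assms(2)) (simp_all add: mem_Times_iff)
  thus "lookup (comult_rep x) z * f (fst z) (snd z) =
    lookup (comult_rep x) z * g (fst z) (snd z)" by simp
qed

lemma sweedler_swap:
  "sweedler (\<lambda>a b. sweedler (f a b) y) x = sweedler (\<lambda>c d. sweedler (\<lambda>a b. f a b c d) x) y"
  unfolding sweedler_def sum_distrib_left by (subst sum.swap) (simp add: mult_ac)

lemma sweedler_mult_left: "c * sweedler f x = sweedler (\<lambda>a b. c * f a b) x"
  unfolding sweedler_def sum_distrib_left by (simp add: mult_ac)

lemma sweedler_mult_right: "sweedler f x * c = sweedler (\<lambda>a b. f a b * c) x"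
  unfolding sweedler_def sum_distrib_right by (simp add: mult_ac)

lemma base_vspace: "vspace (base_module :: ('k, 'k) module)"
  by (rule assoc_algebra_vspace[OF base_module_algebra])

text \<open>The bridge from a Sweedler expression in an arbitrary vector space to a scalar sum: a
  functional passes through the linear extension over the representative.\<close>

lemma sweedler_tensor_lift:
  assumes "vspace U" "f \<in> bilinear_hom H H U" "\<phi> \<in> linear_hom U base_module" "x \<in> carrier H"
  shows "\<phi> (tensor_lift U f (\<Delta> x)) = sweedler (\<lambda>a b. \<phi> (f a b)) x"
proof -
  interpret U: vspace U by fact
  note D = comult_rep[OF assms(4)]
  have c: "(\<lambda>z. f (fst z) (snd z)) \<in> carrier H \<times> carrier H \<rightarrow> carrier U"
    by (rule funcsetI) (simp add: mem_Times_iff bilinear_hom_closed[OF assms(2)])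
  have "\<phi> (tensor_lift U f (\<Delta> x)) = \<phi> (lin_ext U (\<lambda>z. f (fst z) (snd z)) (comult_rep x))"
    unfolding D(2) by (simp only: tensor_lift_proj[OF assoc_algebra_axioms assoc_algebra_axioms assms(1,2) D(1)])
  also have "\<dots> = sweedler (\<lambda>a b. \<phi> (f a b)) x"
    unfolding sweedler_def lin_ext_base[symmetric]
    by (rule U.lin_ext_compose[OF base_vspace assms(3) c D(1)])
  finally show ?thesis .
qed

lemma sweedler_lift:
  assumes "f \<in> bilinear_forms" "x \<in> carrier H"
  shows "tensor_lift base_module f (\<Delta> x) = sweedler f x"
proof -
  have "(\<lambda>x. x) \<in> linear_hom base_module (base_module :: ('k, 'k) module)"
    by (rule linear_homI) simp_all
  from sweedler_tensor_lift[OF base_vspace assms(1) this assms(2)] show ?thesis .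
qed

text \<open>A functional on H \<otimes> H agrees with the lift of the bilinear form that it induces
  on pure tensors.\<close>

lemma sweedler_functional:
  assumes "\<phi> \<in> linear_hom (tensor H H) base_module" "x \<in> carrier H"
  shows "\<phi> (\<Delta> x) = sweedler (\<lambda>a b. \<phi> (pure_tensor H H a b)) x"
proof -
  note HH = assoc_algebra_axioms assoc_algebra_axioms
  note pure = bilinear_hom_compose[OF pure_tensor_bilinear[OF HH] assms(1)]
  have "\<phi> (\<Delta> x) = tensor_lift base_module (\<lambda>a b. \<phi> (pure_tensor H H a b)) (\<Delta> x)"
    by (rule tensor_linear_eq[OF HH assms(1) tensor_lift_linear[OF HH base_vspace pure] _ linear_hom_closed[OF comult_linear assms(2)]])
      (rule tensor_lift_pure[OF HH base_vspace pure, symmetric])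
  also have "\<dots> = sweedler (\<lambda>a b. \<phi> (pure_tensor H H a b)) x"
    by (rule sweedler_lift[OF pure assms(2)])
  finally show ?thesis .
qed

lemma functional_sweedler:
  assumes "f \<in> bilinear_forms"
  shows "sweedler f \<in> functionals"
  by (rule linear_hom_cong[OF vspace_axioms linear_hom_compose[OF comult_linear
        tensor_lift_linear[OF assoc_algebra_axioms assoc_algebra_axioms base_vspace assms]]])
    (rule sweedler_lift[OF assms, symmetric])

lemma functional_mult_left: "g \<in> functionals \<Longrightarrow> (\<lambda>x. c * g x) \<in> functionals"
  by (rule linear_homI) (simp_all add: linear_hom_add[of g] linear_hom_scale[of g] algebra_simps)

lemma functional_mult_right: "g \<in> functionals \<Longrightarrow> (\<lambda>x. g x * c) \<in> functionals"
  by (rule linear_homI) (simp_all add: linear_hom_add[of g] linear_hom_scale[of g] algebra_simps)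

lemma functional_sweedler_param:
  assumes "y \<in> carrier H" "\<And>a b. a \<in> carrier H \<Longrightarrow> b \<in> carrier H \<Longrightarrow> (\<lambda>x. f x a b) \<in> functionals"
  shows "(\<lambda>x. sweedler (f x) y) \<in> functionals"
proof (rule linear_homI)
  fix x z assume "x \<in> carrier H" "z \<in> carrier H"
  hence "sweedler (f (x \<oplus> z)) y = sweedler (\<lambda>a b. f x a b + f z a b) y"
    using linear_hom_add[OF assms(2)] by (intro sweedler_cong[OF assms(1)]) simp
  thus "sweedler (f (x \<oplus> z)) y = sweedler (f x) y \<oplus>\<^bsub>base_module\<^esub> sweedler (f z) y"
    by (simp add: sweedler_def ring_distribs sum.distrib)
next
  fix c x assume "x \<in> carrier H"
  hence "sweedler (f (c \<odot> x)) y = sweedler (\<lambda>a b. c * f x a b) y"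
    using linear_hom_scale[OF assms(2)] by (intro sweedler_cong[OF assms(1)]) simp
  thus "sweedler (f (c \<odot> x)) y = c \<odot>\<^bsub>base_module\<^esub> sweedler (f x) y"
    by (simp add: sweedler_mult_left)
qed simp

lemma functional_of_mult:
  assumes "\<phi> \<in> functionals" "c \<in> carrier H"
  shows "(\<lambda>x. \<phi> (x \<otimes> c)) \<in> functionals" "(\<lambda>x. \<phi> (c \<otimes> x)) \<in> functionals"
  using linear_hom_compose[OF mult_left_linear[OF assms(2)] assms(1)]
    linear_hom_compose[OF mult_right_linear[OF assms(2)] assms(1)] .

text \<open>A trilinear form induces a functional on (H \<otimes> H) \<otimes> H; applied to the two
  sides of coassociativity it gives the two nested sums.\<close>

lemma sweedler_coassoc:
  assumes f1: "\<And>b c. b \<in> carrier H \<Longrightarrow> c \<in> carrier H \<Longrightarrow> (\<lambda>a. f a b c) \<in> functionals"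
    and f2: "\<And>a c. a \<in> carrier H \<Longrightarrow> c \<in> carrier H \<Longrightarrow> (\<lambda>b. f a b c) \<in> functionals"
    and f3: "\<And>a b. a \<in> carrier H \<Longrightarrow> b \<in> carrier H \<Longrightarrow> (\<lambda>c. f a b c) \<in> functionals"
    and x: "x \<in> carrier H"
  shows "sweedler (\<lambda>l c. sweedler (\<lambda>a b. f a b c) l) x = sweedler (\<lambda>a r. sweedler (\<lambda>b c. f a b c) r) x"
proof -
  note HH = assoc_algebra_axioms assoc_algebra_axioms
  let ?T = "tensor H H"
  note T = tensor_algebra_product[OF HH]
  note TH = T assoc_algebra_axioms
  let ?U = "tensor ?T H"
  let ?q = "\<lambda>u v. tensor_lift ?U (\<lambda>x1 x2. pure_tensor ?T H (pure_tensor H H u x1) x2) (\<Delta> v)"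
  interpret U: assoc_algebra ?U by (rule tensor_algebra_product[OF TH])
  interpret T: assoc_algebra ?T by (rule T)
  note pT = pure_tensor_bilinear[OF HH] and pU = pure_tensor_bilinear[OF TH]
  have fc: "(\<lambda>a b. f a b c) \<in> bilinear_forms" if "c \<in> carrier H" for c
    using that by (intro bilinear_homI f1 f2)
  \<comment> \<open>\<open>k\<close> contracts the first two factors by \<open>f\<close>, with the
    third as a parameter; \<open>g\<close> below contracts all three and has the value
    \<open>f a b c\<close> on pure tensors.\<close>
  define k where "k = (\<lambda>t c. tensor_lift base_module (\<lambda>a b. f a b c) t)"
  have k: "k \<in> bilinear_hom ?T H base_module"
  proof (rule bilinear_homI)
    show "k t \<in> linear_hom H base_module" if "t \<in> carrier ?T" for t unfolding k_def
      by (rule tensor_lift_param[OF HH vspace_axioms base_vspace fc f3 that])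
    show "(\<lambda>t. k t c) \<in> linear_hom ?T base_module" if "c \<in> carrier H" for c unfolding k_def
      by (rule tensor_lift_linear[OF HH base_vspace fc[OF that]])
  qed
  define g where "g = tensor_lift base_module k"
  have g: "g \<in> linear_hom ?U base_module" unfolding g_def
    by (rule tensor_lift_linear[OF TH base_vspace k])
  have gp: "g (pure_tensor ?T H t c) = k t c" if "t \<in> carrier ?T" "c \<in> carrier H" for t c
    unfolding g_def by (rule tensor_lift_pure[OF TH base_vspace k that])
  have b1: "(\<lambda>v0 v1. pure_tensor ?T H (\<Delta> v0) v1) \<in> bilinear_hom H H ?U"
    by (rule bilinear_hom_compose_left[OF pU comult_linear])
  have pb: "(\<lambda>x1 x2. pure_tensor ?T H (pure_tensor H H v x1) x2) \<in> bilinear_hom H H ?U"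
    if "v \<in> carrier H" for v
    by (rule bilinear_hom_compose_left[OF pU bilinear_hom_right[OF pT that]])
  have b2: "(\<lambda>v0 v1. ?q v0 v1) \<in> bilinear_hom H H ?U"
  proof (rule bilinear_homI)
    show "(\<lambda>v1. ?q v0 v1) \<in> linear_hom H ?U"
      if "v0 \<in> carrier H" for v0
      by (rule linear_hom_compose[OF comult_linear tensor_lift_linear[OF HH U.vspace_axioms pb[OF that]]])
    show "(\<lambda>v0. ?q v0 v1) \<in> linear_hom H ?U"
      if "v1 \<in> carrier H" for v1
      by (rule tensor_lift_param[OF HH vspace_axioms U.vspace_axioms pb _ linear_hom_closed[OF comult_linear that]], assumption)
        (rule linear_hom_compose[OF bilinear_hom_left[OF pT] bilinear_hom_left[OF pU]])
  qed
  have "sweedler (\<lambda>l c. sweedler (\<lambda>a b. f a b c) l) x = sweedler (\<lambda>v0 v1. g (pure_tensor ?T H (\<Delta> v0) v1)) x"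
    by (rule sweedler_cong[OF x]) (simp add: gp linear_hom_closed[OF comult_linear] k_def sweedler_lift fc)
  also have "\<dots> = g (tensor_lift ?U (\<lambda>v0 v1. pure_tensor ?T H (\<Delta> v0) v1) (\<Delta> x))"
    by (rule sweedler_tensor_lift[OF U.vspace_axioms b1 g x, symmetric])
  also have "\<dots> = g (tensor_lift ?U (\<lambda>v0 v1. ?q v0 v1) (\<Delta> x))"
    using coassoc x by (simp add: coassociative_coaction_def)
  also have "\<dots> = sweedler (\<lambda>v0 v1. g (?q v0 v1)) x"
    by (rule sweedler_tensor_lift[OF U.vspace_axioms b2 g x])
  also have "\<dots> = sweedler (\<lambda>a r. sweedler (\<lambda>b c. f a b c) r) x"
  proof (rule sweedler_cong[OF x])
    fix a r assume a: "a \<in> carrier H" and r: "r \<in> carrier H"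
    have "g (?q a r) =
        sweedler (\<lambda>b c. g (pure_tensor ?T H (pure_tensor H H a b) c)) r"
      by (rule sweedler_tensor_lift[OF U.vspace_axioms pb[OF a] g r])
    also have "\<dots> = sweedler (\<lambda>b c. f a b c) r"
    proof (rule sweedler_cong[OF r])
      fix b c assume b: "b \<in> carrier H" and c: "c \<in> carrier H"
      show "g (pure_tensor ?T H (pure_tensor H H a b) c) = f a b c"
        unfolding gp[OF bilinear_hom_closed[OF pT a b] c] k_def
        by (rule tensor_lift_pure[OF HH base_vspace fc[OF c] a b])
    qed
    finally show "g (?q a r) = sweedler (\<lambda>b c. f a b c) r" .
  qed
  finally show ?thesis .
qed

text \<open>Multiplicativity of \<open>\<Delta>\<close>. With one factor fixed, multiplication
  followed by the lift of \<open>f\<close> is a functional on H \<otimes> H, so the two coproducts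
  can be expanded one after the other.\<close>

lemma sweedler_mult:
  assumes f: "f \<in> bilinear_forms" and x: "x \<in> carrier H" and y: "y \<in> carrier H"
  shows "sweedler f (x \<otimes> y) = sweedler (\<lambda>a b. sweedler (\<lambda>c d. f (a \<otimes> c) (b \<otimes> d)) y) x"
proof -
  note HH = assoc_algebra_axioms assoc_algebra_axioms
  let ?T = "tensor H H"
  interpret T: assoc_algebra ?T by (rule tensor_algebra_product[OF HH])
  let ?L = "tensor_lift base_module f"
  have L: "?L \<in> linear_hom ?T base_module" by (rule tensor_lift_linear[OF HH base_vspace f])
  note \<Delta>c = linear_hom_closed[OF comult_linear]
  note pc = bilinear_hom_closed[OF pure_tensor_bilinear[OF HH]]
  have ml: "(\<lambda>C. ?L (C \<otimes>\<^bsub>?T\<^esub> D)) \<in> linear_hom ?T base_module"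
    and mr: "(\<lambda>C. ?L (D \<otimes>\<^bsub>?T\<^esub> C)) \<in> linear_hom ?T base_module" if "D \<in> carrier ?T" for D
    using that linear_hom_add[OF L] linear_hom_scale[OF L]
    by (intro linear_homI; simp add: T.l_distr T.r_distr T.smult_mult_left T.smult_mult_right)+
  have "sweedler f (x \<otimes> y) = ?L (\<Delta> x \<otimes>\<^bsub>?T\<^esub> \<Delta> y)"
    using x y by (simp add: sweedler_lift[OF f, symmetric] algebra_hom_mult[OF comult_hom])
  also have "\<dots> = sweedler (\<lambda>a b. ?L (pure_tensor H H a b \<otimes>\<^bsub>?T\<^esub> \<Delta> y)) x"
    by (rule sweedler_functional[OF ml[OF \<Delta>c[OF y]] x])
  also have "\<dots> = sweedler (\<lambda>a b. sweedler (\<lambda>c d. f (a \<otimes> c) (b \<otimes> d)) y) x"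
  proof (rule sweedler_cong[OF x])
    fix a b assume a: "a \<in> carrier H" and b: "b \<in> carrier H"
    have "?L (pure_tensor H H a b \<otimes>\<^bsub>?T\<^esub> \<Delta> y) = sweedler (\<lambda>c d. ?L (pure_tensor H H a b \<otimes>\<^bsub>?T\<^esub> pure_tensor H H c d)) y"
      by (rule sweedler_functional[OF mr[OF pc[OF a b]] y])
    also have "\<dots> = sweedler (\<lambda>c d. f (a \<otimes> c) (b \<otimes> d)) y"
      using a b by (intro sweedler_cong[OF y])
        (simp add: pure_tensor_mult[OF HH] tensor_lift_pure[OF HH base_vspace f])
    finally show "?L (pure_tensor H H a b \<otimes>\<^bsub>?T\<^esub> \<Delta> y) = sweedler (\<lambda>c d. f (a \<otimes> c) (b \<otimes> d)) y" .
  qed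
  finally show ?thesis .
qed

lemma sweedler_one:
  assumes "f \<in> bilinear_forms"
  shows "sweedler f \<one> = f \<one> \<one>"
proof -
  note HH = assoc_algebra_axioms assoc_algebra_axioms
  have "sweedler f \<one> = tensor_lift base_module f (\<Delta> \<one>)"
    by (rule sweedler_lift[OF assms one_closed, symmetric])
  also have "\<Delta> \<one> = pure_tensor H H \<one> \<one>"
    by (simp add: algebra_hom_one[OF comult_hom] pure_tensor_one[OF HH])
  also have "tensor_lift base_module f \<dots> = f \<one> \<one>"
    by (rule tensor_lift_pure[OF HH base_vspace assms one_closed one_closed])
  finally show ?thesis .
qed

lemma sweedler_counit_left:
  assumes "g \<in> functionals" "x \<in> carrier H"
  shows "sweedler (\<lambda>a b. \<epsilon> a * g b) x = g x"
proof -
  have "g x = g (tensor_lift H (\<lambda>v0 v1. \<epsilon> v0 \<odot> v1) (\<Delta> x))"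
    using counit_left assms(2) by simp
  also have "\<dots> = sweedler (\<lambda>a b. g (\<epsilon> a \<odot> b)) x"
    by (rule sweedler_tensor_lift[OF vspace_axioms scale_bilinear(2)[OF vspace_axioms counit_linear] assms])
  also have "\<dots> = sweedler (\<lambda>a b. \<epsilon> a * g b) x"
    by (rule sweedler_cong[OF assms(2)]) (simp add: linear_hom_scale[OF assms(1)])
  finally show ?thesis by simp
qed

text \<open>Coassociativity of the coalgebra H \<otimes> H, applied to the pair x, y: both arguments
  are rebracketed together, as products of Sweedler components require.\<close>

lemma sweedler_coassoc2:
  assumes "\<And>x2 x3 y1 y2 y3. \<lbrakk>x2 \<in> carrier H; x3 \<in> carrier H; y1 \<in> carrier H; y2 \<in> carrier H; y3 \<in> carrier H\<rbrakk>
      \<Longrightarrow> (\<lambda>x1. f x1 x2 x3 y1 y2 y3) \<in> functionals"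
    and "\<And>x1 x3 y1 y2 y3. \<lbrakk>x1 \<in> carrier H; x3 \<in> carrier H; y1 \<in> carrier H; y2 \<in> carrier H; y3 \<in> carrier H\<rbrakk>
      \<Longrightarrow> (\<lambda>x2. f x1 x2 x3 y1 y2 y3) \<in> functionals"
    and "\<And>x1 x2 y1 y2 y3. \<lbrakk>x1 \<in> carrier H; x2 \<in> carrier H; y1 \<in> carrier H; y2 \<in> carrier H; y3 \<in> carrier H\<rbrakk>
      \<Longrightarrow> (\<lambda>x3. f x1 x2 x3 y1 y2 y3) \<in> functionals"
    and "\<And>x1 x2 x3 y2 y3. \<lbrakk>x1 \<in> carrier H; x2 \<in> carrier H; x3 \<in> carrier H; y2 \<in> carrier H; y3 \<in> carrier H\<rbrakk>
      \<Longrightarrow> (\<lambda>y1. f x1 x2 x3 y1 y2 y3) \<in> functionals"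
    and "\<And>x1 x2 x3 y1 y3. \<lbrakk>x1 \<in> carrier H; x2 \<in> carrier H; x3 \<in> carrier H; y1 \<in> carrier H; y3 \<in> carrier H\<rbrakk>
      \<Longrightarrow> (\<lambda>y2. f x1 x2 x3 y1 y2 y3) \<in> functionals"
    and "\<And>x1 x2 x3 y1 y2. \<lbrakk>x1 \<in> carrier H; x2 \<in> carrier H; x3 \<in> carrier H; y1 \<in> carrier H; y2 \<in> carrier H\<rbrakk>
      \<Longrightarrow> (\<lambda>y3. f x1 x2 x3 y1 y2 y3) \<in> functionals"
    and x: "x \<in> carrier H" and y: "y \<in> carrier H"
  shows "sweedler (\<lambda>x1 r. sweedler (\<lambda>y1 s. sweedler (\<lambda>x2 x3. sweedler (\<lambda>y2 y3. f x1 x2 x3 y1 y2 y3) s) r) y) x =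
    sweedler (\<lambda>l x3. sweedler (\<lambda>m y3. sweedler (\<lambda>x1 x2. sweedler (\<lambda>y1 y2. f x1 x2 x3 y1 y2 y3) m) l) y) x"
proof -
  \<comment> \<open>Interchanging the sums brings the components of \<open>y\<close> together. They
    are rebracketed inside, which leaves \<open>?g\<close>; then \<open>x\<close> is rebracketed,
    and a second interchange restores the order.\<close>
  let ?g = "\<lambda>x1 x2 x3. sweedler (\<lambda>m y3. sweedler (\<lambda>y1 y2. f x1 x2 x3 y1 y2 y3) m) y"
  have "sweedler (\<lambda>x1 r. sweedler (\<lambda>y1 s. sweedler (\<lambda>x2 x3. sweedler (\<lambda>y2 y3. f x1 x2 x3 y1 y2 y3) s) r) y) x =
    sweedler (\<lambda>x1 r. sweedler (\<lambda>x2 x3. sweedler (\<lambda>y1 s. sweedler (\<lambda>y2 y3. f x1 x2 x3 y1 y2 y3) s) y) r) x"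
    by (rule sweedler_cong[OF x]) (rule sweedler_swap)
  also have "\<dots> = sweedler (\<lambda>x1 r. sweedler (\<lambda>x2 x3. ?g x1 x2 x3) r) x"
    by (intro sweedler_cong x sweedler_coassoc[symmetric] assms(4-6) y)
  also have "\<dots> = sweedler (\<lambda>l x3. sweedler (\<lambda>x1 x2. ?g x1 x2 x3) l) x"
    by (intro sweedler_coassoc[symmetric] functional_sweedler_param assms(1-3) x y)
  also have "\<dots> = sweedler (\<lambda>l x3. sweedler (\<lambda>m y3. sweedler (\<lambda>x1 x2. sweedler (\<lambda>y1 y2. f x1 x2 x3 y1 y2 y3) m) l) y) x"
    by (rule sweedler_cong[OF x]) (rule sweedler_swap)
  finally show ?thesis .
qed

end

section \<open>The twisted algebra\<close>

context hopf_algebra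
begin

text \<open>Two nested lifts are the common shape of the twisted product and of the cocycle
  identity. The inner lift is linear in each outer variable by \<open>tensor_lift_param\<close>, so
  the outer lift is again that of a bilinear map.\<close>

lemma nested_tensor_lift:
  assumes U: "vspace U"
    and f1: "\<And>a b. a \<in> carrier H \<Longrightarrow> b \<in> carrier H \<Longrightarrow> f a b \<in> bilinear_hom H H U"
    and f2: "\<And>c d. c \<in> carrier H \<Longrightarrow> d \<in> carrier H \<Longrightarrow> (\<lambda>a b. f a b c d) \<in> bilinear_hom H H U"
  shows "(\<lambda>x y. tensor_lift U (\<lambda>a b. tensor_lift U (f a b) (\<Delta> y)) (\<Delta> x)) \<in> bilinear_hom H H U"
    and "\<phi> \<in> linear_hom U base_module \<Longrightarrow> x \<in> carrier H \<Longrightarrow> y \<in> carrier H \<Longrightarrow>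
      \<phi> (tensor_lift U (\<lambda>a b. tensor_lift U (f a b) (\<Delta> y)) (\<Delta> x)) =
      sweedler (\<lambda>a b. sweedler (\<lambda>c d. \<phi> (f a b c d)) y) x"
proof -
  note HH = assoc_algebra_axioms assoc_algebra_axioms
  note \<Delta>c = linear_hom_closed[OF comult_linear]
  have bil: "(\<lambda>a b. tensor_lift U (f a b) (\<Delta> y)) \<in> bilinear_hom H H U" if y: "y \<in> carrier H" for y
  proof (rule bilinear_homI)
    fix a assume a: "a \<in> carrier H"
    show "(\<lambda>b. tensor_lift U (f a b) (\<Delta> y)) \<in> linear_hom H U"
      by (rule tensor_lift_param[OF HH vspace_axioms U f1[OF a] bilinear_hom_right[OF f2 a] \<Delta>c[OF y]])
  next
    fix b assume b: "b \<in> carrier H"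
    show "(\<lambda>a. tensor_lift U (f a b) (\<Delta> y)) \<in> linear_hom H U"
      by (rule tensor_lift_param[OF HH vspace_axioms U f1[OF _ b] bilinear_hom_left[OF f2 b] \<Delta>c[OF y]])
  qed
  show "(\<lambda>x y. tensor_lift U (\<lambda>a b. tensor_lift U (f a b) (\<Delta> y)) (\<Delta> x)) \<in> bilinear_hom H H U"
  proof (rule bilinear_homI)
    fix y assume y: "y \<in> carrier H"
    show "(\<lambda>x. tensor_lift U (\<lambda>a b. tensor_lift U (f a b) (\<Delta> y)) (\<Delta> x)) \<in> linear_hom H U"
      by (rule linear_hom_compose[OF comult_linear tensor_lift_linear[OF HH U bil[OF y]]])
  next
    fix x assume x: "x \<in> carrier H"
    show "(\<lambda>y. tensor_lift U (\<lambda>a b. tensor_lift U (f a b) (\<Delta> y)) (\<Delta> x)) \<in> linear_hom H U"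
      by (rule tensor_lift_param[OF HH vspace_axioms U bil
            linear_hom_compose[OF comult_linear tensor_lift_linear[OF HH U f1]] \<Delta>c[OF x]])
  qed
  assume \<phi>: "\<phi> \<in> linear_hom U base_module" and x: "x \<in> carrier H" and y: "y \<in> carrier H"
  have "\<phi> (tensor_lift U (\<lambda>a b. tensor_lift U (f a b) (\<Delta> y)) (\<Delta> x)) =
      sweedler (\<lambda>a b. \<phi> (tensor_lift U (f a b) (\<Delta> y))) x"
    by (rule sweedler_tensor_lift[OF U bil[OF y] \<phi> x])
  also have "\<dots> = sweedler (\<lambda>a b. sweedler (\<lambda>c d. \<phi> (f a b c d)) y) x"
    by (rule sweedler_cong[OF x sweedler_tensor_lift[OF U f1 \<phi> y]])
  finally show "\<phi> (tensor_lift U (\<lambda>a b. tensor_lift U (f a b) (\<Delta> y)) (\<Delta> x)) =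
      sweedler (\<lambda>a b. sweedler (\<lambda>c d. \<phi> (f a b c d)) y) x" .
qed

lemma sweedler_swap3:
  "sweedler (\<lambda>a b. sweedler (\<lambda>c d. sweedler (\<lambda>e f. g a b c d e f) z) y) x =
    sweedler (\<lambda>e f. sweedler (\<lambda>a b. sweedler (\<lambda>c d. g a b c d e f) y) x) z"
proof -
  have "(\<lambda>a b. sweedler (\<lambda>c d. sweedler (\<lambda>e f. g a b c d e f) z) y) =
      (\<lambda>a b. sweedler (\<lambda>e f. sweedler (\<lambda>c d. g a b c d e f) y) z)"
    by (intro ext) (rule sweedler_swap)
  thus ?thesis by (simp only: sweedler_swap[of _ z x])
qed

end

locale cocycle_twist = hopf_algebra H \<Delta> \<epsilon> S
  for H :: "('k::field, 'h) module" (structure) and \<Delta> \<epsilon> S +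
  fixes \<alpha> :: "'h \<Rightarrow> 'h \<Rightarrow> 'k"
  assumes cocycle: "two_cocycle H \<Delta> \<alpha>" and normalized: "normalized_cocycle H \<epsilon> \<alpha>"
begin

abbreviation twisted :: "('k, 'h) module" ("A\<^sub>\<alpha>")
  where "twisted \<equiv> twisted_algebra H \<Delta> \<alpha>"

lemma twisted_simps [simp]:
  "carrier A\<^sub>\<alpha> = carrier H" "\<one>\<^bsub>A\<^sub>\<alpha>\<^esub> = \<one>" "\<zero>\<^bsub>A\<^sub>\<alpha>\<^esub> = \<zero>" "x \<oplus>\<^bsub>A\<^sub>\<alpha>\<^esub> y = x \<oplus> y" "c \<odot>\<^bsub>A\<^sub>\<alpha>\<^esub> x = c \<odot> x"
  by (simp_all add: twisted_algebra_def)

lemma linear_hom_twisted: "linear_hom A\<^sub>\<alpha> U = linear_hom H U" "linear_hom U A\<^sub>\<alpha> = linear_hom U H"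
  unfolding linear_hom_def by simp_all

lemma bilinear_hom_twisted:
  "bilinear_hom A\<^sub>\<alpha> V U = bilinear_hom H V U" "bilinear_hom V A\<^sub>\<alpha> U = bilinear_hom V H U"
  "bilinear_hom U V A\<^sub>\<alpha> = bilinear_hom U V H"
  unfolding bilinear_hom_def linear_hom_twisted by simp_all

lemma cocycle_bilinear: "\<alpha> \<in> bilinear_forms"
  using cocycle by (simp add: two_cocycle_def)

lemmas cocycle_functional = bilinear_hom_left[OF cocycle_bilinear] bilinear_hom_right[OF cocycle_bilinear]

lemma cocycle_one: "x \<in> carrier H \<Longrightarrow> \<alpha> x \<one> = \<epsilon> x" "x \<in> carrier H \<Longrightarrow> \<alpha> \<one> x = \<epsilon> x"
  using normalized by (simp_all add: normalized_cocycle_def)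

lemmas functional_intros = functional_mult_left functional_mult_right functional_sweedler_param
  cocycle_functional functional_of_mult[OF cocycle_functional(1)] functional_of_mult[OF cocycle_functional(2)]

lemma sweedler_cocycle:
  assumes x: "x \<in> carrier H" and y: "y \<in> carrier H" and z: "z \<in> carrier H"
  shows "sweedler (\<lambda>x1 x2. sweedler (\<lambda>y1 y2. \<alpha> x1 y1 * \<alpha> (x2 \<otimes> y2) z) y) x =
    sweedler (\<lambda>y1 y2. sweedler (\<lambda>z1 z2. \<alpha> y1 z1 * \<alpha> x (y2 \<otimes> z2)) z) y"
proof -
  \<comment> \<open>The identity of k is the functional that turns lifts with values in k into
    scalar sums.\<close>
  have id: "(\<lambda>c. c) \<in> linear_hom base_module (base_module :: ('k, 'k) module)"
    by (rule linear_homI) simp_all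
  have "tensor_lift base_module (\<lambda>x1 x2. tensor_lift base_module
        (\<lambda>y1 y2. \<alpha> x1 y1 * \<alpha> (x2 \<otimes> y2) z) (\<Delta> y)) (\<Delta> x) =
      tensor_lift base_module (\<lambda>y1 y2. tensor_lift base_module
        (\<lambda>z1 z2. \<alpha> y1 z1 * \<alpha> x (y2 \<otimes> z2)) (\<Delta> z)) (\<Delta> y)"
    using cocycle x y z by (simp add: two_cocycle_def)
  also have "\<dots> = sweedler (\<lambda>y1 y2. sweedler (\<lambda>z1 z2. \<alpha> y1 z1 * \<alpha> x (y2 \<otimes> z2)) z) y"
    by (rule nested_tensor_lift(2)[OF base_vspace _ _ id y z])
      (intro bilinear_homI functional_intros x; (assumption | rule m_closed x; assumption))+
  also have "tensor_lift base_module (\<lambda>x1 x2. tensor_lift base_module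
        (\<lambda>y1 y2. \<alpha> x1 y1 * \<alpha> (x2 \<otimes> y2) z) (\<Delta> y)) (\<Delta> x) =
      sweedler (\<lambda>x1 x2. sweedler (\<lambda>y1 y2. \<alpha> x1 y1 * \<alpha> (x2 \<otimes> y2) z) y) x"
    by (rule nested_tensor_lift(2)[OF base_vspace _ _ id x y])
      (intro bilinear_homI functional_intros z; (assumption | rule m_closed z; assumption))+
  finally show ?thesis .
qed

lemma twisted_mult_aux:
  assumes "a \<in> carrier H" "b \<in> carrier H"
  shows "(\<lambda>c d. \<alpha> a c \<odot> (b \<otimes> d)) \<in> bilinear_hom H H H" "(\<lambda>c d. \<alpha> c a \<odot> (d \<otimes> b)) \<in> bilinear_hom H H H"
  using assms linear_hom_add[OF cocycle_functional(1)[OF assms(1)]] linear_hom_scale[OF cocycle_functional(1)[OF assms(1)]]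
    linear_hom_add[OF cocycle_functional(2)[OF assms(1)]] linear_hom_scale[OF cocycle_functional(2)[OF assms(1)]]
  by (intro bilinear_homI linear_homI; simp add: scale_add_left scale_add_right scale_scale l_distr r_distr
      smult_mult_left smult_mult_right mult.commute)+

lemma twisted_mult_bilinear: "(\<lambda>x y. x \<otimes>\<^bsub>A\<^sub>\<alpha>\<^esub> y) \<in> bilinear_hom H H H"
  unfolding twisted_algebra_def monoid.simps partial_object.simps ring.simps
  by simp (rule nested_tensor_lift(1)[OF vspace_axioms twisted_mult_aux])

lemma twisted_mult_functional:
  assumes "\<phi> \<in> functionals" "x \<in> carrier H" "y \<in> carrier H"
  shows "\<phi> (x \<otimes>\<^bsub>A\<^sub>\<alpha>\<^esub> y) = sweedler (\<lambda>a b. sweedler (\<lambda>c d. \<alpha> a c * \<phi> (b \<otimes> d)) y) x"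
proof -
  have "\<phi> (x \<otimes>\<^bsub>A\<^sub>\<alpha>\<^esub> y) = sweedler (\<lambda>a b. sweedler (\<lambda>c d. \<phi> (\<alpha> a c \<odot> (b \<otimes> d))) y) x"
    using nested_tensor_lift(2)[OF vspace_axioms twisted_mult_aux assms]
    by (simp add: twisted_algebra_def)
  also have "\<dots> = sweedler (\<lambda>a b. sweedler (\<lambda>c d. \<alpha> a c * \<phi> (b \<otimes> d)) y) x"
    by (intro sweedler_cong assms(2,3)) (simp add: linear_hom_scale[OF assms(1)])
  finally show ?thesis .
qed

lemma twisted_closed [simp]: "x \<in> carrier H \<Longrightarrow> y \<in> carrier H \<Longrightarrow> x \<otimes>\<^bsub>A\<^sub>\<alpha>\<^esub> y \<in> carrier H"
  by (rule bilinear_hom_closed[OF twisted_mult_bilinear])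

text \<open>The coproduct of a twisted product is \<alpha>(x1, y1) x2 y2 \<otimes> x3 y3. It is
  bracketed so that the inner sums form the twisted product of the first components, with x3 y3 on
  the right. Associativity and multiplicativity of the coaction both start from this form.\<close>

lemma sweedler_twisted_mult:
  assumes f: "f \<in> bilinear_forms" and x: "x \<in> carrier H" and y: "y \<in> carrier H"
  shows "sweedler f (x \<otimes>\<^bsub>A\<^sub>\<alpha>\<^esub> y) =
    sweedler (\<lambda>l x3. sweedler (\<lambda>m y3. sweedler (\<lambda>x1 x2. sweedler (\<lambda>y1 y2.
      \<alpha> x1 y1 * f (x2 \<otimes> y2) (x3 \<otimes> y3)) m) l) y) x"
proof -
  note fl = bilinear_hom_left[OF f] and fr = bilinear_hom_right[OF f]
  have "sweedler f (x \<otimes>\<^bsub>A\<^sub>\<alpha>\<^esub> y) = sweedler (\<lambda>x1 r. sweedler (\<lambda>y1 s. \<alpha> x1 y1 * sweedler f (r \<otimes> s)) y) x"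
    by (rule twisted_mult_functional[OF functional_sweedler[OF f] x y])
  also have "\<dots> = sweedler (\<lambda>x1 r. sweedler (\<lambda>y1 s. sweedler (\<lambda>x2 x3. sweedler (\<lambda>y2 y3.
      \<alpha> x1 y1 * f (x2 \<otimes> y2) (x3 \<otimes> y3)) s) r) y) x"
    by (intro sweedler_cong x y) (simp only: sweedler_mult[OF f] sweedler_mult_left)
  also have "\<dots> = sweedler (\<lambda>l x3. sweedler (\<lambda>m y3. sweedler (\<lambda>x1 x2. sweedler (\<lambda>y1 y2.
      \<alpha> x1 y1 * f (x2 \<otimes> y2) (x3 \<otimes> y3)) m) l) y) x"
    by (rule sweedler_coassoc2[OF _ _ _ _ _ _ x y])
      (intro functional_mult_left functional_mult_right cocycle_functional
        functional_of_mult[OF fl] functional_of_mult[OF fr] m_closed; assumption)+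
  finally show ?thesis .
qed

text \<open>Under a functional each side becomes a sum of a cocycle expression in the first
  components times \<phi> of the product of the last components; the two cocycle expressions are the
  two sides of the cocycle identity.\<close>

lemma twisted_assoc:
  assumes x: "x \<in> carrier H" and y: "y \<in> carrier H" and z: "z \<in> carrier H"
  shows "(x \<otimes>\<^bsub>A\<^sub>\<alpha>\<^esub> y) \<otimes>\<^bsub>A\<^sub>\<alpha>\<^esub> z = x \<otimes>\<^bsub>A\<^sub>\<alpha>\<^esub> (y \<otimes>\<^bsub>A\<^sub>\<alpha>\<^esub> z)"
proof (rule functionals_separate)
  fix \<phi> assume \<phi>: "\<phi> \<in> functionals"
  note fi = functional_mult_left functional_mult_right functional_sweedler_param
    cocycle_functional functional_of_mult[OF \<phi>]
  \<comment> \<open>\<open>f\<close> and \<open>g\<close> are chosen so that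
    \<open>sweedler f w\<close> is \<phi> of the twisted product of \<open>w\<close> with
    \<open>z\<close>, and \<open>sweedler g w\<close> is \<phi> of the twisted product of
    \<open>x\<close> with \<open>w\<close>.\<close>
  define f where "f = (\<lambda>w1 w2. sweedler (\<lambda>z1 z2. \<alpha> w1 z1 * \<phi> (w2 \<otimes> z2)) z)"
  define g where "g = (\<lambda>w1 w2. sweedler (\<lambda>x1 x2. \<alpha> x1 w1 * \<phi> (x2 \<otimes> w2)) x)"
  have f: "f \<in> bilinear_forms" unfolding f_def
    by (intro bilinear_homI fi z; assumption)
  have g: "g \<in> bilinear_forms" unfolding g_def
    by (intro bilinear_homI fi x; assumption)
  \<comment> \<open>\<open>?K\<close> and \<open>?L\<close> are the two sides of the cocycle
    identity at the arguments \<open>l\<close>, \<open>m\<close>, \<open>n\<close>.\<close>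
  let ?K = "\<lambda>l m n. sweedler (\<lambda>x1 x2. sweedler (\<lambda>y1 y2. \<alpha> x1 y1 * \<alpha> (x2 \<otimes> y2) n) m) l"
  let ?L = "\<lambda>l m n. sweedler (\<lambda>y1 y2. sweedler (\<lambda>z1 z2. \<alpha> y1 z1 * \<alpha> l (y2 \<otimes> z2)) n) m"
  have "\<phi> ((x \<otimes>\<^bsub>A\<^sub>\<alpha>\<^esub> y) \<otimes>\<^bsub>A\<^sub>\<alpha>\<^esub> z) = sweedler f (x \<otimes>\<^bsub>A\<^sub>\<alpha>\<^esub> y)"
    unfolding f_def by (rule twisted_mult_functional[OF \<phi> twisted_closed[OF x y] z])
  also have "\<dots> = sweedler (\<lambda>l x3. sweedler (\<lambda>m y3. sweedler (\<lambda>x1 x2. sweedler (\<lambda>y1 y2.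
      \<alpha> x1 y1 * f (x2 \<otimes> y2) (x3 \<otimes> y3)) m) l) y) x"
    by (rule sweedler_twisted_mult[OF f x y])
  also have "\<dots> = sweedler (\<lambda>l x3. sweedler (\<lambda>m y3. sweedler (\<lambda>n z3. ?K l m n * \<phi> ((x3 \<otimes> y3) \<otimes> z3)) z) y) x"
    unfolding f_def sweedler_mult_left sweedler_mult_right sweedler_swap3[of _ z] by (simp only: mult.assoc)
  \<comment> \<open>The cocycle identity replaces \<open>?K\<close> by \<open>?L\<close>, while
    associativity of H rebrackets the product of the last components.\<close>
  also have "\<dots> = sweedler (\<lambda>l x3. sweedler (\<lambda>m y3. sweedler (\<lambda>n z3. ?L l m n * \<phi> (x3 \<otimes> (y3 \<otimes> z3))) z) y) x"
    by (intro sweedler_cong x y z) (simp only: sweedler_cocycle m_assoc)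
  also have "\<dots> = sweedler (\<lambda>m y3. sweedler (\<lambda>n z3. sweedler (\<lambda>l x3. ?L l m n * \<phi> (x3 \<otimes> (y3 \<otimes> z3))) x) z) y"
    by (rule sweedler_swap3[symmetric])
  also have "\<dots> = sweedler (\<lambda>m y3. sweedler (\<lambda>n z3. sweedler (\<lambda>y1 y2. sweedler (\<lambda>z1 z2.
      \<alpha> y1 z1 * g (y2 \<otimes> z2) (y3 \<otimes> z3)) n) m) z) y"
    unfolding g_def sweedler_mult_left sweedler_mult_right sweedler_swap3[of _ x] by (simp only: mult.assoc)
  also have "\<dots> = sweedler g (y \<otimes>\<^bsub>A\<^sub>\<alpha>\<^esub> z)"
    by (rule sweedler_twisted_mult[OF g y z, symmetric])
  also have "\<dots> = sweedler (\<lambda>x1 x2. sweedler (\<lambda>w1 w2. \<alpha> x1 w1 * \<phi> (x2 \<otimes> w2)) (y \<otimes>\<^bsub>A\<^sub>\<alpha>\<^esub> z)) x"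
    unfolding g_def by (rule sweedler_swap)
  also have "\<dots> = \<phi> (x \<otimes>\<^bsub>A\<^sub>\<alpha>\<^esub> (y \<otimes>\<^bsub>A\<^sub>\<alpha>\<^esub> z))"
    by (rule twisted_mult_functional[OF \<phi> x twisted_closed[OF y z], symmetric])
  finally show "\<phi> ((x \<otimes>\<^bsub>A\<^sub>\<alpha>\<^esub> y) \<otimes>\<^bsub>A\<^sub>\<alpha>\<^esub> z) = \<phi> (x \<otimes>\<^bsub>A\<^sub>\<alpha>\<^esub> (y \<otimes>\<^bsub>A\<^sub>\<alpha>\<^esub> z))" .
qed (rule twisted_closed x y z)+

text \<open>As the coproduct of the unit is 1 \<otimes> 1, one argument of the cocycle becomes the
  unit; normalization turns it into the counit, and the left counit law finishes both cases.\<close>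

lemma twisted_one:
  assumes x: "x \<in> carrier H"
  shows "\<one> \<otimes>\<^bsub>A\<^sub>\<alpha>\<^esub> x = x" "x \<otimes>\<^bsub>A\<^sub>\<alpha>\<^esub> \<one> = x"
proof -
  show "\<one> \<otimes>\<^bsub>A\<^sub>\<alpha>\<^esub> x = x"
  proof (rule functionals_separate)
    fix \<phi> assume \<phi>: "\<phi> \<in> functionals"
    note fi = functional_mult_left functional_mult_right functional_sweedler_param
      cocycle_functional functional_of_mult[OF \<phi>]
    have bil: "(\<lambda>a b. sweedler (\<lambda>c d. \<alpha> a c * \<phi> (b \<otimes> d)) x) \<in> bilinear_forms"
      by (intro bilinear_homI fi x; assumption)
    have "\<phi> (\<one> \<otimes>\<^bsub>A\<^sub>\<alpha>\<^esub> x) = sweedler (\<lambda>c d. \<alpha> \<one> c * \<phi> (\<one> \<otimes> d)) x"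
      unfolding twisted_mult_functional[OF \<phi> one_closed x] by (rule sweedler_one[OF bil])
    also have "\<dots> = sweedler (\<lambda>c d. \<epsilon> c * \<phi> d) x"
      by (rule sweedler_cong[OF x]) (simp add: cocycle_one)
    also have "\<dots> = \<phi> x" by (rule sweedler_counit_left[OF \<phi> x])
    finally show "\<phi> (\<one> \<otimes>\<^bsub>A\<^sub>\<alpha>\<^esub> x) = \<phi> x" .
  qed (simp_all add: x)
  show "x \<otimes>\<^bsub>A\<^sub>\<alpha>\<^esub> \<one> = x"
  proof (rule functionals_separate)
    fix \<phi> assume \<phi>: "\<phi> \<in> functionals"
    note fi = functional_mult_left functional_mult_right functional_sweedler_param
      cocycle_functional functional_of_mult[OF \<phi>]
    have bil: "(\<lambda>c d. sweedler (\<lambda>a b. \<alpha> a c * \<phi> (b \<otimes> d)) x) \<in> bilinear_forms"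
      by (intro bilinear_homI fi x; assumption)
    \<comment> \<open>The interchange makes the sum over the coproduct of the unit the outer one,
      where \<open>sweedler_one\<close> applies.\<close>
    have "\<phi> (x \<otimes>\<^bsub>A\<^sub>\<alpha>\<^esub> \<one>) = sweedler (\<lambda>c d. sweedler (\<lambda>a b. \<alpha> a c * \<phi> (b \<otimes> d)) x) \<one>"
      unfolding twisted_mult_functional[OF \<phi> x one_closed] by (rule sweedler_swap)
    also have "\<dots> = sweedler (\<lambda>a b. \<alpha> a \<one> * \<phi> (b \<otimes> \<one>)) x" by (rule sweedler_one[OF bil])
    also have "\<dots> = sweedler (\<lambda>a b. \<epsilon> a * \<phi> b) x"
      by (rule sweedler_cong[OF x]) (simp add: cocycle_one)
    also have "\<dots> = \<phi> x" by (rule sweedler_counit_left[OF \<phi> x])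
    finally show "\<phi> (x \<otimes>\<^bsub>A\<^sub>\<alpha>\<^esub> \<one>) = \<phi> x" .
  qed (simp_all add: x)
qed

lemma twisted_algebra_algebra: "assoc_algebra A\<^sub>\<alpha>"
proof (rule assoc_algebraI)
  note bl = bilinear_hom_left[OF twisted_mult_bilinear] and br = bilinear_hom_right[OF twisted_mult_bilinear]
  show "ring A\<^sub>\<alpha>"
  proof (rule ringI)
    show "abelian_group A\<^sub>\<alpha>"
    proof (rule abelian_groupI)
      fix x assume "x \<in> carrier A\<^sub>\<alpha>"
      thus "\<exists>y\<in>carrier A\<^sub>\<alpha>. y \<oplus>\<^bsub>A\<^sub>\<alpha>\<^esub> x = \<zero>\<^bsub>A\<^sub>\<alpha>\<^esub>"
        by (intro bexI[of _ "\<ominus> x"]) (simp_all add: l_neg)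
    qed (simp_all add: a_assoc, simp add: a_comm)
    show "Group.monoid A\<^sub>\<alpha>"
      by (rule monoidI) (simp_all add: twisted_assoc twisted_one)
  qed (simp_all add: linear_hom_add[OF bl] linear_hom_add[OF br])
  show "(c \<odot>\<^bsub>A\<^sub>\<alpha>\<^esub> x) \<otimes>\<^bsub>A\<^sub>\<alpha>\<^esub> y = c \<odot>\<^bsub>A\<^sub>\<alpha>\<^esub> (x \<otimes>\<^bsub>A\<^sub>\<alpha>\<^esub> y)"
    "x \<otimes>\<^bsub>A\<^sub>\<alpha>\<^esub> (c \<odot>\<^bsub>A\<^sub>\<alpha>\<^esub> y) = c \<odot>\<^bsub>A\<^sub>\<alpha>\<^esub> (x \<otimes>\<^bsub>A\<^sub>\<alpha>\<^esub> y)"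
    if "x \<in> carrier A\<^sub>\<alpha>" "y \<in> carrier A\<^sub>\<alpha>" for c x y
    using that by (simp_all add: linear_hom_scale[OF bl] linear_hom_scale[OF br])
qed (simp_all add: scale_add_left scale_add_right scale_scale)

section \<open>The coaction on the twisted algebra\<close>

lemma twisted_pure_bilinear: "pure_tensor A\<^sub>\<alpha> H \<in> bilinear_hom H H (tensor A\<^sub>\<alpha> H)"
  using pure_tensor_bilinear[OF twisted_algebra_algebra assoc_algebra_axioms]
  by (simp only: bilinear_hom_twisted)

lemma twisted_tensor_algebra: "assoc_algebra (tensor A\<^sub>\<alpha> H)"
  by (rule tensor_algebra_product[OF twisted_algebra_algebra assoc_algebra_axioms])

lemma twisted_tensor_vspace: "vspace (tensor A\<^sub>\<alpha> H)"
  by (rule assoc_algebra_vspace[OF twisted_tensor_algebra])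

lemma functional_twisted_coaction:
  assumes "\<phi> \<in> linear_hom (tensor A\<^sub>\<alpha> H) base_module" "x \<in> carrier H"
  shows "\<phi> (twisted_coaction H \<Delta> \<alpha> x) = sweedler (\<lambda>a b. \<phi> (pure_tensor A\<^sub>\<alpha> H a b)) x"
  unfolding twisted_coaction_def
  by (rule sweedler_tensor_lift[OF twisted_tensor_vspace twisted_pure_bilinear assms])

lemma twisted_coaction_linear: "twisted_coaction H \<Delta> \<alpha> \<in> linear_hom H (tensor A\<^sub>\<alpha> H)"
  unfolding twisted_coaction_def[abs_def]
  by (rule linear_hom_compose[OF comult_linear
        tensor_lift_linear[OF assoc_algebra_axioms assoc_algebra_axioms twisted_tensor_vspace twisted_pure_bilinear]])

text \<open>The coaction is the coproduct with its first factor read in the twisted algebra. In a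
  product of two such tensors the first factors are multiplied by the twisted product, and
  \<open>sweedler_twisted_mult\<close> recognizes the result as the coproduct of the twisted
  product.\<close>

lemma twisted_coaction_hom: "twisted_coaction H \<Delta> \<alpha> \<in> algebra_hom A\<^sub>\<alpha> (tensor A\<^sub>\<alpha> H)"
proof (rule algebra_homI)
  note AH = twisted_algebra_algebra assoc_algebra_axioms
  let ?T = "tensor A\<^sub>\<alpha> H" and ?\<delta> = "twisted_coaction H \<Delta> \<alpha>" and ?p = "pure_tensor A\<^sub>\<alpha> H"
  interpret T: assoc_algebra ?T by (rule twisted_tensor_algebra)
  note \<delta>c = linear_hom_closed[OF twisted_coaction_linear]
  note pc = bilinear_hom_closed[OF twisted_pure_bilinear]
  show "?\<delta> \<in> linear_hom A\<^sub>\<alpha> ?T" using twisted_coaction_linear by (simp only: linear_hom_twisted)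
  show "?\<delta> \<one>\<^bsub>A\<^sub>\<alpha>\<^esub> = \<one>\<^bsub>?T\<^esub>"
  proof (rule T.functionals_separate)
    fix \<phi> assume \<phi>: "\<phi> \<in> linear_hom ?T base_module"
    have "\<phi> (?\<delta> \<one>) = \<phi> (?p \<one> \<one>)"
      unfolding functional_twisted_coaction[OF \<phi> one_closed]
      by (rule sweedler_one[OF bilinear_hom_compose[OF twisted_pure_bilinear \<phi>]])
    thus "\<phi> (?\<delta> \<one>\<^bsub>A\<^sub>\<alpha>\<^esub>) = \<phi> \<one>\<^bsub>?T\<^esub>" using pure_tensor_one[OF AH] by simp
  qed (simp_all add: \<delta>c)
  fix x y assume "x \<in> carrier A\<^sub>\<alpha>" "y \<in> carrier A\<^sub>\<alpha>"
  hence x: "x \<in> carrier H" and y: "y \<in> carrier H" by simp_all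
  show "?\<delta> (x \<otimes>\<^bsub>A\<^sub>\<alpha>\<^esub> y) = ?\<delta> x \<otimes>\<^bsub>?T\<^esub> ?\<delta> y"
  proof (rule T.functionals_separate)
    fix \<phi> assume \<phi>: "\<phi> \<in> linear_hom ?T base_module"
    note g = bilinear_hom_compose[OF twisted_pure_bilinear \<phi>]
    have ml: "(\<lambda>C. \<phi> (C \<otimes>\<^bsub>?T\<^esub> D)) \<in> linear_hom ?T base_module"
      and mr: "(\<lambda>C. \<phi> (D \<otimes>\<^bsub>?T\<^esub> C)) \<in> linear_hom ?T base_module" if "D \<in> carrier ?T" for D
      by (rule linear_hom_compose[OF T.mult_left_linear[OF that] \<phi>], rule linear_hom_compose[OF T.mult_right_linear[OF that] \<phi>])
    have "\<phi> (?\<delta> x \<otimes>\<^bsub>?T\<^esub> ?\<delta> y) = sweedler (\<lambda>l x3. \<phi> (?p l x3 \<otimes>\<^bsub>?T\<^esub> ?\<delta> y)) x"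
      by (rule functional_twisted_coaction[OF ml[OF \<delta>c[OF y]] x])
    also have "\<dots> = sweedler (\<lambda>l x3. sweedler (\<lambda>m y3. \<phi> (?p l x3 \<otimes>\<^bsub>?T\<^esub> ?p m y3)) y) x"
      by (rule sweedler_cong[OF x functional_twisted_coaction[OF mr[OF pc] y]])
    also have "\<dots> = sweedler (\<lambda>l x3. sweedler (\<lambda>m y3. sweedler (\<lambda>x1 x2. sweedler (\<lambda>y1 y2.
        \<alpha> x1 y1 * \<phi> (?p (x2 \<otimes> y2) (x3 \<otimes> y3))) m) l) y) x"
    proof (intro sweedler_cong x y)
      fix l x3 m y3 assume c: "l \<in> carrier H" "x3 \<in> carrier H" "m \<in> carrier H" "y3 \<in> carrier H"
      have "?p l x3 \<otimes>\<^bsub>?T\<^esub> ?p m y3 = ?p (l \<otimes>\<^bsub>A\<^sub>\<alpha>\<^esub> m) (x3 \<otimes> y3)"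
        using c by (intro pure_tensor_mult[OF AH]) simp_all
      thus "\<phi> (?p l x3 \<otimes>\<^bsub>?T\<^esub> ?p m y3) = sweedler (\<lambda>x1 x2. sweedler (\<lambda>y1 y2.
        \<alpha> x1 y1 * \<phi> (?p (x2 \<otimes> y2) (x3 \<otimes> y3))) m) l"
        using twisted_mult_functional[OF bilinear_hom_left[OF g m_closed[OF c(2,4)]] c(1,3)] by simp
    qed
    also have "\<dots> = sweedler (\<lambda>a b. \<phi> (?p a b)) (x \<otimes>\<^bsub>A\<^sub>\<alpha>\<^esub> y)"
      by (rule sweedler_twisted_mult[OF g x y, symmetric])
    also have "\<dots> = \<phi> (?\<delta> (x \<otimes>\<^bsub>A\<^sub>\<alpha>\<^esub> y))"
      by (rule functional_twisted_coaction[OF \<phi> twisted_closed[OF x y], symmetric])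
    finally show "\<phi> (?\<delta> (x \<otimes>\<^bsub>A\<^sub>\<alpha>\<^esub> y)) = \<phi> (?\<delta> x \<otimes>\<^bsub>?T\<^esub> ?\<delta> y)" by simp
  qed (simp_all add: \<delta>c x y)
qed

end

section \<open>Comodule algebra maps out of the tensor algebra\<close>

context cocycle_twist
begin

abbreviation "T\<^sub>H \<equiv> tensor_algebra H"
abbreviation "S\<^sub>H \<equiv> symmetric_algebra H"
abbreviation "\<delta>\<^sub>\<alpha> \<equiv> twisted_coaction H \<Delta> \<alpha>"

text \<open>The values on generators get names, here and in \<open>universal_gen\<close>, so that
  the coaction and the universal map appear as lifts of linear maps on H.\<close>

definition coaction_gen where
  "coaction_gen x = tensor_lift (tensor T\<^sub>H H) (\<lambda>x1 x2. pure_tensor T\<^sub>H H (tensor_gen H x1) x2) (\<Delta> x)"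

definition universal_gen where
  "universal_gen x = tensor_lift (universal_target H \<Delta> \<alpha>)
    (\<lambda>x1 x2. pure_tensor S\<^sub>H A\<^sub>\<alpha> (symmetric_gen H x1) x2) (\<Delta> x)"

text \<open>The map \<mu> \<otimes> id on the tensor product with H, which occurs on one side of
  colinearity.\<close>

definition map_left where
  "map_left \<mu> = tensor_lift (tensor A\<^sub>\<alpha> H) (\<lambda>a0 a1. pure_tensor A\<^sub>\<alpha> H (\<mu> a0) a1)"

text \<open>The character at \<open>l\<close> tensored with the identity: the coefficients in the
  symmetric algebra are evaluated at \<open>l\<close>.\<close>

definition specialization where
  "specialization l = tensor_lift A\<^sub>\<alpha> (\<lambda>s a. sym_eval H l s \<odot>\<^bsub>A\<^sub>\<alpha>\<^esub> a)"

lemmas T_algebra = tensor_algebra_algebra[OF vspace_axioms]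
lemmas S_algebra = symmetric_algebra_algebra[OF vspace_axioms]
lemmas T_tensor_algebra = tensor_algebra_product[OF T_algebra assoc_algebra_axioms]

lemma universal_target_algebra: "assoc_algebra (universal_target H \<Delta> \<alpha>)"
  unfolding universal_target_def by (rule tensor_algebra_product[OF S_algebra twisted_algebra_algebra])

lemma coaction_gen_bilinear:
  "(\<lambda>x1 x2. pure_tensor T\<^sub>H H (tensor_gen H x1) x2) \<in> bilinear_hom H H (tensor T\<^sub>H H)"
  by (rule bilinear_hom_compose_left[OF pure_tensor_bilinear[OF T_algebra assoc_algebra_axioms]
        tensor_gen_linear[OF vspace_axioms]])

lemma coaction_gen_linear: "coaction_gen \<in> linear_hom H (tensor T\<^sub>H H)"
  unfolding coaction_gen_def[abs_def]
  by (rule linear_hom_compose[OF comult_linear tensor_lift_linear[OF assoc_algebra_axioms assoc_algebra_axioms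
        assoc_algebra_vspace[OF T_tensor_algebra] coaction_gen_bilinear]])

lemma coaction_eq: "tensor_algebra_coaction H \<Delta> = tensor_algebra_lift (tensor T\<^sub>H H) coaction_gen"
  by (simp add: tensor_algebra_coaction_def coaction_gen_def[abs_def])

lemma coaction_hom: "tensor_algebra_coaction H \<Delta> \<in> algebra_hom T\<^sub>H (tensor T\<^sub>H H)"
  unfolding coaction_eq by (rule tensor_algebra_lift_hom[OF vspace_axioms T_tensor_algebra coaction_gen_linear])

lemma coaction_tensor_gen:
  "x \<in> carrier H \<Longrightarrow> tensor_algebra_coaction H \<Delta> (tensor_gen H x) = coaction_gen x"
  unfolding coaction_eq by (rule tensor_algebra_lift_gen[OF vspace_axioms T_tensor_algebra coaction_gen_linear])

lemma universal_gen_bilinear: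
  "(\<lambda>x1 x2. pure_tensor S\<^sub>H A\<^sub>\<alpha> (symmetric_gen H x1) x2) \<in> bilinear_hom H H (universal_target H \<Delta> \<alpha>)"
  using bilinear_hom_compose_left[OF pure_tensor_bilinear[OF S_algebra twisted_algebra_algebra]
        symmetric_gen_linear[OF vspace_axioms]]
  unfolding universal_target_def bilinear_hom_twisted .

lemma universal_gen_linear: "universal_gen \<in> linear_hom H (universal_target H \<Delta> \<alpha>)"
  unfolding universal_gen_def[abs_def]
  by (rule linear_hom_compose[OF comult_linear tensor_lift_linear[OF assoc_algebra_axioms assoc_algebra_axioms
        assoc_algebra_vspace[OF universal_target_algebra] universal_gen_bilinear]])

lemma universal_map_eq: "universal_map H \<Delta> \<alpha> = tensor_algebra_lift (universal_target H \<Delta> \<alpha>) universal_gen"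
  by (simp add: universal_map_def universal_gen_def[abs_def])

lemma universal_map_hom: "universal_map H \<Delta> \<alpha> \<in> algebra_hom T\<^sub>H (universal_target H \<Delta> \<alpha>)"
  unfolding universal_map_eq
  by (rule tensor_algebra_lift_hom[OF vspace_axioms universal_target_algebra universal_gen_linear])

lemma universal_map_tensor_gen:
  "x \<in> carrier H \<Longrightarrow> universal_map H \<Delta> \<alpha> (tensor_gen H x) = universal_gen x"
  unfolding universal_map_eq
  by (rule tensor_algebra_lift_gen[OF vspace_axioms universal_target_algebra universal_gen_linear])

lemma tensor_gen_closed: "x \<in> carrier H \<Longrightarrow> tensor_gen H x \<in> carrier T\<^sub>H"
  by (rule linear_hom_closed[OF tensor_gen_linear[OF vspace_axioms]])

lemma map_left_bilinear:
  "\<mu> \<in> linear_hom T\<^sub>H A\<^sub>\<alpha> \<Longrightarrow> (\<lambda>a0 a1. pure_tensor A\<^sub>\<alpha> H (\<mu> a0) a1) \<in> bilinear_hom T\<^sub>H H (tensor A\<^sub>\<alpha> H)"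
  by (rule bilinear_hom_compose_left[OF pure_tensor_bilinear[OF twisted_algebra_algebra assoc_algebra_axioms]])

lemma map_left_pure:
  "\<mu> \<in> linear_hom T\<^sub>H A\<^sub>\<alpha> \<Longrightarrow> t \<in> carrier T\<^sub>H \<Longrightarrow> x \<in> carrier H \<Longrightarrow>
    map_left \<mu> (pure_tensor T\<^sub>H H t x) = pure_tensor A\<^sub>\<alpha> H (\<mu> t) x"
  unfolding map_left_def
  by (rule tensor_lift_pure[OF T_algebra assoc_algebra_axioms twisted_tensor_vspace map_left_bilinear])

lemma map_left_hom:
  assumes \<mu>: "\<mu> \<in> algebra_hom T\<^sub>H A\<^sub>\<alpha>"
  shows "map_left \<mu> \<in> algebra_hom (tensor T\<^sub>H H) (tensor A\<^sub>\<alpha> H)"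
proof -
  note \<mu>l = algebra_hom_linear[OF \<mu>]
  interpret T: assoc_algebra T\<^sub>H by (rule T_algebra)
  show ?thesis
  proof (rule tensor_algebra_homI[OF T_algebra assoc_algebra_axioms twisted_tensor_algebra])
    show "map_left \<mu> \<in> linear_hom (tensor T\<^sub>H H) (tensor A\<^sub>\<alpha> H)"
      unfolding map_left_def
      by (rule tensor_lift_linear[OF T_algebra assoc_algebra_axioms twisted_tensor_vspace map_left_bilinear[OF \<mu>l]])
    show "map_left \<mu> (pure_tensor T\<^sub>H H \<one>\<^bsub>T\<^sub>H\<^esub> \<one>) = \<one>\<^bsub>tensor A\<^sub>\<alpha> H\<^esub>"
      using pure_tensor_one[OF twisted_algebra_algebra assoc_algebra_axioms]
      by (simp add: map_left_pure[OF \<mu>l] algebra_hom_one[OF \<mu>])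
    fix t x t' x' assume "t \<in> carrier T\<^sub>H" "x \<in> carrier H" "t' \<in> carrier T\<^sub>H" "x' \<in> carrier H"
    thus "map_left \<mu> (pure_tensor T\<^sub>H H (t \<otimes>\<^bsub>T\<^sub>H\<^esub> t') (x \<otimes> x')) =
        map_left \<mu> (pure_tensor T\<^sub>H H t x) \<otimes>\<^bsub>tensor A\<^sub>\<alpha> H\<^esub> map_left \<mu> (pure_tensor T\<^sub>H H t' x')"
      by (simp add: map_left_pure[OF \<mu>l] algebra_hom_mult[OF \<mu>] linear_hom_closed[OF \<mu>l]
          pure_tensor_mult[OF twisted_algebra_algebra assoc_algebra_axioms, OF linear_hom_closed[OF \<mu>l] _ linear_hom_closed[OF \<mu>l]])
  qed
qed

text \<open>Since both coactions are algebra maps, the two sides of colinearity are algebra maps out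
  of the tensor algebra, so they are equal as soon as they agree on generators.\<close>

lemma comodule_hom_iff:
  assumes \<mu>: "\<mu> \<in> algebra_hom T\<^sub>H A\<^sub>\<alpha>"
  shows "\<mu> \<in> comodule_algebra_hom H T\<^sub>H (tensor_algebra_coaction H \<Delta>) A\<^sub>\<alpha> \<delta>\<^sub>\<alpha> \<longleftrightarrow>
    (\<forall>x\<in>carrier H. \<delta>\<^sub>\<alpha> (\<mu> (tensor_gen H x)) = map_left \<mu> (coaction_gen x))"
proof -
  have "(\<forall>P\<in>carrier T\<^sub>H. \<delta>\<^sub>\<alpha> (\<mu> P) = map_left \<mu> (tensor_algebra_coaction H \<Delta> P)) \<longleftrightarrow>
    (\<forall>x\<in>carrier H. \<delta>\<^sub>\<alpha> (\<mu> (tensor_gen H x)) = map_left \<mu> (coaction_gen x))" (is "?l \<longleftrightarrow> ?r")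
  proof
    assume ?l
    thus ?r by (intro ballI) (simp only: coaction_tensor_gen[symmetric] tensor_gen_closed)
  next
    assume r: ?r
    show ?l
    proof
      fix P assume P: "P \<in> carrier T\<^sub>H"
      show "\<delta>\<^sub>\<alpha> (\<mu> P) = map_left \<mu> (tensor_algebra_coaction H \<Delta> P)"
        by (rule tensor_algebra_hom_eq[OF vspace_axioms twisted_tensor_algebra
              algebra_hom_compose[OF \<mu> twisted_coaction_hom] algebra_hom_compose[OF coaction_hom map_left_hom[OF \<mu>]] _ P])
          (use r in \<open>simp only: coaction_tensor_gen\<close>)
    qed
  qed
  thus ?thesis using \<mu> by (simp add: comodule_algebra_hom_def map_left_def)
qed

section \<open>Specializing the universal map at a linear form\<close>

lemma specialization_pure:
  assumes "l \<in> functionals" "s \<in> carrier S\<^sub>H" "a \<in> carrier H"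
  shows "specialization l (pure_tensor S\<^sub>H A\<^sub>\<alpha> s a) = sym_eval H l s \<odot> a"
  unfolding specialization_def
  by (subst tensor_lift_pure[OF S_algebra twisted_algebra_algebra assoc_algebra_vspace[OF twisted_algebra_algebra]
    scale_bilinear(2)[OF assoc_algebra_vspace[OF twisted_algebra_algebra]
      algebra_hom_linear[OF sym_eval_aux(1)[OF vspace_axioms assms(1)]]]]) (simp_all add: assms)

lemma specialization_linear:
  assumes "l \<in> functionals"
  shows "specialization l \<in> linear_hom (universal_target H \<Delta> \<alpha>) A\<^sub>\<alpha>"
  unfolding specialization_def universal_target_def
  by (rule tensor_lift_linear[OF S_algebra twisted_algebra_algebra assoc_algebra_vspace[OF twisted_algebra_algebra]
    scale_bilinear(2)[OF assoc_algebra_vspace[OF twisted_algebra_algebra]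
      algebra_hom_linear[OF sym_eval_aux(1)[OF vspace_axioms assms]]]])

text \<open>On pure tensors the two scalars produced by the character can be pulled out of the
  twisted product and multiply to the character of the product.\<close>

lemma specialization_hom:
  assumes l: "l \<in> functionals"
  shows "specialization l \<in> algebra_hom (universal_target H \<Delta> \<alpha>) A\<^sub>\<alpha>"
  unfolding universal_target_def
proof (rule tensor_algebra_homI[OF S_algebra twisted_algebra_algebra twisted_algebra_algebra])
  interpret S': assoc_algebra S\<^sub>H by (rule S_algebra)
  interpret A: assoc_algebra A\<^sub>\<alpha> by (rule twisted_algebra_algebra)
  note e = sym_eval_aux(1)[OF vspace_axioms l]
  show "specialization l \<in> linear_hom (tensor S\<^sub>H A\<^sub>\<alpha>) A\<^sub>\<alpha>"
    using specialization_linear[OF l] by (simp only: universal_target_def)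
  show "specialization l (pure_tensor S\<^sub>H A\<^sub>\<alpha> \<one>\<^bsub>S\<^sub>H\<^esub> \<one>\<^bsub>A\<^sub>\<alpha>\<^esub>) = \<one>\<^bsub>A\<^sub>\<alpha>\<^esub>"
    by (simp add: specialization_pure[OF l] algebra_hom_one[OF e])
  fix s a s' a' assume "s \<in> carrier S\<^sub>H" "a \<in> carrier A\<^sub>\<alpha>" "s' \<in> carrier S\<^sub>H" "a' \<in> carrier A\<^sub>\<alpha>"
  thus "specialization l (pure_tensor S\<^sub>H A\<^sub>\<alpha> (s \<otimes>\<^bsub>S\<^sub>H\<^esub> s') (a \<otimes>\<^bsub>A\<^sub>\<alpha>\<^esub> a')) =
      specialization l (pure_tensor S\<^sub>H A\<^sub>\<alpha> s a) \<otimes>\<^bsub>A\<^sub>\<alpha>\<^esub> specialization l (pure_tensor S\<^sub>H A\<^sub>\<alpha> s' a')"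
    using A.smult_mult_left A.smult_mult_right
    by (simp add: specialization_pure[OF l] algebra_hom_mult[OF e] scale_scale mult.commute)
qed

text \<open>The map \<mu>_l of the overview, built as a composite so that it visibly vanishes
  wherever the universal map does.\<close>

definition generic_map where
  "generic_map l P = specialization l (universal_map H \<Delta> \<alpha> P)"

lemma generic_map_hom: "l \<in> functionals \<Longrightarrow> generic_map l \<in> algebra_hom T\<^sub>H A\<^sub>\<alpha>"
  unfolding generic_map_def[abs_def]
  by (rule algebra_hom_compose[OF universal_map_hom specialization_hom])

lemma functional_generic_map_gen:
  assumes l: "l \<in> functionals" and \<phi>: "\<phi> \<in> functionals" and x: "x \<in> carrier H"
  shows "\<phi> (generic_map l (tensor_gen H x)) = sweedler (\<lambda>x1 x2. l x1 * \<phi> x2) x"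
proof -
  have \<phi>s: "(\<lambda>u. \<phi> (specialization l u)) \<in> linear_hom (universal_target H \<Delta> \<alpha>) base_module"
    by (rule linear_hom_compose[OF specialization_linear[OF l]]) (simp only: linear_hom_twisted \<phi>)
  have "\<phi> (generic_map l (tensor_gen H x)) =
      sweedler (\<lambda>x1 x2. \<phi> (specialization l (pure_tensor S\<^sub>H A\<^sub>\<alpha> (symmetric_gen H x1) x2))) x"
    unfolding generic_map_def universal_map_tensor_gen[OF x] universal_gen_def
    by (rule sweedler_tensor_lift[OF assoc_algebra_vspace[OF universal_target_algebra] universal_gen_bilinear \<phi>s x])
  also have "\<dots> = sweedler (\<lambda>x1 x2. l x1 * \<phi> x2) x"
  proof (rule sweedler_cong[OF x])
    fix a b assume a: "a \<in> carrier H" and b: "b \<in> carrier H"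
    show "\<phi> (specialization l (pure_tensor S\<^sub>H A\<^sub>\<alpha> (symmetric_gen H a) b)) = l a * \<phi> b"
      using specialization_pure[OF l linear_hom_closed[OF symmetric_gen_linear[OF vspace_axioms] a] b]
      by (simp add: sym_eval_gen[OF vspace_axioms l a] linear_hom_scale[OF \<phi>] b)
  qed
  finally show ?thesis .
qed

lemma generic_map_gen_closed:
  "l \<in> functionals \<Longrightarrow> x \<in> carrier H \<Longrightarrow> generic_map l (tensor_gen H x) \<in> carrier H"
  using linear_hom_closed[OF algebra_hom_linear[OF generic_map_hom] tensor_gen_closed] by simp

lemma functional_map_left_gen:
  assumes \<mu>: "\<mu> \<in> algebra_hom T\<^sub>H A\<^sub>\<alpha>" and \<phi>: "\<phi> \<in> linear_hom (tensor A\<^sub>\<alpha> H) base_module" and x: "x \<in> carrier H"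
  shows "\<phi> (map_left \<mu> (coaction_gen x)) = sweedler (\<lambda>x1 x2. \<phi> (pure_tensor A\<^sub>\<alpha> H (\<mu> (tensor_gen H x1)) x2)) x"
proof -
  note lin = linear_hom_compose[OF algebra_hom_linear[OF map_left_hom[OF \<mu>]] \<phi>]
  have "\<phi> (map_left \<mu> (coaction_gen x)) =
      sweedler (\<lambda>x1 x2. \<phi> (map_left \<mu> (pure_tensor T\<^sub>H H (tensor_gen H x1) x2))) x"
    unfolding coaction_gen_def
    by (rule sweedler_tensor_lift[OF assoc_algebra_vspace[OF T_tensor_algebra] coaction_gen_bilinear lin x])
  also have "\<dots> = sweedler (\<lambda>x1 x2. \<phi> (pure_tensor A\<^sub>\<alpha> H (\<mu> (tensor_gen H x1)) x2)) x"
    by (rule sweedler_cong[OF x]) (simp only: map_left_pure[OF algebra_hom_linear[OF \<mu>] tensor_gen_closed])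
  finally show ?thesis .
qed

text \<open>On a generator both sides of colinearity amount to l(x1) x2 \<otimes> x3, bracketed in
  two ways, so coassociativity identifies them.\<close>

lemma generic_map_comodule_hom:
  assumes l: "l \<in> functionals"
  shows "generic_map l \<in> comodule_algebra_hom H T\<^sub>H (tensor_algebra_coaction H \<Delta>) A\<^sub>\<alpha> \<delta>\<^sub>\<alpha>"
  unfolding comodule_hom_iff[OF generic_map_hom[OF l]]
proof
  interpret AH: assoc_algebra "tensor A\<^sub>\<alpha> H" by (rule twisted_tensor_algebra)
  fix x assume x: "x \<in> carrier H"
  note gx = generic_map_gen_closed[OF l]
  show "\<delta>\<^sub>\<alpha> (generic_map l (tensor_gen H x)) = map_left (generic_map l) (coaction_gen x)"
  proof (rule AH.functionals_separate)
    show "\<delta>\<^sub>\<alpha> (generic_map l (tensor_gen H x)) \<in> carrier (tensor A\<^sub>\<alpha> H)"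
      by (rule linear_hom_closed[OF twisted_coaction_linear gx[OF x]])
    show "map_left (generic_map l) (coaction_gen x) \<in> carrier (tensor A\<^sub>\<alpha> H)"
      by (rule linear_hom_closed[OF algebra_hom_linear[OF map_left_hom[OF generic_map_hom[OF l]]]
            linear_hom_closed[OF coaction_gen_linear x]])
    fix \<phi> assume \<phi>: "\<phi> \<in> linear_hom (tensor A\<^sub>\<alpha> H) base_module"
    let ?g = "\<lambda>a b. \<phi> (pure_tensor A\<^sub>\<alpha> H a b)"
    note g = bilinear_hom_compose[OF twisted_pure_bilinear \<phi>]
    have "\<phi> (\<delta>\<^sub>\<alpha> (generic_map l (tensor_gen H x))) = sweedler ?g (generic_map l (tensor_gen H x))"
      by (rule functional_twisted_coaction[OF \<phi> gx[OF x]])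
    also have "\<dots> = sweedler (\<lambda>x1 r. l x1 * sweedler ?g r) x"
      by (rule functional_generic_map_gen[OF l functional_sweedler[OF g] x])
    also have "\<dots> = sweedler (\<lambda>x1 r. sweedler (\<lambda>x2 x3. l x1 * ?g x2 x3) r) x"
      unfolding sweedler_mult_left ..
    also have "\<dots> = sweedler (\<lambda>r x3. sweedler (\<lambda>x1 x2. l x1 * ?g x2 x3) r) x"
      by (rule sweedler_coassoc[symmetric, OF _ _ _ x])
        (rule functional_mult_right[OF l] functional_mult_left bilinear_hom_left[OF g] bilinear_hom_right[OF g]; assumption?)+
    also have "\<dots> = sweedler (\<lambda>r x3. ?g (generic_map l (tensor_gen H r)) x3) x"
      by (rule sweedler_cong[OF x]) (rule functional_generic_map_gen[OF l bilinear_hom_left[OF g], symmetric])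
    also have "\<dots> = \<phi> (map_left (generic_map l) (coaction_gen x))"
      by (rule functional_map_left_gen[OF generic_map_hom[OF l] \<phi> x, symmetric])
    finally show "\<phi> (\<delta>\<^sub>\<alpha> (generic_map l (tensor_gen H x))) = \<phi> (map_left (generic_map l) (coaction_gen x))" .
  qed
qed

text \<open>Here \<open>\<epsilon>\<close> serves as a linear form on the space underlying the
  twisted algebra, where it need not be multiplicative. Agreement of \<mu> with
  \<open>generic_map l\<close> is established on generators and extends because both are algebra
  maps.\<close>

lemma comodule_hom_generic:
  assumes "\<mu> \<in> comodule_algebra_hom H T\<^sub>H (tensor_algebra_coaction H \<Delta>) A\<^sub>\<alpha> \<delta>\<^sub>\<alpha>"
  obtains l where "l \<in> functionals" "\<And>P. P \<in> carrier T\<^sub>H \<Longrightarrow> \<mu> P = generic_map l P"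
proof -
  have \<mu>: "\<mu> \<in> algebra_hom T\<^sub>H A\<^sub>\<alpha>" using assms by (simp add: comodule_algebra_hom_def)
  have com: "\<delta>\<^sub>\<alpha> (\<mu> (tensor_gen H x)) = map_left \<mu> (coaction_gen x)" if "x \<in> carrier H" for x
    using assms that unfolding comodule_hom_iff[OF \<mu>] by simp
  have \<mu>l: "\<mu> \<in> linear_hom T\<^sub>H H" using algebra_hom_linear[OF \<mu>] by (simp only: linear_hom_twisted)
  define l where "l = (\<lambda>x. \<epsilon> (\<mu> (tensor_gen H x)))"
  have l: "l \<in> functionals" unfolding l_def
    by (rule linear_hom_compose[OF linear_hom_compose[OF tensor_gen_linear[OF vspace_axioms] \<mu>l] counit_linear])
  have \<mu>c: "\<mu> (tensor_gen H x) \<in> carrier H" if "x \<in> carrier H" for x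
    by (rule linear_hom_closed[OF \<mu>l tensor_gen_closed[OF that]])
  have gen: "\<mu> (tensor_gen H x) = generic_map l (tensor_gen H x)" if x: "x \<in> carrier H" for x
  proof (rule functionals_separate[OF \<mu>c[OF x] generic_map_gen_closed[OF l x]])
    fix \<phi> assume \<phi>: "\<phi> \<in> functionals"
    have b: "(\<lambda>a b. \<epsilon> a * \<phi> b) \<in> bilinear_hom A\<^sub>\<alpha> H base_module"
      unfolding bilinear_hom_twisted
      by (intro bilinear_homI functional_mult_left functional_mult_right \<phi> counit_linear)
    note AH = twisted_algebra_algebra assoc_algebra_axioms
    \<comment> \<open>\<open>\<psi>\<close> is \<epsilon> \<otimes> \<phi>. On the coaction of an
      element it returns \<phi> of that element by the left counit law; on the other side of
      colinearity it gives the sum of l(x1) \<phi>(x2).\<close>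
    define \<psi> where "\<psi> = tensor_lift base_module (\<lambda>a b. \<epsilon> a * \<phi> b)"
    have \<psi>: "\<psi> \<in> linear_hom (tensor A\<^sub>\<alpha> H) base_module"
      unfolding \<psi>_def by (rule tensor_lift_linear[OF AH base_vspace b])
    have \<psi>p: "\<psi> (pure_tensor A\<^sub>\<alpha> H a c) = \<epsilon> a * \<phi> c" if "a \<in> carrier H" "c \<in> carrier H" for a c
      unfolding \<psi>_def using that by (intro tensor_lift_pure[OF AH base_vspace b]) simp_all
    have "\<phi> (\<mu> (tensor_gen H x)) = sweedler (\<lambda>a b. \<epsilon> a * \<phi> b) (\<mu> (tensor_gen H x))"
      by (rule sweedler_counit_left[OF \<phi> \<mu>c[OF x], symmetric])
    also have "\<dots> = sweedler (\<lambda>a b. \<psi> (pure_tensor A\<^sub>\<alpha> H a b)) (\<mu> (tensor_gen H x))"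
      by (rule sweedler_cong[OF \<mu>c[OF x] \<psi>p[symmetric]])
    also have "\<dots> = \<psi> (\<delta>\<^sub>\<alpha> (\<mu> (tensor_gen H x)))"
      by (rule functional_twisted_coaction[OF \<psi> \<mu>c[OF x], symmetric])
    also have "\<dots> = sweedler (\<lambda>x1 x2. \<psi> (pure_tensor A\<^sub>\<alpha> H (\<mu> (tensor_gen H x1)) x2)) x"
      unfolding com[OF x] by (rule functional_map_left_gen[OF \<mu> \<psi> x])
    also have "\<dots> = sweedler (\<lambda>x1 x2. l x1 * \<phi> x2) x"
      unfolding l_def by (rule sweedler_cong[OF x \<psi>p[OF \<mu>c]])
    also have "\<dots> = \<phi> (generic_map l (tensor_gen H x))"
      by (rule functional_generic_map_gen[OF l \<phi> x, symmetric])
    finally show "\<phi> (\<mu> (tensor_gen H x)) = \<phi> (generic_map l (tensor_gen H x))" .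
  qed
  show ?thesis
    by (rule that[OF l tensor_algebra_hom_eq[OF vspace_axioms twisted_algebra_algebra \<mu> generic_map_hom[OF l] gen]])
qed

text \<open>Two separations are combined: functionals \<phi> on the twisted algebra reduce the claim
  to elements of the symmetric algebra, and evaluations at linear forms detect these.\<close>

lemma specialization_separation:
  assumes inf: "infinite (UNIV :: 'k set)" and z: "z \<in> carrier (universal_target H \<Delta> \<alpha>)"
    and van: "\<And>l. l \<in> functionals \<Longrightarrow> specialization l z = \<zero>"
  shows "z = \<zero>\<^bsub>universal_target H \<Delta> \<alpha>\<^esub>"
  unfolding universal_target_def
proof (rule tensor_separation[OF S_algebra twisted_algebra_algebra z[unfolded universal_target_def]])
  note SA = S_algebra twisted_algebra_algebra
  note Sv = assoc_algebra_vspace[OF S_algebra]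
  fix \<phi> assume "\<phi> \<in> linear_hom A\<^sub>\<alpha> base_module"
  hence \<phi>: "\<phi> \<in> functionals" and \<phi>': "\<phi> \<in> linear_hom A\<^sub>\<alpha> base_module" by (simp_all only: linear_hom_twisted)
  let ?r = "tensor_lift S\<^sub>H (\<lambda>s a. \<phi> a \<odot>\<^bsub>S\<^sub>H\<^esub> s)"
  note b = scale_bilinear(1)[OF Sv \<phi>']
  have r: "?r \<in> linear_hom (universal_target H \<Delta> \<alpha>) S\<^sub>H" unfolding universal_target_def
    by (rule tensor_lift_linear[OF SA Sv b])
  show "?r z = \<zero>\<^bsub>S\<^sub>H\<^esub>"
  proof (rule symmetric_algebra_separation[OF inf vspace_axioms linear_hom_closed[OF r z]])
    fix l assume l: "l \<in> functionals"
    note e = algebra_hom_linear[OF sym_eval_aux(1)[OF vspace_axioms l]]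
    \<comment> \<open>Evaluation acts on the first tensor factor and \<phi> on the second, so they
      commute; hence the vanishing of the specialization gives that of each evaluated slice.\<close>
    have "sym_eval H l (?r z) = \<phi> (specialization l z)"
    proof (rule tensor_linear_eq[OF SA linear_hom_compose[OF r[unfolded universal_target_def] e]
          linear_hom_compose[OF specialization_linear[OF l, unfolded universal_target_def] \<phi>'] _ z[unfolded universal_target_def]])
      fix s a assume s: "s \<in> carrier S\<^sub>H" and "a \<in> carrier A\<^sub>\<alpha>"
      hence a: "a \<in> carrier H" by simp
      show "sym_eval H l (?r (pure_tensor S\<^sub>H A\<^sub>\<alpha> s a)) = \<phi> (specialization l (pure_tensor S\<^sub>H A\<^sub>\<alpha> s a))"
        using tensor_lift_pure[OF SA Sv b s] a s
        by (simp add: specialization_pure[OF l s a] linear_hom_scale[OF \<phi> a] linear_hom_scale[OF e s] mult.commute)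
    qed
    also have "\<dots> = 0"
      using linear_hom_zero[OF vspace_axioms base_vspace \<phi>] by (simp add: van[OF l])
    finally show "sym_eval H l (?r z) = 0" .
  qed
qed

lemma H_identity_iff:
  assumes inf: "infinite (UNIV :: 'k set)" and P: "P \<in> carrier T\<^sub>H"
  shows "H_identity H \<Delta> A\<^sub>\<alpha> \<delta>\<^sub>\<alpha> P \<longleftrightarrow> universal_map H \<Delta> \<alpha> P = \<zero>\<^bsub>universal_target H \<Delta> \<alpha>\<^esub>"
proof
  assume id: "H_identity H \<Delta> A\<^sub>\<alpha> \<delta>\<^sub>\<alpha> P"
  show "universal_map H \<Delta> \<alpha> P = \<zero>\<^bsub>universal_target H \<Delta> \<alpha>\<^esub>"
  proof (rule specialization_separation[OF inf linear_hom_closed[OF algebra_hom_linear[OF universal_map_hom] P]])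
    fix l assume l: "l \<in> functionals"
    have "generic_map l P = \<zero>\<^bsub>A\<^sub>\<alpha>\<^esub>"
      by (rule bspec[OF conjunct2[OF id[unfolded H_identity_def]] generic_map_comodule_hom[OF l]])
    thus "specialization l (universal_map H \<Delta> \<alpha> P) = \<zero>" by (simp add: generic_map_def)
  qed
next
  assume 0: "universal_map H \<Delta> \<alpha> P = \<zero>\<^bsub>universal_target H \<Delta> \<alpha>\<^esub>"
  show "H_identity H \<Delta> A\<^sub>\<alpha> \<delta>\<^sub>\<alpha> P" unfolding H_identity_def
  proof (intro conjI ballI P)
    fix \<mu> assume \<mu>: "\<mu> \<in> comodule_algebra_hom H T\<^sub>H (tensor_algebra_coaction H \<Delta>) A\<^sub>\<alpha> \<delta>\<^sub>\<alpha>"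
    show "\<mu> P = \<zero>\<^bsub>A\<^sub>\<alpha>\<^esub>"
    proof (rule comodule_hom_generic[OF \<mu>])
      fix l assume l: "l \<in> functionals" and eq: "\<And>P. P \<in> carrier T\<^sub>H \<Longrightarrow> \<mu> P = generic_map l P"
      show "\<mu> P = \<zero>\<^bsub>A\<^sub>\<alpha>\<^esub>"
        unfolding eq[OF P] generic_map_def 0
        by (rule linear_hom_zero[OF assoc_algebra_vspace[OF universal_target_algebra]
              assoc_algebra_vspace[OF twisted_algebra_algebra] specialization_linear[OF l]])
    qed
  qed
qed

end

theorem theorem3p2:
  fixes H :: "('k::field, 'h) module"
    and \<Delta> :: "'h \<Rightarrow> ('h \<times> 'h \<Rightarrow>\<^sub>0 'k) set" and \<epsilon> :: "'h \<Rightarrow> 'k" and S :: "'h \<Rightarrow> 'h"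
    and \<alpha> :: "'h \<Rightarrow> 'h \<Rightarrow> 'k"
  assumes "infinite (UNIV :: 'k set)"
    and "hopf_algebra H \<Delta> \<epsilon> S"
    and "two_cocycle H \<Delta> \<alpha>"
    and "normalized_cocycle H \<epsilon> \<alpha>"
    and "convolution_invertible H \<Delta> \<epsilon> \<alpha>"
  shows "(\<forall>P \<in> carrier (tensor_algebra H).
            H_identity H \<Delta> (twisted_algebra H \<Delta> \<alpha>) (twisted_coaction H \<Delta> \<alpha>) P \<longleftrightarrow>
            universal_map H \<Delta> \<alpha> P = \<zero>\<^bsub>universal_target H \<Delta> \<alpha>\<^esub>) \<and>
         H_identities H \<Delta> (twisted_algebra H \<Delta> \<alpha>) (twisted_coaction H \<Delta> \<alpha>) =
           a_kernel (tensor_algebra H) (universal_target H \<Delta> \<alpha>) (universal_map H \<Delta> \<alpha>)"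
proof -
  interpret cocycle_twist H \<Delta> \<epsilon> S \<alpha>
    using assms(2-4) by (simp add: cocycle_twist_def cocycle_twist_axioms_def)
  \<comment> \<open>Membership in the tensor algebra is part of both \<open>H_identity\<close> and
    the kernel, so the equivalence on the carrier is an equality of sets.\<close>
  have "P \<in> H_identities H \<Delta> A\<^sub>\<alpha> \<delta>\<^sub>\<alpha> \<longleftrightarrow>
      P \<in> a_kernel T\<^sub>H (universal_target H \<Delta> \<alpha>) (universal_map H \<Delta> \<alpha>)" for P
    using H_identity_iff[OF assms(1), of P]
    by (simp add: H_identities_def a_kernel_def' H_identity_def conj_commute cong: conj_cong)
  thus ?thesis using H_identity_iff[OF assms(1)] by (simp add: set_eq_iff)
qed

end
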